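(* Let $r_\infty>0$. Let $\bar{\mathsf b}\in\mathfrak B$, $\bar u_{\mathsf O}>0$, and let $\bar u\in\mathfrak E$ be an admissible solution of the integral equation $u=\mathfrak g+\mathcal G(u)$ with parameters $\bar{\mathsf b},\bar u_{\mathsf O}$. Suppose that $\bar u$ satisfies condition (HL) (with $\mathcal G$ formed with $u_{\mathsf O}=\bar u_{\mathsf O}$). Then there exist positive constants $\delta,\epsilon$ such that for every $(\mathsf b,u_{\mathsf O})\in\mathfrak B\times\mathbb R$ with $$\|\mathsf b-\bar{\mathsf b}\|_{\mathfrak B}+|u_{\mathsf O}-\bar u_{\mathsf O}|\le\delta$$ there is a unique admissible solution $u$ with parameters $\mathsf b,u_{\mathsf O}$ which satisfies (HL) and $\|u-\bar u\|_{\mathfrak E}\le\epsilon$; moreover the map $(\mathsf b,u_{\mathsf O})\mapsto u$ is continuous.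
   Context: Notation: $a\vee b=\max(a,b)$. Equation of state (standing assumption): $P$ is a smooth function of $\rho>0$ with $P>0$, $dP/d\rho>0$ for $\rho>0$, and $P=\mathsf A\rho^\gamma(1+\Lambda(\mathsf A\rho^{\gamma-1}))$ for $\rho>0$, with constants $\mathsf A>0$, $1<\gamma<2$ and a smooth $\Lambda:\mathbb R\to\mathbb R$, $\Lambda(0)=0$. Put $\nu=1/(\gamma-1)\in(1,\infty)$. The enthalpy is $u=\int_0^\rho dP/\rho$; inverting, $\rho=\big(\frac{\gamma-1}{\gamma\mathsf A}\big)^\nu u^\nu(1+\Lambda_\rho(u))$, where $\Lambda_\rho$ is regarded as a smooth function on $\mathbb R$ with $\Lambda_\rho(0)=0$. For a parameter $u_{\mathsf O}>0$ put $\mathsf f(u)=(u\vee0)^\nu(1+\Lambda_\rho(u_{\mathsf O}u))$, with derivative $\mathsf f'(u)$ with respect to $u$ (both depend on $u_{\mathsf O}$). Spaces, for fixed $r_\infty>0$: $\mathfrak B=\{\mathsf b\in C^1([0,r_\infty]): \mathsf b'(0)=0\}$ with norm $\|\mathsf b\|_{L^\infty}+\|\mathsf b'\|_{L^\infty}$; $\mathfrak E$ is the space of continuous functions $u(r,\zeta)$ on $[0,r_\infty]\times[-1,1]$ with $u(0,\zeta)=u(0,0)$ and $u(r,-\zeta)=u(r,\zeta)$ for all $r,\zeta$, with the sup norm $\|\cdot\|_{\mathfrak E}$. Operators: for $f\in\mathfrak E$, $$\mathcal Kf(r,\zeta)=\frac1{4\pi}\int_{-1}^1\int_0^{r_\infty}K(r,\zeta,r',\zeta')f(r',\zeta')r'^2dr'd\zeta',$$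 $$K(r,\zeta,r',\zeta')=\int_0^{2\pi}\frac{d\beta}{\sqrt{r^2+r'^2-2rr'(\sqrt{1-\zeta^2}\sqrt{1-\zeta'^2}\cos\beta+\zeta\zeta')}}.$$ (Equivalently, the Newtonian potential $\frac1{4\pi}\int_{|x'|\le r_\infty}\frac{f^\flat(x')}{|x-x'|}dx'$, where $f^\flat(x)=f(|x|,x_3/|x|)$, $x\in\mathbb R^3$.) Then $\mathcal G(u)=1+\mathcal K(\mathsf f\circ u)-\mathcal K(\mathsf f\circ u)(0,0)$, with Fréchet derivative $D\mathcal G(u)h=\mathcal K(\mathsf f'\circ u\cdot h)-\mathcal K(\mathsf f'\circ u\cdot h)(0,0)$ on $\mathfrak E$. For $\mathsf b\in\mathfrak B$, $\mathfrak g(r,\zeta)=\mathsf b(r\sqrt{1-\zeta^2})$. Admissible solution with parameters $\mathsf b,u_{\mathsf O}$: a $u\in\mathfrak E$ with $u=\mathfrak g+\mathcal G(u)$ for which there are $r_0\in(0,r_\infty)$ and a continuous $R:[-1,1]\to(r_0,r_\infty)$ such that (a1) $\partial u/\partial r<0$ for $r_0\le r\le r_\infty$, $|\zeta|\le1$; (a2) for every $\zeta\in[-1,1]$, $u(r,\zeta)>0$ for $0\le r<R(\zeta)$, $u(R(\zeta),\zeta)=0$, and $u(r,\zeta)<0$ for $R(\zeta)<r\le r_\infty$. (Solutions of the integral equation have a continuous derivative $\partial u/\partial r$ on $0<r\le r_\infty$, $|\zeta|\le 1$.) Condition (HL) for $u\in\mathfrak E$: if $h\in\mathfrak E$ and $h=D\mathcal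 G(u)h$, then $h=0$. *)

theory Defs
  imports "HOL-Analysis.Analysis"
begin

text \<open>Smoothness on an open set of reals: all iterated derivatives exist there.\<close>

definition smooth_on :: "real set \<Rightarrow> (real \<Rightarrow> real) \<Rightarrow> bool" where
  "smooth_on S f \<longleftrightarrow> (\<forall>n. \<forall>x\<in>S. (deriv ^^ n) f field_differentiable (at x))"

definition equation_of_state ::
  "real \<Rightarrow> real \<Rightarrow> (real \<Rightarrow> real) \<Rightarrow> (real \<Rightarrow> real) \<Rightarrow> bool" where
  "equation_of_state A \<gamma> \<Lambda> P \<longleftrightarrow>
     A > 0 \<and> 1 < \<gamma> \<and> \<gamma> < 2 \<and> smooth_on UNIV \<Lambda> \<and> \<Lambda> 0 = 0 \<and>
     smooth_on {0<..} P \<and>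
     (\<forall>\<rho>>0. P \<rho> > 0 \<and> deriv P \<rho> > 0 \<and>
        P \<rho> = A * \<rho> powr \<gamma> * (1 + \<Lambda> (A * \<rho> powr (\<gamma> - 1))))"

definition enthalpy :: "(real \<Rightarrow> real) \<Rightarrow> real \<Rightarrow> real" where
  "enthalpy P \<rho> = (LINT s:{0<..\<rho>}|lborel. deriv P s / s)"

definition polytropic_index :: "real \<Rightarrow> real" where
  "polytropic_index \<gamma> = 1 / (\<gamma> - 1)"

text \<open>
  \<open>\<Lambda>\<rho>\<close> is the correction factor in the inverse of the map from density to enthalpy.
  The inverse only determines \<open>\<Lambda>\<rho>\<close> on the range of the enthalpy, which may be a
  bounded interval; elsewhere \<open>\<Lambda>\<rho>\<close> is an arbitrary smooth extension.
\<close>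

definition density_correction ::
  "real \<Rightarrow> real \<Rightarrow> (real \<Rightarrow> real) \<Rightarrow> (real \<Rightarrow> real) \<Rightarrow> bool" where
  "density_correction A \<gamma> P \<Lambda>\<rho> \<longleftrightarrow>
     smooth_on UNIV \<Lambda>\<rho> \<and> \<Lambda>\<rho> 0 = 0 \<and>
     (\<forall>\<rho>>0. \<rho> = ((\<gamma> - 1) / (\<gamma> * A)) powr polytropic_index \<gamma> *
                 enthalpy P \<rho> powr polytropic_index \<gamma> * (1 + \<Lambda>\<rho> (enthalpy P \<rho>)))"

definition ff :: "real \<Rightarrow> (real \<Rightarrow> real) \<Rightarrow> real \<Rightarrow> real \<Rightarrow> real" where
  "ff \<nu> \<Lambda>\<rho> uO u = max u 0 powr \<nu> * (1 + \<Lambda>\<rho> (uO * u))"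


text \<open>
  The function spaces consist of extensional functions, so that equality in them is
  equality on the domain. Derivatives on \<open>[0, R]\<close> are one-sided at the endpoints.
\<close>

definition bderiv :: "real \<Rightarrow> (real \<Rightarrow> real) \<Rightarrow> real \<Rightarrow> real" where
  "bderiv R b x = vector_derivative b (at x within {0..R})"

definition B_space :: "real \<Rightarrow> (real \<Rightarrow> real) set" where
  "B_space R = {b \<in> extensional {0..R}.
     (\<forall>x\<in>{0..R}. b differentiable (at x within {0..R})) \<and>
     continuous_on {0..R} (bderiv R b) \<and> bderiv R b 0 = 0}"

definition B_norm :: "real \<Rightarrow> (real \<Rightarrow> real) \<Rightarrow> real" where
  "B_norm R b = (SUP x\<in>{0..R}. \<bar>b x\<bar>) + (SUP x\<in>{0..R}. \<bar>bderiv R b x\<bar>)"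

definition rz_domain :: "real \<Rightarrow> (real \<times> real) set" where
  "rz_domain R = {0..R} \<times> {-1..1}"

definition E_space :: "real \<Rightarrow> (real \<times> real \<Rightarrow> real) set" where
  "E_space R = {u \<in> extensional (rz_domain R). continuous_on (rz_domain R) u \<and>
     (\<forall>\<zeta>\<in>{-1..1}. u (0, \<zeta>) = u (0, 0)) \<and>
     (\<forall>r\<in>{0..R}. \<forall>\<zeta>\<in>{-1..1}. u (r, - \<zeta>) = u (r, \<zeta>))}"

definition E_norm :: "real \<Rightarrow> (real \<times> real \<Rightarrow> real) \<Rightarrow> real" where
  "E_norm R u = (SUP p\<in>rz_domain R. \<bar>u p\<bar>)"


text \<open>
  Where the integral over \<open>\<beta>\<close> diverges (for instance at \<open>(r', \<zeta>') = (r, \<zeta>)\<close> with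
  \<open>0 < r\<close> and \<open>\<bar>\<zeta>\<bar> < 1\<close>), the kernel takes the value \<open>0\<close>. This happens only on a null
  set of points \<open>(r', \<zeta>')\<close> and does not affect the operator below.
\<close>

definition kernel :: "real \<Rightarrow> real \<Rightarrow> real \<Rightarrow> real \<Rightarrow> real" where
  "kernel r \<zeta> r' \<zeta>' = (LINT \<beta>:{0..2*pi}|lborel.
     1 / sqrt (r\<^sup>2 + r'\<^sup>2
       - 2 * r * r' * (sqrt (1 - \<zeta>\<^sup>2) * sqrt (1 - \<zeta>'\<^sup>2) * cos \<beta> + \<zeta> * \<zeta>')))"

definition KK :: "real \<Rightarrow> (real \<times> real \<Rightarrow> real) \<Rightarrow> real \<times> real \<Rightarrow> real" where
  "KK R f = (\<lambda>(r, \<zeta>). 1 / (4 * pi) *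
     (LINT \<zeta>':{-1..1}|lborel. (LINT r':{0..R}|lborel.
        kernel r \<zeta> r' \<zeta>' * f (r', \<zeta>') * r'\<^sup>2)))"

text \<open>
  In \<open>GG\<close> and \<open>DGG\<close> the argument \<open>f\<close> is the profile \<open>ff \<nu> \<Lambda>\<rho> uO\<close>; \<open>DGG R f u\<close> is the
  Frechet derivative of \<open>GG R f\<close> at \<open>u\<close>, given by its explicit formula.
\<close>

definition GG :: "real \<Rightarrow> (real \<Rightarrow> real) \<Rightarrow> (real \<times> real \<Rightarrow> real) \<Rightarrow> real \<times> real \<Rightarrow> real" where
  "GG R f u p = 1 + KK R (f \<circ> u) p - KK R (f \<circ> u) (0, 0)"

definition DGG :: "real \<Rightarrow> (real \<Rightarrow> real) \<Rightarrow> (real \<times> real \<Rightarrow> real) \<Rightarrow>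
    (real \<times> real \<Rightarrow> real) \<Rightarrow> real \<times> real \<Rightarrow> real" where
  "DGG R f u h p =
     KK R (\<lambda>q. deriv f (u q) * h q) p - KK R (\<lambda>q. deriv f (u q) * h q) (0, 0)"

definition gg :: "(real \<Rightarrow> real) \<Rightarrow> real \<times> real \<Rightarrow> real" where
  "gg b = (\<lambda>(r, \<zeta>). b (r * sqrt (1 - \<zeta>\<^sup>2)))"

definition admissible_solution :: "real \<Rightarrow> real \<Rightarrow> (real \<Rightarrow> real) \<Rightarrow>
    (real \<Rightarrow> real) \<Rightarrow> real \<Rightarrow> (real \<times> real \<Rightarrow> real) \<Rightarrow> bool" where
  "admissible_solution R \<nu> \<Lambda>\<rho> b uO u \<longleftrightarrow>
     b \<in> B_space R \<and> uO > 0 \<and> u \<in> E_space R \<and>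
     (\<forall>p\<in>rz_domain R. u p = gg b p + GG R (ff \<nu> \<Lambda>\<rho> uO) u p) \<and>
     (\<exists>r0 \<in> {0<..<R}. \<exists>Rb :: real \<Rightarrow> real.
        continuous_on {-1..1} Rb \<and> Rb ` {-1..1} \<subseteq> {r0<..<R} \<and>
        (\<forall>r\<in>{r0..R}. \<forall>\<zeta>\<in>{-1..1}. \<exists>d<0.
           ((\<lambda>s. u (s, \<zeta>)) has_real_derivative d) (at r within {0..R})) \<and>
        (\<forall>\<zeta>\<in>{-1..1}.
           (\<forall>r\<in>{0..<Rb \<zeta>}. u (r, \<zeta>) > 0) \<and>
           u (Rb \<zeta>, \<zeta>) = 0 \<and>
           (\<forall>r\<in>{Rb \<zeta><..R}. u (r, \<zeta>) < 0)))"

definition HL :: "real \<Rightarrow> real \<Rightarrow> (real \<Rightarrow> real) \<Rightarrow> real \<Rightarrow> (real \<times> real \<Rightarrow> real) \<Rightarrow> bool" where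
  "HL R \<nu> \<Lambda>\<rho> uO u \<longleftrightarrow>
     (\<forall>h\<in>E_space R. (\<forall>p\<in>rz_domain R. h p = DGG R (ff \<nu> \<Lambda>\<rho> uO) u h p) \<longrightarrow> (\<forall>p\<in>rz_domain R. h p = 0))"

definition param_dist ::
  "real \<Rightarrow> (real \<Rightarrow> real) \<times> real \<Rightarrow> (real \<Rightarrow> real) \<times> real \<Rightarrow> real" where
  "param_dist R p q = B_norm R (\<lambda>x. fst p x - fst q x) + \<bar>snd p - snd q\<bar>"

definition E_dist ::
  "real \<Rightarrow> (real \<times> real \<Rightarrow> real) \<Rightarrow> (real \<times> real \<Rightarrow> real) \<Rightarrow> real" where
  "E_dist R u v = E_norm R (\<lambda>p. u p - v p)"

definition continuous_param_map ::
  "real \<Rightarrow> ((real \<Rightarrow> real) \<times> real) set \<Rightarrow>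
   ((real \<Rightarrow> real) \<times> real \<Rightarrow> real \<times> real \<Rightarrow> real) \<Rightarrow> bool" where
  "continuous_param_map R N S \<longleftrightarrow>
     (\<forall>p\<in>N. \<forall>e>0. \<exists>d>0. \<forall>q\<in>N. param_dist R q p < d \<longrightarrow> E_dist R (S q) (S p) < e)"

end

theory Submission
  imports Defs "HOL-Complex_Analysis.Great_Picard"
begin

text \<open>
  The equation \<open>u = gg b + GG R f u\<close> is solved near \<open>ub\<close> by the argument of the implicit function
  theorem in the Banach space \<open>E\<close>, and the solution found there inherits the geometric conditions
  of admissibility because they are open conditions in a topology that the potential controls.

  \<^emph>\<open>The potential.\<close> In the coordinates \<open>y = ((r', \<zeta>'), \<beta>)\<close> the operator \<open>KK\<close> integrates
  \<open>f r'\<^sup>2 / D\<close>, where \<open>D\<close> is the distance of two points of space. All its analytic properties rest on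
  one estimate, \<open>nn_integral_potential_weight\<close>: the integral of \<open>r'\<^sup>2 / D\<^bsup>9/4\<^esup>\<close> over the
  coordinate box is bounded independently of the first point. It needs no change of variables.
  The distance is at least \<open>\<bar>r - r'\<bar>\<close>, at least \<open>\<bar>r \<zeta> - r' \<zeta>'\<bar>\<close> and at least
  \<open>r' \<bar>sin \<beta>\<bar> sqrt (1 - \<zeta>'\<^sup>2)\<close>, and splitting the exponent as \<open>9/4 = 7/8 + 1/2 + 7/8\<close> among these
  three bounds leaves one-dimensional integrals of powers above \<open>-1\<close>. Since \<open>9/4\<close> exceeds \<open>2\<close>,
  the kernel \<open>1/D\<close> and also its radial derivative, of size \<open>1/D\<^sup>2\<close>, may be replaced by
  those of \<open>1 / sqrt (D\<^sup>2 + \<eta>\<^sup>2)\<close> with an error of order \<open>\<eta>\<^bsup>1/4\<^esup>\<close> times the supremum of the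
  source, uniformly in the first point. Hence potentials are continuous, potentials of bounded
  families of sources are equicontinuous (\<open>KK_equicontinuous\<close>), and potentials are continuously
  differentiable in \<open>r\<close> up to both end points, with a derivative bounded by a multiple of the
  supremum of the source (\<open>KK_has_derivative\<close>, \<open>KK_dr_bound\<close>).

  \<^emph>\<open>Invertibility.\<close> By equicontinuity the linearisation \<open>T\<close> of \<open>GG\<close> at \<open>ub\<close> is a compact operator
  on \<open>E\<close>, and (HL) says that \<open>I - T\<close> is injective. Riesz' theory of compact operators then makes
  \<open>I - T\<close> bounded below and onto (\<open>HL_invertible\<close>).

  \<^emph>\<open>Solving the equation.\<close> As \<open>\<nu> > 1\<close>, the profile \<open>ff \<nu> \<Lambda>\<rho> uO u\<close> has a derivative in \<open>u\<close> that is
  continuous in \<open>(uO, u)\<close>. So for parameters and functions close to \<open>uOb\<close> and \<open>ub\<close> the nonlinear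
  operator differs from \<open>T\<close> by a Lipschitz map with a small constant, and Newton's method with
  the frozen derivative \<open>I - T\<close> is a contraction (\<open>fixed_point_near_approximate\<close>). The same
  inequality yields uniqueness, continuous dependence on the parameters and, since being bounded
  below survives small perturbations, condition (HL) for the new solution.

  \<^emph>\<open>Admissibility.\<close> The radial derivative of \<open>ub\<close> is continuous and negative on the compact set
  \<open>r0 \<le> r \<le> R\<close>, hence bounded away from \<open>0\<close>; likewise \<open>ub\<close> is bounded away from \<open>0\<close> for
  \<open>r \<le> r0\<close> and for \<open>r = R\<close>. Nearby solutions differ little from \<open>ub\<close>, and so do their radial
  derivatives, because the derivative of a potential is controlled by its source. They therefore
  decrease through a unique zero on each ray, and this zero is a continuous function of \<open>\<zeta>\<close>
  because its graph is closed (\<open>admissible_stable\<close>).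
\<close>


section \<open>Compact perturbations of the identity\<close>

text \<open>
  Riesz' lemma: normalise the difference between a point outside \<open>W\<close> and a point of \<open>W\<close> that is
  nearly closest to it. A closest point need not exist, which is why the constant is below \<open>1\<close>.
\<close>

lemma riesz_almost_orthogonal:
  fixes X W :: "'a::real_normed_vector set"
  assumes "subspace X" "subspace W" "closed W" "W \<subset> X"
  shows "\<exists>x\<in>X. norm x = 1 \<and> (\<forall>w\<in>W. 1/2 \<le> norm (x - w))"
proof -
  obtain v where v: "v \<in> X" "v \<notin> W"
    using assms(4) by blast
  have W0: "W \<noteq> {}"
    using subspace_0[OF assms(2)] by auto
  have d: "0 < infdist v W"
    using v W0 assms(3) in_closed_iff_infdist_zero infdist_nonneg less_eq_real_def by metis
  obtain w0 where w0: "w0 \<in> W" "norm (v - w0) < 2 * infdist v W"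
  proof -
    have "\<exists>a\<in>W. dist v a < 2 * infdist v W"
    proof (rule ccontr)
      assume "\<not> ?thesis"
      then have "2 * infdist v W \<le> infdist v W"
        unfolding infdist_notempty[OF W0] using W0
        by (intro cINF_greatest) (auto simp: not_less infdist_notempty)
      with d show False by simp
    qed
    then show ?thesis using that by (auto simp: dist_norm)
  qed
  define n where "n = norm (v - w0)"
  have n: "0 < n"
    using v w0 by (auto simp: n_def)
  define x where "x = (1/n) *\<^sub>R (v - w0)"
  have "x \<in> X"
    unfolding x_def using v w0 assms by (intro subspace_scale subspace_diff) auto
  moreover have "norm x = 1"
    using n by (simp add: x_def n_def)
  moreover have "1/2 \<le> norm (x - w)" if "w \<in> W" for w
  proof -
    \<comment> \<open>rescaling \<open>x - w\<close> by \<open>n\<close> gives the difference of \<open>v\<close> and a point of \<open>W\<close>\<close>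
    have "w0 + n *\<^sub>R w \<in> W"
      using w0 that assms(2) by (intro subspace_add subspace_scale)
    then have "infdist v W \<le> norm (v - (w0 + n *\<^sub>R w))"
      by (metis dist_norm infdist_le)
    also have "v - (w0 + n *\<^sub>R w) = n *\<^sub>R (x - w)"
      using n by (simp add: x_def algebra_simps)
    also have "norm \<dots> = n * norm (x - w)"
      using n by simp
    finally have "n / 2 < n * norm (x - w)"
      using w0 by (simp add: n_def)
    then have "n * (1/2) \<le> n * norm (x - w)" by simp
    then show ?thesis
      using n by (simp only: mult_le_cancel_left_pos)
  qed
  ultimately show ?thesis by blast
qed

text \<open>
  Otherwise there are unit vectors \<open>x n\<close> with \<open>x n - T (x n)\<close> tending to \<open>0\<close>. Along a subsequence
  \<open>T (x n)\<close> converges, hence so does \<open>x n\<close>, and the limit is a fixed vector of \<open>T\<close> of norm \<open>1\<close>.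
\<close>

lemma compact_perturbation_bounded_below:
  fixes T :: "'a::banach \<Rightarrow> 'a"
  assumes V: "subspace V" "closed V" and T: "bounded_linear T" "T ` V \<subseteq> V"
    and comp: "\<And>x. (\<And>n::nat. x n \<in> V) \<Longrightarrow> (\<And>n. norm (x n) \<le> 1) \<Longrightarrow>
      \<exists>l r. strict_mono (r :: nat \<Rightarrow> nat) \<and> (\<lambda>n. T (x (r n))) \<longlonglongrightarrow> l"
    and inj: "\<And>x. x \<in> V \<Longrightarrow> T x = x \<Longrightarrow> x = 0"
  shows "\<exists>c>0. \<forall>x\<in>V. c * norm x \<le> norm (x - T x)"
proof (rule ccontr)
  assume "\<not> ?thesis"
  then have "\<forall>n::nat. \<exists>x\<in>V. norm (x - T x) < 1 / Suc n * norm x"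
    by (metis not_le of_nat_0_less_iff zero_less_Suc zero_less_divide_1_iff)
  then obtain y where y: "\<And>n::nat. y n \<in> V" "\<And>n. norm (y n - T (y n)) < 1 / Suc n * norm (y n)"
    by metis
  define x where "x n = (1 / norm (y n)) *\<^sub>R y n" for n
  have y0: "y n \<noteq> 0" for n
    using y(2)[of n] by auto
  have xV: "x n \<in> V" for n
    unfolding x_def by (intro subspace_scale V y)
  have x1: "norm (x n) = 1" for n
    using y0 by (simp add: x_def)
  have xT: "norm (x n - T (x n)) < 1 / Suc n" for n
  proof -
    have "x n - T (x n) = (1 / norm (y n)) *\<^sub>R (y n - T (y n))"
      by (simp only: x_def linear_simps[OF T(1)] scaleR_diff_right)
    then have "norm (x n - T (x n)) = norm (y n - T (y n)) / norm (y n)" by simp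
    also have "\<dots> < 1 / Suc n"
      using y(2)[of n] y0[of n] by (simp add: pos_divide_less_eq mult.commute)
    finally show ?thesis .
  qed
  obtain l r where r: "strict_mono (r::nat \<Rightarrow> nat)" and l: "(\<lambda>n. T (x (r n))) \<longlonglongrightarrow> l"
    using comp[of x] xV x1 by (metis order_refl)
  have "(\<lambda>n. x n - T (x n)) \<longlonglongrightarrow> 0"
    by (rule Lim_null_comparison[OF _ LIMSEQ_Suc[OF lim_1_over_n]])
       (use xT in \<open>auto intro!: always_eventually less_imp_le simp del: of_nat_Suc\<close>)
  from LIMSEQ_subseq_LIMSEQ[OF this r] have "(\<lambda>n. x (r n) - T (x (r n))) \<longlonglongrightarrow> 0"
    by (simp add: o_def)
  from tendsto_add[OF this l] have xl: "(\<lambda>n. x (r n)) \<longlonglongrightarrow> l" by simp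
  have "(\<lambda>n. T (x (r n))) \<longlonglongrightarrow> T l"
    by (rule bounded_linear.tendsto[OF T(1) xl])
  then have "T l = l" using l LIMSEQ_unique by blast
  moreover have "l \<in> V"
    using closed_sequentially[OF V(2) _ xl] xV by blast
  ultimately have "l = 0" using inj by blast
  moreover have "norm l = 1"
    using tendsto_norm[OF xl] x1 by (simp add: LIMSEQ_const_iff)
  ultimately show False by simp
qed

text \<open>
  Write \<open>L = I - T\<close>. If \<open>L\<close> were not onto, the images of \<open>V\<close> under its iterates would be a strictly
  decreasing sequence of subspaces, closed because \<open>L\<close> is bounded below. Choose in each a unit
  vector at distance at least \<open>1/2\<close> from the next one. The differences of the \<open>T\<close>-images of these
  vectors have norm at least \<open>1/2\<close>, which contradicts compactness.
\<close>

lemma compact_perturbation_surjective: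
  fixes T :: "'a::banach \<Rightarrow> 'a"
  assumes V: "subspace V" "closed V" and T: "bounded_linear T" "T ` V \<subseteq> V"
    and comp: "\<And>x. (\<And>n::nat. x n \<in> V) \<Longrightarrow> (\<And>n. norm (x n) \<le> 1) \<Longrightarrow>
      \<exists>l r. strict_mono (r :: nat \<Rightarrow> nat) \<and> (\<lambda>n. T (x (r n))) \<longlonglongrightarrow> l"
    and below: "c > 0" "\<And>x. x \<in> V \<Longrightarrow> c * norm x \<le> norm (x - T x)"
  shows "(\<lambda>x. x - T x) ` V = V"
proof (rule ccontr)
  assume neq: "(\<lambda>x. x - T x) ` V \<noteq> V"
  define L where "L x = x - T x" for x
  have L: "bounded_linear L"
    unfolding L_def by (intro bounded_linear_sub bounded_linear_ident T)
  define W where "W n = (L ^^ n) ` V" for n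
  have W0: "W 0 = V" by (simp add: W_def)
  have WS: "W (Suc n) = L ` W n" for n
    by (simp add: W_def image_comp)
  have sub: "subspace (W n)" for n
    by (induction n) (use V L in \<open>auto simp: W0 WS bounded_linear.linear intro!: linear_subspace_image\<close>)
  have LV: "L ` V \<subseteq> V"
    using T V by (auto simp: L_def intro!: subspace_diff)
  have dec1: "W (Suc n) \<subseteq> W n" for n
    by (induction n) (use LV in \<open>auto simp: W0 WS\<close>)
  have dec: "W n \<subseteq> W m" if "m \<le> n" for m n
    using lift_Suc_antimono_le[of W, OF dec1 that] .
  have WV: "W n \<subseteq> V" for n
    using dec[of 0 n] by (simp add: W0)
  have cl: "complete (W n)" for n
  proof (induction n)
    case 0
    then show ?case using V by (simp add: W0 complete_eq_closed)
  next
    case (Suc n)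
    show ?case unfolding WS
      by (rule complete_isometric_image[OF below(1) sub L _ Suc])
         (use below WV in \<open>auto simp: L_def\<close>)
  qed
  have inj: "inj_on L V"
  proof (rule inj_onI)
    fix x y assume xy: "x \<in> V" "y \<in> V" "L x = L y"
    have "c * norm (x - y) \<le> norm (L (x - y))"
      unfolding L_def using xy V by (intro below subspace_diff)
    also have "L (x - y) = 0"
      using xy by (simp add: linear_simps[OF L])
    finally show "x = y"
      using below(1) by (simp add: mult_le_0_iff)
  qed
  have strict: "W (Suc n) \<subset> W n" for n
  proof (induction n)
    case 0
    then show ?case using neq LV by (auto simp: W0 WS L_def)
  next
    case (Suc n)
    have "L ` W (Suc n) \<noteq> L ` W n"
      using Suc inj_on_image_eq_iff[OF inj WV WV] by blast
    then show ?case
      using dec1[of "Suc n"] by (simp add: WS)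
  qed
  have "\<exists>x\<in>W n. norm x = 1 \<and> (\<forall>w\<in>W (Suc n). 1/2 \<le> norm (x - w))" for n
    using riesz_almost_orthogonal[OF sub sub _ strict] cl complete_eq_closed by blast
  then obtain x where x: "\<And>n. x n \<in> W n" "\<And>n. norm (x n) = 1"
    "\<And>n w. w \<in> W (Suc n) \<Longrightarrow> 1/2 \<le> norm (x n - w)"
    by metis
  have far: "1/2 \<le> norm (T (x n) - T (x m))" if "n < m" for n m
  proof -
    have "L (x n) \<in> W (Suc n)"
      using x by (auto simp: WS)
    moreover have "x m \<in> W (Suc n)"
      using dec[of "Suc n" m] x that by auto
    moreover have "L (x m) \<in> W (Suc n)"
      using dec[of "Suc n" "Suc m"] x that by (auto simp: WS)
    ultimately have "L (x n) + x m - L (x m) \<in> W (Suc n)"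
      by (intro subspace_diff subspace_add sub)
    from x(3)[OF this] show ?thesis
      by (simp add: L_def algebra_simps)
  qed
  obtain l r where r: "strict_mono (r::nat \<Rightarrow> nat)" and l: "(\<lambda>n. T (x (r n))) \<longlonglongrightarrow> l"
    using comp[of x] x WV by (metis order_refl subsetD)
  from LIMSEQ_imp_Cauchy[OF l] obtain N where
    "\<forall>m\<ge>N. \<forall>n\<ge>N. norm (T (x (r m)) - T (x (r n))) < 1/2"
    unfolding Cauchy_iff by (metis half_gt_zero zero_less_one)
  then have "norm (T (x (r N)) - T (x (r (Suc N)))) < 1/2" by simp
  moreover have "r N < r (Suc N)" using r by (simp add: strict_mono_def)
  ultimately show False using far by force
qed

text \<open>
  Newton's method with the frozen derivative \<open>I - T\<close>: send \<open>u\<close> to the solution \<open>x\<close> of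
  \<open>x - T x = N u - T u\<close>. The fixed points of this map are those of \<open>N\<close>. As the inverse of \<open>I - T\<close>
  has norm at most \<open>1/c\<close>, the map contracts by the factor \<open>1/2\<close> and moves the centre \<open>u0\<close> by at
  most \<open>\<epsilon>/2\<close>.
\<close>

lemma fixed_point_near_approximate:
  fixes T N :: "'a::banach \<Rightarrow> 'a"
  assumes V: "subspace V" "closed V" and T: "bounded_linear T" "T ` V \<subseteq> V"
    and below: "c > 0" "\<And>x. x \<in> V \<Longrightarrow> c * norm x \<le> norm (x - T x)"
    and surj: "(\<lambda>x. x - T x) ` V = V"
    and u0: "u0 \<in> V" and NV: "\<And>u. u \<in> V \<Longrightarrow> N u \<in> V"
    and lin: "\<And>u v. u \<in> V \<Longrightarrow> v \<in> V \<Longrightarrow> dist u u0 \<le> \<epsilon> \<Longrightarrow> dist v u0 \<le> \<epsilon> \<Longrightarrow>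
      norm (N u - N v - T (u - v)) \<le> c/2 * norm (u - v)"
    and defect: "norm (N u0 - u0) \<le> c/2 * \<epsilon>" and "\<epsilon> > 0"
  shows "\<exists>u\<in>V. dist u u0 \<le> \<epsilon> \<and> N u = u"
proof -
  define L where "L x = x - T x" for x
  have L: "bounded_linear L"
    unfolding L_def by (intro bounded_linear_sub bounded_linear_ident T)
  have belowL: "norm x \<le> norm (L x) / c" if "x \<in> V" for x
    using below that by (simp add: L_def field_simps)
  have "\<forall>y\<in>V. \<exists>x\<in>V. L x = y"
  proof
    fix y assume "y \<in> V"
    then have "y \<in> (\<lambda>x. x - T x) ` V" using surj by simp
    then show "\<exists>x\<in>V. L x = y" by (auto simp: L_def)
  qed
  then obtain M where M: "\<And>y. y \<in> V \<Longrightarrow> M y \<in> V" "\<And>y. y \<in> V \<Longrightarrow> L (M y) = y"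
    by metis
  define \<Phi> where "\<Phi> u = M (N u - T u)" for u
  have V1: "N u - T u \<in> V" if "u \<in> V" for u
    using that NV T by (intro subspace_diff V) auto
  have \<Phi>V: "\<Phi> u \<in> V" if "u \<in> V" for u
    unfolding \<Phi>_def using that by (intro M V1)
  have L\<Phi>: "L (\<Phi> u) = N u - T u" if "u \<in> V" for u
    unfolding \<Phi>_def using that by (intro M V1)
  define S where "S = V \<inter> cball u0 \<epsilon>"
  have lip: "dist (\<Phi> u) (\<Phi> v) \<le> 1/2 * dist u v" if "u \<in> S" "v \<in> S" for u v
  proof -
    have uv: "u \<in> V" "v \<in> V" "dist u u0 \<le> \<epsilon>" "dist v u0 \<le> \<epsilon>"
      using that by (auto simp: S_def dist_commute)
    have "norm (\<Phi> u - \<Phi> v) \<le> norm (L (\<Phi> u - \<Phi> v)) / c"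
      using uv by (intro belowL subspace_diff V \<Phi>V)
    also have "L (\<Phi> u - \<Phi> v) = N u - N v - T (u - v)"
      using uv by (simp add: linear_simps[OF L] linear_simps[OF T(1)] L\<Phi> algebra_simps)
    also have "norm \<dots> / c \<le> (c/2 * norm (u - v)) / c"
      using lin[OF uv] below(1) by (intro divide_right_mono) auto
    finally show ?thesis
      using below(1) by (simp add: dist_norm)
  qed
  have u0S: "u0 \<in> S"
    using u0 \<open>\<epsilon> > 0\<close> by (simp add: S_def)
  have \<Phi>0: "dist (\<Phi> u0) u0 \<le> \<epsilon>/2"
  proof -
    have "norm (\<Phi> u0 - u0) \<le> norm (L (\<Phi> u0 - u0)) / c"
      using u0 by (intro belowL subspace_diff V \<Phi>V)
    also have "L (\<Phi> u0 - u0) = N u0 - u0"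
      using u0 by (simp add: linear_simps[OF L] L\<Phi>) (simp add: L_def)
    also have "norm \<dots> / c \<le> (c/2 * \<epsilon>) / c"
      using defect below(1) by (intro divide_right_mono) auto
    finally show ?thesis
      using below(1) by (simp add: dist_norm)
  qed
  have "\<exists>!u\<in>S. \<Phi> u = u"
  proof (rule Banach_fix[where c="1/2"])
    show "complete S"
      unfolding S_def complete_eq_closed using V by (intro closed_Int) auto
    show "\<Phi> ` S \<subseteq> S"
    proof
      fix w assume "w \<in> \<Phi> ` S"
      then obtain u where u: "u \<in> S" "w = \<Phi> u" by blast
      have "dist (\<Phi> u) u0 \<le> dist (\<Phi> u) (\<Phi> u0) + dist (\<Phi> u0) u0"
        by (rule dist_triangle)
      also have "\<dots> \<le> 1/2 * dist u u0 + \<epsilon>/2"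
        using lip[OF u(1) u0S] \<Phi>0 by simp
      also have "\<dots> \<le> \<epsilon>"
        using u by (simp add: S_def dist_commute)
      finally show "w \<in> S"
        using u \<Phi>V by (auto simp: S_def dist_commute)
    qed
  qed (use u0S lip in auto)
  then obtain u where u: "u \<in> V" "dist u u0 \<le> \<epsilon>" "\<Phi> u = u"
    by (auto simp: S_def dist_commute)
  have "L u = N u - T u"
    using L\<Phi> u by metis
  then have "N u = u"
    by (simp add: L_def)
  with u show ?thesis by blast
qed


section \<open>The distance between two points in spherical coordinates\<close>

text \<open>
  The point is that the bound does not depend on the position \<open>c\<close> of the singularity: at distance
  more than \<open>1\<close> from \<open>c\<close> the integrand is below \<open>1\<close>, and what is left is a translate of an integral
  around \<open>0\<close>.
\<close>

lemma nn_integral_abs_powr_le: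
  fixes a b c s :: real
  assumes "a \<le> b" "0 < s" "s < 1"
  shows "(\<integral>\<^sup>+t. ennreal (indicator {a..b} t * \<bar>t - c\<bar> powr (- s)) \<partial>lborel)
    \<le> ennreal ((b - a) + 2 / (1 - s))"
proof -
  let ?p = "\<lambda>t::real. ennreal (indicator {0..1} t * t powr (- s))"
  have p: "(\<integral>\<^sup>+t. ?p t \<partial>lborel) = ennreal (1 / (1 - s))"
    using nn_integral_has_integral_lebesgue[OF _ has_integral_powr_from_0[of "- s" 1]] assms
    by simp
  have shift: "(\<integral>\<^sup>+t. ?p (\<sigma> * (t - c)) \<partial>lborel) = ennreal (1 / (1 - s))"
    if "\<sigma> = 1 \<or> \<sigma> = -1" for \<sigma> :: real
    using nn_integral_real_affine[of "\<lambda>t. ?p (\<sigma> * (t - c))" \<sigma> c] that p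
    by (auto simp: algebra_simps)
  have "(\<integral>\<^sup>+t. ennreal (indicator {a..b} t * \<bar>t - c\<bar> powr (- s)) \<partial>lborel)
    \<le> (\<integral>\<^sup>+t. indicator {a..b} t + (?p (1 * (t - c)) + ?p ((-1) * (t - c))) \<partial>lborel)"
  proof (rule nn_integral_mono)
    fix t :: real
    have "\<bar>t - c\<bar> powr (- s) \<le> 1" if "\<bar>t - c\<bar> \<ge> 1"
      using powr_mono2'[of "- s" 1 "\<bar>t - c\<bar>"] that assms by simp
    then have "indicator {a..b} t * \<bar>t - c\<bar> powr (- s) \<le> indicator {a..b} t +
      (indicator {0..1} (1 * (t - c)) * (1 * (t - c)) powr (- s) +
       indicator {0..1} ((-1) * (t - c)) * ((-1) * (t - c)) powr (- s))"
      by (auto simp: indicator_def abs_if split: if_splits)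
    then show "ennreal (indicator {a..b} t * \<bar>t - c\<bar> powr (- s))
      \<le> indicator {a..b} t + (?p (1 * (t - c)) + ?p ((-1) * (t - c)))"
      by (subst ennreal_indicator[symmetric], subst ennreal_plus[symmetric], simp, simp,
          subst ennreal_plus[symmetric], simp, simp, intro ennreal_leI)
  qed
  also have "\<dots> = ennreal (b - a) + (ennreal (1 / (1 - s)) + ennreal (1 / (1 - s)))"
    using assms by (simp add: nn_integral_add shift[of 1, simplified] shift[of "-1", simplified])
  also have "\<dots> = ennreal ((b - a) + 2 / (1 - s))"
    using assms by (simp flip: ennreal_plus)
  finally show ?thesis .
qed

text \<open>
  From \<open>s cos s \<le> sin s\<close> for \<open>s = x/2\<close> and the double angle formulas,
  \<open>sin x \<ge> x (cos (x/2))\<^sup>2 = x (1 + cos x) / 2\<close>.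
\<close>

lemma sin_ge_half:
  assumes "0 \<le> x" "x \<le> pi/2"
  shows "x / 2 \<le> sin x"
proof -
  have "sin 0 - 0 * cos 0 \<le> sin (x/2) - x/2 * cos (x/2)"
  proof (rule DERIV_nonneg_imp_nondecreasing[where f="\<lambda>t. sin t - t * cos t"])
    fix t assume "0 \<le> t" "t \<le> x/2"
    then have "0 \<le> t * sin t"
      using assms by (intro mult_nonneg_nonneg sin_ge_zero) auto
    moreover have "((\<lambda>t. sin t - t * cos t) has_real_derivative t * sin t) (at t)"
      by (auto intro!: derivative_eq_intros simp: algebra_simps)
    ultimately show "\<exists>y. ((\<lambda>t. sin t - t * cos t) has_real_derivative y) (at t) \<and> 0 \<le> y"
      by blast
  qed (use assms in auto)
  then have "2 * (x/2 * cos (x/2)) * cos (x/2) \<le> 2 * sin (x/2) * cos (x/2)"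
    using assms by (intro mult_right_mono cos_ge_zero) auto
  also have "\<dots> = sin x" using sin_double[of "x/2"] by simp
  also have "2 * (x/2 * cos (x/2)) * cos (x/2) = x * ((cos (x/2))\<^sup>2)"
    by (simp add: power2_eq_square)
  also have "(cos (x/2))\<^sup>2 = (1 + cos x) / 2"
    using cos_double_cos[of "x/2"] by simp
  finally show ?thesis
    using mult_nonneg_nonneg[OF assms(1) cos_ge_zero[of x]] assms by (simp add: algebra_simps)
qed

lemma abs_sin_ge_dist:
  assumes "0 \<le> x" "x \<le> 2 * pi"
  shows "\<bar>x\<bar> / 2 \<le> \<bar>sin x\<bar> \<or> \<bar>x - pi\<bar> / 2 \<le> \<bar>sin x\<bar> \<or> \<bar>x - 2 * pi\<bar> / 2 \<le> \<bar>sin x\<bar>"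
proof -
  consider "x \<le> pi/2" | "pi/2 \<le> x" "x \<le> pi" | "pi \<le> x" "x \<le> 3*pi/2" | "3*pi/2 \<le> x"
    by linarith
  then show ?thesis
  proof cases
    case 1
    then show ?thesis using sin_ge_half[of x] assms by auto
  next
    case 2
    then show ?thesis using sin_ge_half[of "pi - x"] assms by auto
  next
    case 3
    then show ?thesis using sin_ge_half[of "x - pi"] assms by (auto simp: sin_diff)
  next
    case 4
    then show ?thesis using sin_ge_half[of "2 * pi - x"] assms by (auto simp: sin_diff)
  qed
qed

text \<open>
  The squared Euclidean distance between the point with radius \<open>fst p\<close>, cosine \<open>snd p\<close> of the polar
  angle and azimuth \<open>0\<close>, and the point with coordinates \<open>((r', \<zeta>'), \<beta>) = y\<close>.
\<close>

definition dist2 :: "real \<times> real \<Rightarrow> (real \<times> real) \<times> real \<Rightarrow> real" where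
  "dist2 p y = (fst p)\<^sup>2 + (fst (fst y))\<^sup>2 - 2 * fst p * fst (fst y) *
     (sqrt (1 - (snd p)\<^sup>2) * sqrt (1 - (snd (fst y))\<^sup>2) * cos (snd y) + snd p * snd (fst y))"

definition spherical_box :: "real \<Rightarrow> ((real \<times> real) \<times> real) set" where
  "spherical_box R = ({0..R} \<times> {-1..1}) \<times> {0..2*pi}"

text \<open>
  Half of the derivative of \<^const>\<open>dist2\<close> in the radius of \<open>p\<close>.
\<close>

definition radial_offset :: "real \<times> real \<Rightarrow> (real \<times> real) \<times> real \<Rightarrow> real" where
  "radial_offset p y = fst p - fst (fst y) *
     (sqrt (1 - (snd p)\<^sup>2) * sqrt (1 - (snd (fst y))\<^sup>2) * cos (snd y) + snd p * snd (fst y))"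

text \<open>
  The three squares are those of the differences of the Cartesian coordinates.
\<close>

lemma dist2_cartesian:
  assumes "\<bar>z\<bar> \<le> 1" "\<bar>z'\<bar> \<le> 1"
  shows "dist2 (r, z) ((r', z'), t) =
    (r * sqrt (1 - z\<^sup>2) - r' * sqrt (1 - z'\<^sup>2) * cos t)\<^sup>2 + (r' * sqrt (1 - z'\<^sup>2) * sin t)\<^sup>2
      + (r * z - r' * z')\<^sup>2"
proof -
  have s: "(sqrt (1 - z\<^sup>2))\<^sup>2 = 1 - z\<^sup>2" "(sqrt (1 - z'\<^sup>2))\<^sup>2 = 1 - z'\<^sup>2"
    using assms by (auto simp: abs_square_le_1)
  have t: "(sin t)\<^sup>2 = 1 - (cos t)\<^sup>2" by (rule sin_squared_eq)
  show ?thesis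
    unfolding dist2_def fst_conv snd_conv power_mult_distrib power2_diff s t
    by (simp add: algebra_simps)
qed

text \<open>
  The bracket in \<^const>\<open>dist2\<close> is the cosine of the angle between the two points, so all three
  bounds follow once it is known to lie in \<open>[-1, 1]\<close>; this is read off from the squared lengths of
  the sum and the difference of the two unit vectors.
\<close>

lemma dist2_angle_bounds:
  assumes "\<bar>z\<bar> \<le> 1" "\<bar>z'\<bar> \<le> 1"
  shows "(radial_offset (r, z) ((r', z'), t))\<^sup>2 \<le> dist2 (r, z) ((r', z'), t)"
    and "0 \<le> r * r' \<Longrightarrow> (r - r')\<^sup>2 \<le> dist2 (r, z) ((r', z'), t)"
    and "dist2 (r, z) ((r', z'), t) \<le> (\<bar>r\<bar> + \<bar>r'\<bar>)\<^sup>2"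
proof -
  define c where "c = sqrt (1 - z\<^sup>2) * sqrt (1 - z'\<^sup>2) * cos t + z * z'"
  have s: "(sqrt (1 - z\<^sup>2))\<^sup>2 = 1 - z\<^sup>2" "(sqrt (1 - z'\<^sup>2))\<^sup>2 = 1 - z'\<^sup>2"
    using assms by (auto simp: abs_square_le_1)
  have "0 \<le> (sqrt (1 - z\<^sup>2) - sqrt (1 - z'\<^sup>2) * cos t)\<^sup>2 + (sqrt (1 - z'\<^sup>2) * sin t)\<^sup>2 + (z - z')\<^sup>2"
    by simp
  also have "\<dots> = 2 - 2 * c"
    unfolding c_def power_mult_distrib power2_diff s sin_squared_eq by (simp add: algebra_simps)
  finally have c1: "c \<le> 1" by simp
  have "0 \<le> (sqrt (1 - z\<^sup>2) + sqrt (1 - z'\<^sup>2) * cos t)\<^sup>2 + (sqrt (1 - z'\<^sup>2) * sin t)\<^sup>2 + (z + z')\<^sup>2"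
    by simp
  also have "\<dots> = 2 + 2 * c"
    unfolding c_def power_mult_distrib power2_sum s sin_squared_eq by (simp add: algebra_simps)
  finally have c2: "-1 \<le> c" by simp
  have d: "dist2 (r, z) ((r', z'), t) = r\<^sup>2 + r'\<^sup>2 - 2 * (r * r') * c"
    by (simp add: dist2_def c_def)
  have "c\<^sup>2 \<le> 1" using c1 c2 by (simp add: abs_square_le_1 abs_le_iff)
  then have "r'\<^sup>2 * c\<^sup>2 \<le> r'\<^sup>2"
    using mult_left_mono[of "c\<^sup>2" 1 "r'\<^sup>2"] by simp
  then show "(radial_offset (r, z) ((r', z'), t))\<^sup>2 \<le> dist2 (r, z) ((r', z'), t)"
    by (simp add: d radial_offset_def c_def[symmetric] power2_diff power_mult_distrib)
  show "(r - r')\<^sup>2 \<le> dist2 (r, z) ((r', z'), t)" if "0 \<le> r * r'"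
    using mult_left_mono[OF c1 that] by (simp add: d power2_diff)
  have "\<bar>r * r' * c\<bar> \<le> \<bar>r * r'\<bar>"
    using c1 c2 by (simp add: abs_mult mult_left_le abs_le_iff)
  then have "- (r * r' * c) \<le> \<bar>r\<bar> * \<bar>r'\<bar>"
    by (simp only: abs_mult[of r r'] abs_le_iff)
  then show "dist2 (r, z) ((r', z'), t) \<le> (\<bar>r\<bar> + \<bar>r'\<bar>)\<^sup>2"
    by (simp add: d power2_sum algebra_simps)
qed

text \<open>
  Separates two singular factors located at different points; the larger of the two powers dominates.
\<close>

lemma powr_young:
  fixes a b :: real
  assumes "a > 0" "b > 0" "s \<ge> 0" "t \<ge> 0"
  shows "a powr (- s) * b powr (- t) \<le> a powr (- (s + t)) + b powr (- (s + t))"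
proof (cases "a \<le> b")
  case True
  have "b powr (- t) \<le> a powr (- t)" using True assms by (intro powr_mono2') auto
  then have "a powr (- s) * b powr (- t) \<le> a powr (- s) * a powr (- t)"
    by (intro mult_left_mono) auto
  also have "\<dots> = a powr (- (s + t))" by (simp flip: powr_add)
  finally show ?thesis by (smt (verit) powr_ge_zero)
next
  case False
  have "a powr (- s) \<le> b powr (- s)" using False assms by (intro powr_mono2') auto
  then have "a powr (- s) * b powr (- t) \<le> b powr (- s) * b powr (- t)"
    by (intro mult_right_mono) auto
  also have "\<dots> = b powr (- (s + t))" by (simp flip: powr_add)
  finally show ?thesis by (smt (verit) powr_ge_zero)
qed

text \<open>
  A majorant of \<open>\<bar>z - c\<bar> powr (-1/2) * (1 - z\<^sup>2) powr (-7/16)\<close> on \<open>(-1, 1)\<close>, in which every singularity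
  has the still integrable exponent \<open>15/16 = 1/2 + 7/16\<close>.
\<close>

definition polar_weight :: "real \<Rightarrow> real \<Rightarrow> real" where
  "polar_weight c z = 2 * \<bar>z - c\<bar> powr (-(15/16)) + \<bar>z - 1\<bar> powr (-(15/16)) + \<bar>z - (-1)\<bar> powr (-(15/16))"

text \<open>
  A majorant of \<open>\<bar>sin t\<bar> powr (-7/8)\<close> on one period, with a term for each zero of the sine.
\<close>

definition azimuth_weight :: "real \<Rightarrow> real" where
  "azimuth_weight t = 2 * (\<bar>t - 0\<bar> powr (-(7/8)) + \<bar>t - pi\<bar> powr (-(7/8)) + \<bar>t - 2 * pi\<bar> powr (-(7/8)))"

lemma polar_weight_bound:
  assumes "\<bar>z\<bar> < 1" "z \<noteq> c"
  shows "\<bar>z - c\<bar> powr (-(1/2)) * (1 - z\<^sup>2) powr (-(7/16)) \<le> polar_weight c z"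
proof -
  have ab: "0 < 1 - z" "0 < 1 + z" using assms by auto
  have f: "1 - z\<^sup>2 = (1 - z) * (1 + z)" by (simp add: algebra_simps power2_eq_square)
  have "(1 - z\<^sup>2) powr (-(7/16)) \<le> (1 - z) powr (-(7/16)) + (1 + z) powr (-(7/16))"
  proof (cases "z \<ge> 0")
    case True
    have "(1 + z) powr (-(7/16)) \<le> 1 powr (-(7/16))"
      using True by (intro powr_mono2') auto
    then have "(1 - z) powr (-(7/16)) * (1 + z) powr (-(7/16)) \<le> (1 - z) powr (-(7/16))"
      by (simp add: mult_left_le)
    then show ?thesis unfolding f powr_mult by (smt (verit) powr_ge_zero)
  next
    case False
    have "(1 - z) powr (-(7/16)) \<le> 1 powr (-(7/16))"
      using False by (intro powr_mono2') auto
    then have "(1 - z) powr (-(7/16)) * (1 + z) powr (-(7/16)) \<le> (1 + z) powr (-(7/16))"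
      using mult_right_mono[of "(1 - z) powr (-(7/16))" 1 "(1 + z) powr (-(7/16))"] by simp
    then show ?thesis unfolding f powr_mult by (smt (verit) powr_ge_zero)
  qed
  then have "\<bar>z - c\<bar> powr (-(1/2)) * (1 - z\<^sup>2) powr (-(7/16)) \<le>
     \<bar>z - c\<bar> powr (-(1/2)) * ((1 - z) powr (-(7/16)) + (1 + z) powr (-(7/16)))"
    by (intro mult_left_mono) auto
  moreover have "\<bar>z - c\<bar> powr (-(1/2)) * (1 - z) powr (-(7/16)) \<le>
      \<bar>z - c\<bar> powr (-(15/16)) + (1 - z) powr (-(15/16))"
    using powr_young[of "\<bar>z - c\<bar>" "1 - z" "1/2" "7/16"] assms ab by simp
  moreover have "\<bar>z - c\<bar> powr (-(1/2)) * (1 + z) powr (-(7/16)) \<le>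
      \<bar>z - c\<bar> powr (-(15/16)) + (1 + z) powr (-(15/16))"
    using powr_young[of "\<bar>z - c\<bar>" "1 + z" "1/2" "7/16"] assms ab by simp
  moreover have "\<bar>z - 1\<bar> = 1 - z" "\<bar>z - (-1)\<bar> = 1 + z" using ab by auto
  ultimately show ?thesis by (simp add: polar_weight_def algebra_simps)
qed

lemma azimuth_weight_bound:
  assumes "0 \<le> t" "t \<le> 2 * pi" "t \<noteq> 0" "t \<noteq> pi" "t \<noteq> 2 * pi"
  shows "\<bar>sin t\<bar> > 0" "\<bar>sin t\<bar> powr (-(7/8)) \<le> azimuth_weight t"
proof -
  have *: "\<bar>sin t\<bar> > 0 \<and> \<bar>sin t\<bar> powr (-(7/8)) \<le> 2 * d powr (-(7/8))" if "d/2 \<le> \<bar>sin t\<bar>" "d > 0" for d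
  proof -
    have "\<bar>sin t\<bar> powr (-(7/8)) \<le> (d/2) powr (-(7/8))"
      using that by (intro powr_mono2') auto
    also have "\<dots> = 2 powr (7/8) * d powr (-(7/8))"
      using that by (simp add: powr_divide powr_minus divide_simps)
    also have "\<dots> \<le> 2 powr 1 * d powr (-(7/8))"
      by (intro mult_right_mono powr_mono) auto
    finally show ?thesis using that by simp
  qed
  consider d where "d/2 \<le> \<bar>sin t\<bar>" "d > 0" "d = \<bar>t\<bar> \<or> d = \<bar>t - pi\<bar> \<or> d = \<bar>t - 2*pi\<bar>"
    using abs_sin_ge_dist[OF assms(1,2)] assms by (metis abs_ge_zero abs_zero eq_iff_diff_eq_0 less_eq_real_def zero_less_abs_iff)
  then have "\<bar>sin t\<bar> > 0 \<and> \<bar>sin t\<bar> powr (-(7/8)) \<le> azimuth_weight t"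
  proof cases
    case 1
    from *[OF 1(1,2)] 1(3) show ?thesis
      unfolding azimuth_weight_def by (smt (verit) powr_ge_zero diff_zero)
  qed
  then show "\<bar>sin t\<bar> > 0" "\<bar>sin t\<bar> powr (-(7/8)) \<le> azimuth_weight t" by auto
qed

text \<open>
  The exponent \<open>9/4\<close> of the distance is shared out as \<open>7/8\<close> to the difference of the radii, \<open>1/2\<close> to
  that of the heights and \<open>7/8\<close> to the azimuthal coordinate. The last two contribute the powers
  \<open>-1/2\<close> and \<open>-7/8\<close> of \<open>r'\<close>, which the factor \<open>r'\<^sup>2\<close> more than absorbs. The bound is a product in
  which each variable is integrated separately, save that the centre of the polar weight depends
  on \<open>r'\<close>.
\<close>

lemma dist2_powr_bound:
  assumes "0 \<le> r" "\<bar>z\<bar> \<le> 1" "0 < r'" "r' \<le> R" "r' \<noteq> r" "\<bar>z'\<bar> < 1" "z' \<noteq> r * z / r'"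
    and t: "0 \<le> t" "t \<le> 2 * pi" "t \<noteq> 0" "t \<noteq> pi" "t \<noteq> 2 * pi"
  shows "dist2 (r, z) ((r', z'), t) > 0"
    and "r'\<^sup>2 * dist2 (r, z) ((r', z'), t) powr (-(9/8)) \<le>
      (1 + R) * \<bar>r' - r\<bar> powr (-(7/8)) * polar_weight (r * z / r') z' * azimuth_weight t"
proof -
  define d where "d = dist2 (r, z) ((r', z'), t)"
  define D where "D = sqrt d"
  define w where "w = sqrt (1 - z'\<^sup>2)"
  have w2: "0 < 1 - z'\<^sup>2" using assms by (simp add: abs_square_less_1)
  then have w: "w > 0" by (simp add: w_def)
  note s = azimuth_weight_bound[OF t]
  have d1: "(r' - r)\<^sup>2 \<le> d"
    using dist2_angle_bounds(2)[of z z' r r' t] assms by (auto simp: d_def power2_commute)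
  have cart: "d = (r * sqrt (1 - z\<^sup>2) - r' * w * cos t)\<^sup>2 + (r' * w * sin t)\<^sup>2 + (r * z - r' * z')\<^sup>2"
    unfolding d_def w_def using assms by (intro dist2_cartesian) auto
  have d2: "(r' * w * sin t)\<^sup>2 \<le> d" and d3: "(r * z - r' * z')\<^sup>2 \<le> d"
    unfolding cart by auto
  have eq3: "r * z - r' * z' = - (r' * (z' - r * z / r'))" using assms by (simp add: field_simps)
  have D1: "\<bar>r' - r\<bar> \<le> D" using real_sqrt_le_mono[OF d1] by (simp add: D_def)
  have D2: "r' * w * \<bar>sin t\<bar> \<le> D"
    using real_sqrt_le_mono[OF d2] w assms by (simp add: D_def abs_mult)
  have D3: "r' * \<bar>z' - r * z / r'\<bar> \<le> D"
    using real_sqrt_le_mono[OF d3] assms unfolding eq3 by (simp add: D_def abs_mult)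
  have Dpos: "D > 0" using D1 assms by linarith
  then show "dist2 (r, z) ((r', z'), t) > 0" by (simp add: D_def d_def)
  have "d powr (-(9/8)) = D powr (-(9/4))"
    using Dpos by (simp add: D_def powr_powr flip: powr_half_sqrt)
  also have "\<dots> = D powr (-(7/8)) * (D powr (-(7/8)) * D powr (-(1/2)))"
    by (simp flip: powr_add)
  also have "\<dots> \<le> \<bar>r' - r\<bar> powr (-(7/8)) *
      ((r' * w * \<bar>sin t\<bar>) powr (-(7/8)) * (r' * \<bar>z' - r * z / r'\<bar>) powr (-(1/2)))"
  proof -
    have pos: "0 < \<bar>r' - r\<bar>" "0 < r' * w * \<bar>sin t\<bar>" "0 < r' * \<bar>z' - r * z / r'\<bar>"
      using assms(3,5,7) w s(1) by (simp_all only: mult_pos_pos zero_less_abs_iff eq_iff_diff_eq_0[symmetric] not_False_eq_True)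
    show ?thesis
      by (intro mult_mono powr_mono2' D1 D2 D3 pos mult_nonneg_nonneg powr_ge_zero) simp_all
  qed
  also have "\<dots> = \<bar>r' - r\<bar> powr (-(7/8)) * (r' powr (-(11/8)) *
      (\<bar>z' - r * z / r'\<bar> powr (-(1/2)) * (1 - z'\<^sup>2) powr (-(7/16))) * \<bar>sin t\<bar> powr (-(7/8)))"
  proof -
    have "w powr (-(7/8)) = (1 - z'\<^sup>2) powr (-(7/16))"
      using w2 by (simp add: w_def powr_powr flip: powr_half_sqrt)
    moreover have "r' powr (-(7/8)) * r' powr (-(1/2)) = r' powr (-(11/8))"
      by (simp flip: powr_add)
    ultimately show ?thesis by (simp add: powr_mult)
  qed
  finally have "r'\<^sup>2 * d powr (-(9/8)) \<le> r'\<^sup>2 * (\<bar>r' - r\<bar> powr (-(7/8)) * (r' powr (-(11/8)) *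
      (\<bar>z' - r * z / r'\<bar> powr (-(1/2)) * (1 - z'\<^sup>2) powr (-(7/16))) * \<bar>sin t\<bar> powr (-(7/8))))"
    by (intro mult_left_mono) auto
  also have "\<dots> = r' powr (5/8) * \<bar>r' - r\<bar> powr (-(7/8)) *
      (\<bar>z' - r * z / r'\<bar> powr (-(1/2)) * (1 - z'\<^sup>2) powr (-(7/16))) * \<bar>sin t\<bar> powr (-(7/8))"
  proof -
    have "r'\<^sup>2 * r' powr (-(11/8)) = r' powr (5/8)"
      using assms by (simp flip: powr_add powr_numeral)
    then show ?thesis by simp
  qed
  also have "\<dots> \<le> (1 + R) * \<bar>r' - r\<bar> powr (-(7/8)) * polar_weight (r * z / r') z' * azimuth_weight t"
  proof -
    have "r' powr (5/8) \<le> (1 + R) powr (5/8)" using assms by (intro powr_mono2) auto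
    also have "\<dots> \<le> (1 + R) powr 1" using assms by (intro powr_mono) auto
    finally have "r' powr (5/8) \<le> 1 + R" using assms by simp
    moreover have "0 \<le> 1 + R" using assms by simp
    moreover have "0 \<le> polar_weight (r * z / r') z'" by (simp add: polar_weight_def)
    ultimately show ?thesis
      by (intro mult_mono s(2) polar_weight_bound[OF assms(6,7)] mult_nonneg_nonneg powr_ge_zero order_refl)
  qed
  finally show "r'\<^sup>2 * dist2 (r, z) ((r', z'), t) powr (-(9/8)) \<le>
      (1 + R) * \<bar>r' - r\<bar> powr (-(7/8)) * polar_weight (r * z / r') z' * azimuth_weight t"
    by (simp only: d_def)
qed


section \<open>Uniform integrability of the Newtonian kernel\<close>

text \<open>
  The value \<open>\<infinity>\<close> at distance \<open>0\<close> turns a bound on the integral into the statement that the singular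
  points form a null set, so that integrands dominated by the weight may be arbitrary there.
\<close>

definition potential_weight :: "real \<Rightarrow> real \<times> real \<Rightarrow> (real \<times> real) \<times> real \<Rightarrow> ennreal" where
  "potential_weight R p y = (if y \<in> spherical_box R
     then if dist2 p y = 0 then \<infinity> else ennreal ((fst (fst y))\<^sup>2 * dist2 p y powr (-(9/8))) else 0)"

lemma measurable_dist2 [measurable]: "dist2 p \<in> borel_measurable borel"
  unfolding dist2_def by (intro borel_measurable_continuous_onI continuous_intros)

lemma measurable_radial_offset [measurable]: "radial_offset p \<in> borel_measurable borel"
  unfolding radial_offset_def by (intro borel_measurable_continuous_onI continuous_intros)

lemma spherical_box_cbox: "spherical_box R = cbox ((0, -1), 0) ((R, 1), 2 * pi)"
  by (auto simp: spherical_box_def cbox_Pair_eq)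

lemma compact_spherical_box: "compact (spherical_box R)"
  by (simp add: spherical_box_cbox)

lemma measurable_spherical_box [measurable]: "spherical_box R \<in> sets borel"
  by (simp add: spherical_box_cbox)

lemma measurable_potential_weight [measurable]: "potential_weight R p \<in> borel_measurable borel"
proof -
  have [measurable]: "(\<lambda>y :: (real \<times> real) \<times> real. fst (fst y)) \<in> borel_measurable borel"
    by (intro borel_measurable_continuous_onI continuous_intros)
  show ?thesis unfolding potential_weight_def by measurable
qed

lemma polar_weight_nonneg: "0 \<le> polar_weight c z"
  by (simp add: polar_weight_def)

lemma nn_integral_polar_weight:
  "(\<integral>\<^sup>+z. ennreal (indicator {-1..1} z * polar_weight c z) \<partial>lborel) \<le> ennreal 136"
proof -
  have e: "ennreal (indicator {-1..1} z * polar_weight c z) =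
    2 * ennreal (indicator {-1..1} z * \<bar>z - c\<bar> powr (-(15/16))) +
    ennreal (indicator {-1..1} z * \<bar>z - 1\<bar> powr (-(15/16))) +
    ennreal (indicator {-1..1} z * \<bar>z - (-1)\<bar> powr (-(15/16)))" for z
    unfolding ennreal_numeral[symmetric]
    by (subst ennreal_mult'[symmetric], simp, (subst ennreal_plus[symmetric], simp, simp)+)
       (simp add: polar_weight_def algebra_simps)
  have b: "(\<integral>\<^sup>+z. ennreal (indicator {-1..1} z * \<bar>z - c\<bar> powr (-(15/16))) \<partial>lborel) \<le> ennreal 34" for c
    using nn_integral_abs_powr_le[of "-1" 1 "15/16" c] by simp
  have "(\<integral>\<^sup>+z. ennreal (indicator {-1..1} z * polar_weight c z) \<partial>lborel) \<le>
    2 * ennreal 34 + ennreal 34 + ennreal 34"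
    unfolding e
    by (subst nn_integral_add, measurable, subst nn_integral_add, measurable, subst nn_integral_cmult, measurable)
       (intro add_mono mult_left_mono b zero_le)
  also have "\<dots> = ennreal 136"
    unfolding ennreal_numeral[symmetric]
    by (simp del: ennreal_numeral flip: ennreal_plus ennreal_mult')
  finally show ?thesis .
qed

lemma nn_integral_azimuth_weight:
  "(\<integral>\<^sup>+t. ennreal (indicator {0..2*pi} t * azimuth_weight t) \<partial>lborel) \<le> ennreal (6 * (2 * pi + 16))"
proof -
  have e: "ennreal (indicator {0..2*pi} t * azimuth_weight t) =
    2 * (ennreal (indicator {0..2*pi} t * \<bar>t - 0\<bar> powr (-(7/8))) +
    ennreal (indicator {0..2*pi} t * \<bar>t - pi\<bar> powr (-(7/8))) +
    ennreal (indicator {0..2*pi} t * \<bar>t - 2*pi\<bar> powr (-(7/8))))" for t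
    unfolding ennreal_numeral[symmetric]
    by ((subst ennreal_plus[symmetric], simp, simp)+, subst ennreal_mult'[symmetric], simp)
       (simp add: azimuth_weight_def algebra_simps)
  have b: "(\<integral>\<^sup>+t. ennreal (indicator {0..2*pi} t * \<bar>t - c\<bar> powr (-(7/8))) \<partial>lborel) \<le> ennreal (2 * pi + 16)" for c
    using nn_integral_abs_powr_le[of 0 "2*pi" "7/8" c] by simp
  have "(\<integral>\<^sup>+t. ennreal (indicator {0..2*pi} t * azimuth_weight t) \<partial>lborel) \<le>
    2 * (ennreal (2 * pi + 16) + ennreal (2 * pi + 16) + ennreal (2 * pi + 16))"
    unfolding e
    by (subst nn_integral_cmult, measurable, subst nn_integral_add, measurable, subst nn_integral_add, measurable)
       (intro add_mono mult_left_mono b zero_le)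
  also have "\<dots> = ennreal (6 * (2 * pi + 16))"
    unfolding ennreal_numeral[symmetric]
    by (simp add: algebra_simps del: ennreal_numeral flip: ennreal_plus ennreal_mult')
  finally show ?thesis .
qed

definition weight_mass :: "real \<Rightarrow> real" where
  "weight_mass R = (1 + R) * 136 * (6 * (2 * pi + 16)) * (R + 16)"

text \<open>
  Tonelli with the radius outermost: the singularity in the polar variable sits at \<open>r z / r'\<close>, and
  the bound for the polar integral is uniform in its position.
\<close>

lemma nn_integral_potential_weight:
  assumes "0 < R" "p \<in> rz_domain R"
  shows "(\<integral>\<^sup>+y. potential_weight R p y \<partial>lborel) \<le> ennreal (weight_mass R)"
proof -
  obtain r z where p: "p = (r, z)" "0 \<le> r" "r \<le> R" "\<bar>z\<bar> \<le> 1"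
    using assms by (cases p) (auto simp: rz_domain_def)
  define I where "I = (\<lambda>r'. ennreal (indicator {0..R} r' * \<bar>r' - r\<bar> powr (-(7/8))))"
  define J where "J = (\<lambda>r' z'. ennreal (indicator {-1..1} z' * polar_weight (r * z / r') z'))"
  define K where "K = (\<lambda>t. ennreal (indicator {0..2*pi} t * azimuth_weight t))"
  have [measurable]: "K \<in> borel_measurable borel" "I \<in> borel_measurable borel"
    "J r' \<in> borel_measurable borel" for r'
    unfolding K_def I_def J_def azimuth_weight_def polar_weight_def by measurable
  have pointwise: "potential_weight R p ((r', z'), t) \<le> ennreal (1 + R) * I r' * J r' z' * K t"
    if nz: "r' \<noteq> 0" "r' \<noteq> r" "z' \<noteq> 1" "z' \<noteq> -1" "z' \<noteq> r * z / r'" "t \<noteq> 0" "t \<noteq> pi" "t \<noteq> 2*pi"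
    for r' z' t
  proof (cases "((r', z'), t) \<in> spherical_box R")
    case True
    then have b: "0 < r'" "r' \<le> R" "\<bar>z'\<bar> < 1" "0 \<le> t" "t \<le> 2 * pi"
      using nz by (auto simp: spherical_box_def)
    note d = dist2_powr_bound[OF p(2,4) b(1,2) nz(2) b(3) nz(5) b(4,5) nz(6,7,8)]
    have "potential_weight R p ((r', z'), t) = ennreal (r'\<^sup>2 * dist2 p ((r', z'), t) powr (-(9/8)))"
      using True d(1) p by (simp add: potential_weight_def)
    also have "\<dots> \<le> ennreal ((1 + R) * \<bar>r' - r\<bar> powr (-(7/8)) * polar_weight (r * z / r') z' * azimuth_weight t)"
      unfolding p(1) by (intro ennreal_leI d(2))
    also have "\<dots> = ennreal (1 + R) * ennreal (\<bar>r' - r\<bar> powr (-(7/8))) *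
        ennreal (polar_weight (r * z / r') z') * ennreal (azimuth_weight t)"
      using assms(1) by (simp add: polar_weight_nonneg ennreal_mult' del: ennreal_plus)
    also have "\<dots> = ennreal (1 + R) * I r' * J r' z' * K t"
    proof -
      have "-1 \<le> z'" "z' \<le> 1" using b by auto
      then show ?thesis using b by (simp add: I_def J_def K_def)
    qed
    finally show ?thesis .
  qed (simp add: potential_weight_def)
  have "(\<integral>\<^sup>+y. potential_weight R p y \<partial>lborel) =
    (\<integral>\<^sup>+r'. (\<integral>\<^sup>+z'. (\<integral>\<^sup>+t. potential_weight R p ((r', z'), t) \<partial>lborel) \<partial>lborel) \<partial>lborel)"
  proof -
    have [measurable]: "potential_weight R p \<in> borel_measurable ((lborel \<Otimes>\<^sub>M lborel) \<Otimes>\<^sub>M lborel)"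
      by (simp add: lborel_prod)
    have "(\<integral>\<^sup>+y. potential_weight R p y \<partial>lborel) =
      (\<integral>\<^sup>+q. (\<integral>\<^sup>+t. potential_weight R p (q, t) \<partial>lborel) \<partial>(lborel \<Otimes>\<^sub>M lborel))"
      by (subst lborel.nn_integral_fst) (simp_all add: lborel_prod)
    also have "\<dots> = (\<integral>\<^sup>+r'. (\<integral>\<^sup>+z'. (\<integral>\<^sup>+t. potential_weight R p ((r', z'), t) \<partial>lborel) \<partial>lborel) \<partial>lborel)"
      by (subst lborel.nn_integral_fst[symmetric]) simp_all
    finally show ?thesis .
  qed
  also have "\<dots> \<le> (\<integral>\<^sup>+r'. ennreal (1 + R) * I r' * (ennreal 136 * ennreal (6 * (2 * pi + 16))) \<partial>lborel)"
  proof (rule nn_integral_mono_AE, use AE_lborel_singleton[of 0] AE_lborel_singleton[of r] in eventually_elim)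
    fix r' assume r': "r' \<noteq> 0" "r' \<noteq> r"
    have "(\<integral>\<^sup>+z'. (\<integral>\<^sup>+t. potential_weight R p ((r', z'), t) \<partial>lborel) \<partial>lborel) \<le>
      (\<integral>\<^sup>+z'. ennreal (1 + R) * I r' * ennreal (6 * (2 * pi + 16)) * J r' z' \<partial>lborel)"
    proof (rule nn_integral_mono_AE, use AE_lborel_singleton[of 1] AE_lborel_singleton[of "-1"]
        AE_lborel_singleton[of "r * z / r'"] in eventually_elim)
      fix z' assume z': "z' \<noteq> 1" "z' \<noteq> -1" "z' \<noteq> r * z / r'"
      have "(\<integral>\<^sup>+t. potential_weight R p ((r', z'), t) \<partial>lborel) \<le>
        (\<integral>\<^sup>+t. ennreal (1 + R) * I r' * J r' z' * K t \<partial>lborel)"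
        by (rule nn_integral_mono_AE, use AE_lborel_singleton[of 0] AE_lborel_singleton[of pi]
            AE_lborel_singleton[of "2*pi"] in eventually_elim) (use pointwise r' z' in blast)
      also have "\<dots> = ennreal (1 + R) * I r' * J r' z' * (\<integral>\<^sup>+t. K t \<partial>lborel)"
        by (subst nn_integral_cmult) simp_all
      also have "\<dots> \<le> ennreal (1 + R) * I r' * J r' z' * ennreal (6 * (2 * pi + 16))"
        unfolding K_def by (intro mult_left_mono nn_integral_azimuth_weight zero_le)
      finally show "(\<integral>\<^sup>+t. potential_weight R p ((r', z'), t) \<partial>lborel) \<le>
        ennreal (1 + R) * I r' * ennreal (6 * (2 * pi + 16)) * J r' z'"
        by (simp add: mult_ac)
    qed
    also have "\<dots> = ennreal (1 + R) * I r' * ennreal (6 * (2 * pi + 16)) * (\<integral>\<^sup>+z'. J r' z' \<partial>lborel)"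
      by (subst nn_integral_cmult) simp_all
    also have "\<dots> \<le> ennreal (1 + R) * I r' * ennreal (6 * (2 * pi + 16)) * ennreal 136"
      unfolding J_def by (intro mult_left_mono nn_integral_polar_weight zero_le)
    finally show "(\<integral>\<^sup>+z'. (\<integral>\<^sup>+t. potential_weight R p ((r', z'), t) \<partial>lborel) \<partial>lborel) \<le>
        ennreal (1 + R) * I r' * (ennreal 136 * ennreal (6 * (2 * pi + 16)))"
      by (simp add: mult_ac)
  qed
  also have "\<dots> = ennreal (1 + R) * (\<integral>\<^sup>+r'. I r' \<partial>lborel) * (ennreal 136 * ennreal (6 * (2 * pi + 16)))"
    by (subst nn_integral_multc, simp, subst nn_integral_cmult) simp_all
  also have "\<dots> \<le> ennreal (1 + R) * ennreal (R + 16) * (ennreal 136 * ennreal (6 * (2 * pi + 16)))"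
    unfolding I_def using nn_integral_abs_powr_le[of 0 R "7/8" r] assms
    by (intro mult_left_mono mult_right_mono zero_le) simp_all
  also have "\<dots> = ennreal ((1 + R) * (R + 16) * (136 * (6 * (2 * pi + 16))))"
  proof -
    have "ennreal x * ennreal y * (ennreal u * ennreal v) = ennreal (x * y * (u * v))"
      if "0 \<le> x" "0 \<le> y" "0 \<le> u" "0 \<le> v" for x y u v
      using that by (simp add: ennreal_mult)
    from this[of "1 + R" "R + 16" 136 "6 * (2 * pi + 16)"] show ?thesis
      using assms(1) by simp
  qed
  also have "(1 + R) * (R + 16) * (136 * (6 * (2 * pi + 16))) = weight_mass R"
    by (simp add: weight_mass_def algebra_simps)
  finally show ?thesis .
qed

lemma weight_mass_pos: "0 < R \<Longrightarrow> 0 < weight_mass R"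
  unfolding weight_mass_def by (intro mult_pos_pos add_pos_pos pi_gt_zero) auto

lemma set_integral_dominated_by_weight:
  fixes g :: "(real \<times> real) \<times> real \<Rightarrow> real"
  assumes "0 < R" "p \<in> rz_domain R" "0 < A"
    and [measurable]: "set_borel_measurable lborel (spherical_box R) g"
    and le: "\<And>y. y \<in> spherical_box R \<Longrightarrow> 0 < dist2 p y \<Longrightarrow>
      \<bar>g y\<bar> \<le> A * ((fst (fst y))\<^sup>2 * dist2 p y powr (-(9/8)))"
  shows "set_integrable lborel (spherical_box R) g"
    and "\<bar>LINT y:spherical_box R|lborel. g y\<bar> \<le> A * weight_mass R"
proof -
  let ?g = "\<lambda>y. indicator (spherical_box R) y *\<^sub>R g y"
  have [measurable]: "?g \<in> borel_measurable lborel"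
    using assms(4) by (simp add: set_borel_measurable_def)
  have nonneg: "0 \<le> dist2 p y" if "y \<in> spherical_box R" for y
  proof -
    obtain r z r' z' t where e: "p = (r, z)" "y = ((r', z'), t)" by (metis surj_pair)
    have "\<bar>z\<bar> \<le> 1" "\<bar>z'\<bar> \<le> 1"
      using that assms(2) unfolding e by (auto simp: spherical_box_def rz_domain_def)
    from order_trans[OF zero_le_power2 dist2_angle_bounds(1)[OF this]] show ?thesis
      unfolding e .
  qed
  have pw: "ennreal (norm (?g y)) \<le> ennreal A * potential_weight R p y" for y
  proof (cases "y \<in> spherical_box R \<and> dist2 p y \<noteq> 0")
    case True
    then have "ennreal (norm (?g y)) \<le> ennreal (A * ((fst (fst y))\<^sup>2 * dist2 p y powr (-(9/8))))"
      using le[of y] nonneg[of y] by (intro ennreal_leI) simp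
    with True assms(3) show ?thesis
      by (simp add: potential_weight_def ennreal_mult)
  qed (use assms(3) in \<open>auto simp: potential_weight_def ennreal_mult_top\<close>)
  have "(\<integral>\<^sup>+y. ennreal (norm (?g y)) \<partial>lborel) \<le> (\<integral>\<^sup>+y. ennreal A * potential_weight R p y \<partial>lborel)"
    by (intro nn_integral_mono pw)
  also have "\<dots> \<le> ennreal A * ennreal (weight_mass R)"
    by (subst nn_integral_cmult, measurable) (intro mult_left_mono nn_integral_potential_weight assms zero_le)
  also have "\<dots> = ennreal (A * weight_mass R)"
    using assms(3) by (simp add: ennreal_mult')
  finally have fin: "(\<integral>\<^sup>+y. ennreal (norm (?g y)) \<partial>lborel) \<le> ennreal (A * weight_mass R)" .
  have "integrable lborel ?g"
    by (rule integrableI_bounded) (fact, use le_less_trans[OF fin ennreal_less_top] in simp)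
  then show int: "set_integrable lborel (spherical_box R) g"
    by (simp add: set_integrable_def)
  have "ennreal (norm (integral\<^sup>L lborel ?g)) \<le> (\<integral>\<^sup>+y. ennreal (norm (?g y)) \<partial>lborel)"
    by (rule integral_norm_bound_ennreal) fact
  also note fin
  finally show "\<bar>LINT y:spherical_box R|lborel. g y\<bar> \<le> A * weight_mass R"
    using assms(3) weight_mass_pos[OF assms(1)]
    by (simp add: set_lebesgue_integral_def ennreal_le_iff)
qed


section \<open>Regularisation of the Newtonian kernel\<close>

abbreviation continuous_rz :: "real \<Rightarrow> (real \<times> real \<Rightarrow> real) \<Rightarrow> bool" where
  "continuous_rz R f \<equiv> continuous_on (rz_domain R) f"

text \<open>
  Put \<open>a = sqrt d\<close> and \<open>b = sqrt (d + \<eta>\<^sup>2)\<close>. From \<open>a \<le> b \<le> a + \<eta>\<close> it follows that \<open>(b - a) / b\<close> is at most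
  \<open>1\<close> and at most \<open>\<eta> / a\<close>, hence at most \<open>(\<eta> / a) powr (1/4)\<close>. A quarter power of \<open>\<eta>\<close> is thus
  gained at the price of a quarter power of \<open>1/a\<close>, which brings \<open>a powr (-2)\<close> just up to
  \<open>a powr (-9/4) = d powr (-9/8)\<close>.
\<close>

lemma inverse_root_regularised:
  fixes d \<eta> L :: real
  assumes "0 < d" "d \<le> L\<^sup>2" "0 < L" "0 < \<eta>"
  shows "\<bar>1 / sqrt d - 1 / sqrt (d + \<eta>\<^sup>2)\<bar> \<le> L * \<eta> powr (1/4) * d powr (-(9/8))"
    and "\<bar>m\<bar> \<le> sqrt d \<Longrightarrow> \<bar>m / sqrt d ^ 3 - m / sqrt (d + \<eta>\<^sup>2) ^ 3\<bar> \<le> 3 * \<eta> powr (1/4) * d powr (-(9/8))"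
proof -
  define a b where "a = sqrt d" and "b = sqrt (d + \<eta>\<^sup>2)"
  have a: "0 < a" using assms by (simp add: a_def)
  have ab: "a \<le> b" unfolding a_def b_def by (intro real_sqrt_le_mono) simp
  have "b \<le> a + \<eta>"
    unfolding a_def b_def by (rule real_le_lsqrt) (use assms in \<open>auto simp: power2_sum\<close>)
  then have "(b - a) / b \<le> \<eta> / b"
    using a ab by (intro divide_right_mono) auto
  also have "\<dots> \<le> \<eta> / a"
    using a ab assms by (intro divide_left_mono) auto
  finally have ba1: "(b - a) / b \<le> \<eta> / a" .
  have "(b - a) / b \<le> (\<eta> / a) powr (1/4)"
  proof (cases "\<eta> \<le> a")
    case True
    have "(\<eta> / a) powr 1 \<le> (\<eta> / a) powr (1/4)"
      using True a assms by (intro powr_mono') auto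
    then show ?thesis using ba1 a assms by simp
  next
    case False
    have "(b - a) / b \<le> 1" using a ab by simp
    also have "1 = 1 powr (1/4 :: real)" by simp
    also have "\<dots> \<le> (\<eta> / a) powr (1/4)"
      using False a assms by (intro powr_mono2) auto
    finally show ?thesis .
  qed
  also have "\<dots> = \<eta> powr (1/4) * a powr (-(1/4))"
    using a assms by (simp add: powr_divide powr_minus divide_simps)
  finally have ba: "(b - a) / b \<le> \<eta> powr (1/4) * a powr (-(1/4))" .
  have d: "d powr (-(9/8)) = a powr (-(9/4))"
    using assms by (simp add: a_def powr_powr flip: powr_half_sqrt)
  have "1 / a - 1 / b = (b - a) / b * (1 / a)"
    using a ab by (simp add: field_simps)
  also have "\<dots> \<le> \<eta> powr (1/4) * a powr (-(1/4)) * (1 / a)"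
    using a by (intro mult_right_mono ba) auto
  also have "\<dots> = a * \<eta> powr (1/4) * a powr (-(9/4))"
  proof -
    have "a powr (-(1/4)) * (1 / a) = a powr (-(1/4)) * a powr (-1)"
      using a by (simp add: powr_minus divide_simps)
    also have "\<dots> = a powr 1 * a powr (-(9/4))"
      by (simp only: powr_add[symmetric]) simp
    finally have "a powr (-(1/4)) * (1 / a) = a * a powr (-(9/4))"
      unfolding powr_one[OF less_imp_le[OF a]] .
    note e = this
    show ?thesis
      by (simp only: mult.assoc e mult.left_commute[of "\<eta> powr (1/4)" a])
  qed
  also have "\<dots> \<le> L * \<eta> powr (1/4) * a powr (-(9/4))"
    using real_sqrt_le_mono[OF assms(2)] assms(3) by (intro mult_right_mono) (auto simp: a_def)
  finally have "1 / a - 1 / b \<le> L * \<eta> powr (1/4) * d powr (-(9/8))" unfolding d .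
  moreover have "0 \<le> 1 / a - 1 / b"
    using a ab by (simp add: field_simps)
  ultimately show "\<bar>1 / sqrt d - 1 / sqrt (d + \<eta>\<^sup>2)\<bar> \<le> L * \<eta> powr (1/4) * d powr (-(9/8))"
    by (simp add: a_def b_def)
  show "\<bar>m / sqrt d ^ 3 - m / sqrt (d + \<eta>\<^sup>2) ^ 3\<bar> \<le> 3 * \<eta> powr (1/4) * d powr (-(9/8))"
    if "\<bar>m\<bar> \<le> sqrt d"
  proof -
    have b: "0 < b" using a ab by simp
    have cube: "b ^ 3 - a ^ 3 = (b - a) * (a * a + a * b + b * b)"
      by (simp add: algebra_simps power3_eq_cube)
    have "b ^ 3 - a ^ 3 \<le> (b - a) * (b * b + b * b + b * b)"
      unfolding cube using a ab by (intro mult_left_mono add_mono mult_mono) auto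
    then have "(b ^ 3 - a ^ 3) / (a ^ 3 * b ^ 3) \<le> ((b - a) * (3 * b\<^sup>2)) / (a ^ 3 * b ^ 3)"
      using a b by (intro divide_right_mono) (auto simp: power2_eq_square)
    also have "\<dots> = 3 * ((b - a) / b) * (1 / a ^ 3)"
      using a b by (simp add: field_simps power2_eq_square power3_eq_cube)
    also have "\<dots> \<le> 3 * (\<eta> powr (1/4) * a powr (-(1/4))) * (1 / a ^ 3)"
      using a by (intro mult_right_mono mult_left_mono ba) auto
    finally have cubes: "1 / a ^ 3 - 1 / b ^ 3 \<le> 3 * (\<eta> powr (1/4) * a powr (-(1/4))) * (1 / a ^ 3)"
      using a b by (simp add: diff_frac_eq mult.commute)
    have nn: "0 \<le> 1 / a ^ 3 - 1 / b ^ 3"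
      using a ab by (simp add: frac_le power_mono)
    have "\<bar>m / a ^ 3 - m / b ^ 3\<bar> = \<bar>m\<bar> * (1 / a ^ 3 - 1 / b ^ 3)"
    proof -
      have "m / a ^ 3 - m / b ^ 3 = m * (1 / a ^ 3 - 1 / b ^ 3)" by (simp add: right_diff_distrib)
      then show ?thesis by (simp only: abs_mult abs_of_nonneg[OF nn])
    qed
    also have "\<dots> \<le> a * (3 * (\<eta> powr (1/4) * a powr (-(1/4))) * (1 / a ^ 3))"
      using that a nn cubes by (intro mult_mono) (auto simp: a_def)
    also have "\<dots> = 3 * \<eta> powr (1/4) * (a powr (-(1/4)) * a powr (-2))"
      using a by (simp add: powr_minus field_simps power3_eq_cube power2_eq_square)
    also have "a powr (-(1/4)) * a powr (-2) = d powr (-(9/8))"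
      unfolding d by (simp flip: powr_add)
    finally show ?thesis by (simp add: a_def b_def)
  qed
qed

text \<open>
  For \<open>\<eta> = 0\<close> this is the Newtonian kernel itself, with the value \<open>0\<close> at distance \<open>0\<close>.
\<close>

definition regular_kernel :: "real \<Rightarrow> real \<times> real \<Rightarrow> (real \<times> real) \<times> real \<Rightarrow> real" where
  "regular_kernel \<eta> p y = 1 / sqrt (dist2 p y + \<eta>\<^sup>2)"

text \<open>
  The derivative of \<^const>\<open>regular_kernel\<close> in the radius of \<open>p\<close>; see \<open>regular_kernel_has_derivative\<close>
  below for \<open>\<eta> > 0\<close>.
\<close>

definition regular_kernel_deriv :: "real \<Rightarrow> real \<times> real \<Rightarrow> (real \<times> real) \<times> real \<Rightarrow> real" where
  "regular_kernel_deriv \<eta> p y = - radial_offset p y / sqrt (dist2 p y + \<eta>\<^sup>2) ^ 3"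

definition box_integral :: "real \<Rightarrow> (real \<times> real \<Rightarrow> real) \<Rightarrow> ((real \<times> real) \<times> real \<Rightarrow> real) \<Rightarrow> real" where
  "box_integral R f k =
    1 / (4 * pi) * (LINT y:spherical_box R|lborel. f (fst y) * (fst (fst y))\<^sup>2 * k y)"

text \<open>
  Continuity is included because the sources to which the potential is applied are always
  continuous, and continuity is what makes their densities measurable.
\<close>

definition sup_bounded :: "real \<Rightarrow> real \<Rightarrow> (real \<times> real \<Rightarrow> real) \<Rightarrow> bool" where
  "sup_bounded R M f \<longleftrightarrow> continuous_rz R f \<and> (\<forall>q\<in>rz_domain R. \<bar>f q\<bar> \<le> M)"

lemma spherical_box_fst: "y \<in> spherical_box R \<Longrightarrow> fst y \<in> rz_domain R"
  by (auto simp: spherical_box_def rz_domain_def)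

lemma dist2_box_bounds:
  assumes "p \<in> rz_domain R" "y \<in> spherical_box R"
  shows "0 \<le> dist2 p y" "dist2 p y \<le> (2 * R)\<^sup>2" "\<bar>radial_offset p y\<bar> \<le> sqrt (dist2 p y)"
proof -
  obtain r z r' z' t where e: "p = (r, z)" "y = ((r', z'), t)" by (metis surj_pair)
  have b: "\<bar>z\<bar> \<le> 1" "\<bar>z'\<bar> \<le> 1" "0 \<le> r" "r \<le> R" "0 \<le> r'" "r' \<le> R"
    using assms unfolding e by (auto simp: spherical_box_def rz_domain_def)
  note d = dist2_angle_bounds[OF b(1,2), of r r' t]
  show "0 \<le> dist2 p y" using order_trans[OF zero_le_power2 d(1)] by (simp add: e)
  have "(\<bar>r\<bar> + \<bar>r'\<bar>)\<^sup>2 \<le> (2 * R)\<^sup>2" using b by (intro power_mono) auto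
  then show "dist2 p y \<le> (2 * R)\<^sup>2" using d(3) by (simp add: e)
  show "\<bar>radial_offset p y\<bar> \<le> sqrt (dist2 p y)"
    using real_sqrt_le_mono[OF d(1)] by (simp add: e)
qed

lemma density_measurable:
  assumes "continuous_rz R f" and [measurable]: "k \<in> borel_measurable borel"
  shows "set_borel_measurable lborel (spherical_box R) (\<lambda>y. f (fst y) * (fst (fst y))\<^sup>2 * k y)"
proof -
  have "continuous_on (spherical_box R) (\<lambda>y. f (fst y) * (fst (fst y))\<^sup>2)"
    by (intro continuous_intros continuous_on_compose2[OF assms(1)]) (auto simp: spherical_box_def rz_domain_def)
  then have [measurable]: "(\<lambda>y. indicator (spherical_box R) y *\<^sub>R (f (fst y) * (fst (fst y))\<^sup>2)) \<in> borel_measurable borel"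
    by (intro borel_measurable_continuous_on_indicator) simp_all
  have "(\<lambda>y. (indicator (spherical_box R) y *\<^sub>R (f (fst y) * (fst (fst y))\<^sup>2)) * k y) \<in> borel_measurable borel"
    by measurable
  then show ?thesis by (simp add: set_borel_measurable_def mult_ac)
qed

lemma box_integral_singular:
  assumes "0 < R" "p \<in> rz_domain R" "sup_bounded R M f" "0 \<le> M" "0 < A" "k \<in> borel_measurable borel"
    and k: "\<And>y. y \<in> spherical_box R \<Longrightarrow> 0 < dist2 p y \<Longrightarrow> \<bar>k y\<bar> \<le> A * dist2 p y powr (-(9/8))"
  shows "set_integrable lborel (spherical_box R) (\<lambda>y. f (fst y) * (fst (fst y))\<^sup>2 * k y)"
    and "\<bar>box_integral R f k\<bar> \<le> M * A * weight_mass R"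
proof -
  have le: "\<bar>f (fst y) * (fst (fst y))\<^sup>2 * k y\<bar> \<le> N * A * ((fst (fst y))\<^sup>2 * dist2 p y powr (-(9/8)))"
    if "y \<in> spherical_box R" "0 < dist2 p y" "M \<le> N" for y N
  proof -
    have "\<bar>f (fst y)\<bar> \<le> M"
      using assms(3) spherical_box_fst[OF that(1)] by (simp add: sup_bounded_def)
    then have "\<bar>f (fst y)\<bar> * (fst (fst y))\<^sup>2 * \<bar>k y\<bar> \<le> N * (fst (fst y))\<^sup>2 * (A * dist2 p y powr (-(9/8)))"
      using that k[OF that(1,2)] assms(4) by (intro mult_mono) auto
    then show ?thesis by (simp add: abs_mult mult_ac)
  qed
  have m: "set_borel_measurable lborel (spherical_box R) (\<lambda>y. f (fst y) * (fst (fst y))\<^sup>2 * k y)"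
    using assms by (intro density_measurable) (auto simp: sup_bounded_def)
  show "set_integrable lborel (spherical_box R) (\<lambda>y. f (fst y) * (fst (fst y))\<^sup>2 * k y)"
    using assms by (intro set_integral_dominated_by_weight(1)[where A="(M + 1) * A" and p=p] m le) auto
  have "\<bar>LINT y:spherical_box R|lborel. f (fst y) * (fst (fst y))\<^sup>2 * k y\<bar> \<le> M * A * weight_mass R"
  proof (cases "M = 0")
    case True
    then have "f (fst y) = 0" if "y \<in> spherical_box R" for y
      using assms(3) spherical_box_fst[OF that] by (auto simp: sup_bounded_def)
    then have "(LINT y:spherical_box R|lborel. f (fst y) * (fst (fst y))\<^sup>2 * k y)
      = (LINT y:spherical_box R|lborel. 0)"
      by (intro set_lebesgue_integral_cong) auto
    then show ?thesis using True by simp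
  next
    case False
    then show ?thesis
      using assms by (intro set_integral_dominated_by_weight(2)[where p=p] m le) auto
  qed
  moreover have "1 \<le> 4 * pi" using pi_gt3 by simp
  ultimately show "\<bar>box_integral R f k\<bar> \<le> M * A * weight_mass R"
    using mult_mono[of "1 / (4 * pi)" 1 "\<bar>LINT y:spherical_box R|lborel. f (fst y) * (fst (fst y))\<^sup>2 * k y\<bar>" "M * A * weight_mass R"]
    unfolding box_integral_def abs_mult by (simp add: divide_simps)
qed

lemma measurable_regular_kernel [measurable]:
  "regular_kernel \<eta> p \<in> borel_measurable borel" "regular_kernel_deriv \<eta> p \<in> borel_measurable borel"
  unfolding regular_kernel_def regular_kernel_deriv_def by measurable

lemma kernel_singularity:
  assumes "0 < R" "p \<in> rz_domain R" "y \<in> spherical_box R" "0 < dist2 p y"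
  shows "\<bar>regular_kernel 0 p y\<bar> \<le> (1 + 2 * R) powr (5/4) * dist2 p y powr (-(9/8))"
    and "\<bar>regular_kernel_deriv 0 p y\<bar> \<le> (1 + 2 * R) powr (5/4) * dist2 p y powr (-(9/8))"
proof -
  define a where "a = sqrt (dist2 p y)"
  have a: "0 < a" using assms by (simp add: a_def)
  have aR: "a \<le> 1 + 2 * R"
    unfolding a_def
    by (intro real_le_lsqrt order_trans[OF dist2_box_bounds(2)[OF assms(2,3)]] power_mono) (use assms(1) in auto)
  have d: "dist2 p y powr (-(9/8)) = a powr (-(9/4))"
    using assms by (simp add: a_def powr_powr flip: powr_half_sqrt)
  have *: "a powr s * a powr (-(9/4)) \<le> (1 + 2 * R) powr (5/4) * a powr (-(9/4))"
    if "s \<le> 5/4" "0 \<le> s" for s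
  proof (rule mult_right_mono)
    have "a powr s \<le> (1 + 2 * R) powr s" using aR a that by (intro powr_mono2) auto
    also have "\<dots> \<le> (1 + 2 * R) powr (5/4)" using that assms(1) by (intro powr_mono) auto
    finally show "a powr s \<le> (1 + 2 * R) powr (5/4)" .
  qed simp
  have "\<bar>regular_kernel 0 p y\<bar> = a powr (-1)"
    using a by (simp add: regular_kernel_def a_def[symmetric] powr_minus divide_simps)
  also have "\<dots> = a powr (5/4) * a powr (-(9/4))" by (simp flip: powr_add)
  finally show "\<bar>regular_kernel 0 p y\<bar> \<le> (1 + 2 * R) powr (5/4) * dist2 p y powr (-(9/8))"
    using *[of "5/4"] by (simp add: d)
  have "\<bar>regular_kernel_deriv 0 p y\<bar> \<le> a / a ^ 3"
    using a dist2_box_bounds(3)[OF assms(2,3)]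
    unfolding regular_kernel_deriv_def by (simp add: a_def[symmetric] divide_right_mono)
  also have "\<dots> = a powr (-2)"
    using a by (simp add: powr_minus field_simps power2_eq_square power3_eq_cube)
  also have "\<dots> = a powr (1/4) * a powr (-(9/4))" by (simp flip: powr_add)
  finally show "\<bar>regular_kernel_deriv 0 p y\<bar> \<le> (1 + 2 * R) powr (5/4) * dist2 p y powr (-(9/8))"
    using *[of "1/4"] by (simp add: d)
qed

text \<open>
  One constant that serves the kernel, its radial derivative and the errors of their regularisation.
\<close>

definition kernel_const :: "real \<Rightarrow> real" where
  "kernel_const R = (3 + 2 * R) powr (5/4) * weight_mass R"

lemma kernel_const_pos: "0 < R \<Longrightarrow> 0 < kernel_const R"
  unfolding kernel_const_def by (intro mult_pos_pos weight_mass_pos) auto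

lemma box_integral_kernel_bound:
  assumes "0 < R" "p \<in> rz_domain R" "sup_bounded R M f" "0 \<le> M"
    and "k = regular_kernel 0 p \<or> k = regular_kernel_deriv 0 p"
  shows "set_integrable lborel (spherical_box R) (\<lambda>y. f (fst y) * (fst (fst y))\<^sup>2 * k y)"
    and "\<bar>box_integral R f k\<bar> \<le> M * kernel_const R"
proof -
  have k: "k \<in> borel_measurable borel" using assms(5) by auto
  have le: "\<bar>k y\<bar> \<le> (3 + 2 * R) powr (5/4) * dist2 p y powr (-(9/8))"
    if "y \<in> spherical_box R" "0 < dist2 p y" for y
  proof -
    have "\<bar>k y\<bar> \<le> (1 + 2 * R) powr (5/4) * dist2 p y powr (-(9/8))"
      using kernel_singularity[OF assms(1,2) that] assms(5) by auto
    also have "\<dots> \<le> (3 + 2 * R) powr (5/4) * dist2 p y powr (-(9/8))"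
      using assms(1) by (intro mult_right_mono powr_mono2) auto
    finally show ?thesis .
  qed
  have A: "0 < (3 + 2 * R) powr (5/4)" using assms(1) by simp
  show "set_integrable lborel (spherical_box R) (\<lambda>y. f (fst y) * (fst (fst y))\<^sup>2 * k y)"
    "\<bar>box_integral R f k\<bar> \<le> M * kernel_const R"
    using box_integral_singular[OF assms(1-4) A k le] by (simp_all add: kernel_const_def mult_ac)
qed

lemma regular_kernel_continuous:
  assumes "0 < \<eta>"
  shows "continuous_on (rz_domain R \<times> spherical_box R) (\<lambda>(p, y). regular_kernel \<eta> p y)"
    and "continuous_on (rz_domain R \<times> spherical_box R) (\<lambda>(p, y). regular_kernel_deriv \<eta> p y)"
proof -
  have pos: "dist2 p y + \<eta>\<^sup>2 \<noteq> 0" if "p \<in> rz_domain R" "y \<in> spherical_box R" for p y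
    using dist2_box_bounds(1)[OF that] assms by (simp add: add_nonneg_eq_0_iff)
  have c: "continuous_on S (\<lambda>x. dist2 (fst x) (snd x))" "continuous_on S (\<lambda>x. radial_offset (fst x) (snd x))" for S
    unfolding dist2_def radial_offset_def by (intro continuous_intros)+
  show "continuous_on (rz_domain R \<times> spherical_box R) (\<lambda>(p, y). regular_kernel \<eta> p y)"
    "continuous_on (rz_domain R \<times> spherical_box R) (\<lambda>(p, y). regular_kernel_deriv \<eta> p y)"
    unfolding regular_kernel_def regular_kernel_deriv_def case_prod_unfold
    by (intro continuous_intros c; use pos in auto)+
qed

lemma box_integral_regularised:
  assumes "0 < R" "0 < \<eta>" "sup_bounded R M f" "0 \<le> M" "p \<in> rz_domain R"
  shows "\<bar>box_integral R f (regular_kernel 0 p) - box_integral R f (regular_kernel \<eta> p)\<bar>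
      \<le> M * \<eta> powr (1/4) * kernel_const R"
    and "\<bar>box_integral R f (regular_kernel_deriv 0 p) - box_integral R f (regular_kernel_deriv \<eta> p)\<bar>
      \<le> M * \<eta> powr (1/4) * kernel_const R"
proof -
  have int: "set_integrable lborel (spherical_box R) (\<lambda>y. f (fst y) * (fst (fst y))\<^sup>2 * k y)"
    if "continuous_on (spherical_box R) k" for k
  proof -
    have "continuous_on (spherical_box R) (\<lambda>y. f (fst y))"
      using assms(3) by (intro continuous_on_compose2[of "rz_domain R" f _ fst])
        (auto simp: sup_bounded_def spherical_box_def rz_domain_def intro!: continuous_intros)
    then show ?thesis
      unfolding set_integrable_def
      by (intro borel_integrable_compact compact_spherical_box continuous_intros that)
  qed
  have slice: "continuous_on (spherical_box R) (K p)"
    if "continuous_on (rz_domain R \<times> spherical_box R) (\<lambda>(p, y). K p y)" for K :: "real \<times> real \<Rightarrow> _ \<Rightarrow> real"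
  proof -
    have "continuous_on (spherical_box R) (\<lambda>y. (p, y))" by (intro continuous_intros)
    from continuous_on_compose2[OF that this] show ?thesis using assms(5) by auto
  qed
  have main: "\<bar>box_integral R f k0 - box_integral R f k\<bar> \<le> M * \<eta> powr (1/4) * kernel_const R"
    if k0: "k0 = regular_kernel 0 p \<or> k0 = regular_kernel_deriv 0 p"
      and k: "continuous_on (spherical_box R) k" "k \<in> borel_measurable borel"
      and le: "\<And>y. y \<in> spherical_box R \<Longrightarrow> 0 < dist2 p y \<Longrightarrow>
        \<bar>k0 y - k y\<bar> \<le> (3 + 2 * R) * \<eta> powr (1/4) * dist2 p y powr (-(9/8))" for k0 k
  proof -
    have "box_integral R f k0 - box_integral R f k = box_integral R f (\<lambda>y. k0 y - k y)"
      unfolding box_integral_def right_diff_distrib[symmetric]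
      by (subst set_integral_diff(2)[symmetric])
        (use box_integral_kernel_bound(1)[OF assms(1,5,3,4) k0] int[OF k(1)] in \<open>auto simp: algebra_simps\<close>)
    also have "\<bar>\<dots>\<bar> \<le> M * ((3 + 2 * R) * \<eta> powr (1/4)) * weight_mass R"
      by (rule box_integral_singular(2)[OF assms(1,5,3,4)])
         (use k0 k le assms in auto)
    also have "\<dots> \<le> M * \<eta> powr (1/4) * kernel_const R"
    proof -
      have "(3 + 2 * R) powr 1 \<le> (3 + 2 * R) powr (5/4)"
        using assms(1) by (intro powr_mono) auto
      then have "(3 + 2 * R) * (M * \<eta> powr (1/4) * weight_mass R) \<le>
          (3 + 2 * R) powr (5/4) * (M * \<eta> powr (1/4) * weight_mass R)"
        using assms weight_mass_pos[OF assms(1)] by (intro mult_right_mono) auto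
      then show ?thesis by (simp add: kernel_const_def mult_ac)
    qed
    finally show ?thesis .
  qed
  have dd: "dist2 p y \<le> (3 + 2 * R)\<^sup>2" if "y \<in> spherical_box R" for y
    by (rule order_trans[OF dist2_box_bounds(2)[OF assms(5) that]], intro power_mono) (use assms(1) in auto)
  show "\<bar>box_integral R f (regular_kernel 0 p) - box_integral R f (regular_kernel \<eta> p)\<bar>
      \<le> M * \<eta> powr (1/4) * kernel_const R"
  proof (rule main)
    fix y assume y: "y \<in> spherical_box R" "0 < dist2 p y"
    show "\<bar>regular_kernel 0 p y - regular_kernel \<eta> p y\<bar> \<le> (3 + 2 * R) * \<eta> powr (1/4) * dist2 p y powr (-(9/8))"
      using inverse_root_regularised(1)[OF y(2) dd[OF y(1)] _ assms(2)] assms(1)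
      by (simp add: regular_kernel_def)
  qed (use slice[OF regular_kernel_continuous(1)[OF assms(2)]] in auto)
  show "\<bar>box_integral R f (regular_kernel_deriv 0 p) - box_integral R f (regular_kernel_deriv \<eta> p)\<bar>
      \<le> M * \<eta> powr (1/4) * kernel_const R"
  proof (rule main)
    fix y assume y: "y \<in> spherical_box R" "0 < dist2 p y"
    have "\<bar>regular_kernel_deriv 0 p y - regular_kernel_deriv \<eta> p y\<bar> \<le> 3 * \<eta> powr (1/4) * dist2 p y powr (-(9/8))"
      using inverse_root_regularised(2)[OF y(2) dd[OF y(1)] _ assms(2), of "- radial_offset p y"]
        dist2_box_bounds(3)[OF assms(5) y(1)] assms(1)
      by (simp add: regular_kernel_deriv_def)
    also have "\<dots> \<le> (3 + 2 * R) * \<eta> powr (1/4) * dist2 p y powr (-(9/8))"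
      using assms(1) by (intro mult_right_mono) auto
    finally show "\<bar>regular_kernel_deriv 0 p y - regular_kernel_deriv \<eta> p y\<bar> \<le> (3 + 2 * R) * \<eta> powr (1/4) * dist2 p y powr (-(9/8))" .
  qed (use slice[OF regular_kernel_continuous(2)[OF assms(2)]] in auto)
qed


section \<open>The Newtonian potential\<close>

lemma sup_bounded_mono: "sup_bounded R M f \<Longrightarrow> M \<le> N \<Longrightarrow> sup_bounded R N f"
  unfolding sup_bounded_def by force

lemma compact_rz_domain: "compact (rz_domain R)"
  by (simp add: rz_domain_def compact_Times)

lemma continuous_imp_sup_bounded:
  assumes "continuous_rz R f"
  obtains M where "0 \<le> M" "sup_bounded R M f"
proof -
  have "bounded (f ` rz_domain R)"
    by (intro compact_imp_bounded compact_continuous_image assms compact_rz_domain)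
  then obtain M where "\<forall>q\<in>rz_domain R. \<bar>f q\<bar> \<le> M" "0 < M"
    by (auto simp: bounded_pos)
  then show ?thesis using assms that[of M] by (auto simp: sup_bounded_def)
qed

text \<open>
  Fubini. The iterated integral defining \<^const>\<open>KK\<close> integrates over the azimuth first, then over the
  radius and then over \<open>\<zeta>'\<close>; the density is integrable over the box by the weight estimate.
\<close>

lemma KK_eq_box_integral:
  assumes "0 < R" "p \<in> rz_domain R" "continuous_rz R f"
  shows "KK R f p = box_integral R f (regular_kernel 0 p)"
proof -
  obtain r z where p: "p = (r, z)" by (cases p)
  obtain M where M: "0 \<le> M" "sup_bounded R M f"
    using continuous_imp_sup_bounded[OF assms(3)] .
  define F where "F y = indicator (spherical_box R) y *\<^sub>R
    (f (fst y) * (fst (fst y))\<^sup>2 * regular_kernel 0 p y)" for y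
  define G where "G r' z' = indicator {0..R} r' * (indicator {-1..1} z' *
    (kernel r z r' z' * f (r', z') * r'\<^sup>2))" for r' z' :: real
  interpret Q: pair_sigma_finite "lborel \<Otimes>\<^sub>M lborel :: (real \<times> real) measure" "lborel :: real measure" ..
  have "integrable lborel F"
    using box_integral_kernel_bound(1)[OF assms(1,2) M(2,1), of "regular_kernel 0 p"]
    by (simp add: F_def[abs_def] set_integrable_def)
  then have F: "integrable ((lborel \<Otimes>\<^sub>M lborel) \<Otimes>\<^sub>M lborel) F"
    by (simp add: lborel_prod)
  have GF: "(\<integral>t. F (q, t) \<partial>lborel) = (case q of (r', z') \<Rightarrow> G r' z')" for q
  proof -
    obtain r' z' where q: "q = (r', z')" by (cases q)
    have "F (q, t) = (indicator {0..R} r' * (indicator {-1..1} z' * (f (r', z') * r'\<^sup>2))) *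
      (indicator {0..2*pi} t *\<^sub>R (1 / sqrt (dist2 p (q, t))))" for t
      by (simp add: F_def q regular_kernel_def spherical_box_def indicator_def)
    then have "(\<integral>t. F (q, t) \<partial>lborel) = (indicator {0..R} r' * (indicator {-1..1} z' * (f (r', z') * r'\<^sup>2))) *
      (LINT t:{0..2*pi}|lborel. 1 / sqrt (dist2 p (q, t)))"
      by (simp only: set_lebesgue_integral_def integral_mult_right_zero)
    also have "\<dots> = G r' z'"
      by (simp add: G_def kernel_def dist2_def p q)
    finally show ?thesis by (simp add: q)
  qed
  have "integral\<^sup>L lborel F = (\<integral>q. (case q of (r', z') \<Rightarrow> G r' z') \<partial>(lborel \<Otimes>\<^sub>M lborel))"
    using Q.integral_fst'[OF F] by (simp add: lborel_prod GF)
  also have "\<dots> = (\<integral>z'. \<integral>r'. G r' z' \<partial>lborel \<partial>lborel)"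
  proof (rule lborel_pair.integral_snd[symmetric])
    show "integrable (lborel \<Otimes>\<^sub>M lborel) (\<lambda>(r', z'). G r' z')"
      using Q.integrable_fst'[OF F] by (simp add: GF)
  qed
  also have "\<dots> = (LINT z':{-1..1}|lborel. (LINT r':{0..R}|lborel. kernel r z r' z' * f (r', z') * r'\<^sup>2))"
    unfolding set_lebesgue_integral_def
    by (rule Bochner_Integration.integral_cong) (auto simp: G_def indicator_def)
  finally show ?thesis
    by (simp add: KK_def p box_integral_def F_def[abs_def] set_lebesgue_integral_def)
qed

lemma KK_bound:
  assumes "0 < R" "p \<in> rz_domain R" "sup_bounded R M f" "0 \<le> M"
  shows "\<bar>KK R f p\<bar> \<le> M * kernel_const R"
  using box_integral_kernel_bound(2)[OF assms, of "regular_kernel 0 p"] assms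
  by (simp add: KK_eq_box_integral sup_bounded_def)

lemma KK_cong:
  assumes "\<And>q. q \<in> rz_domain R \<Longrightarrow> f q = g q"
  shows "KK R f p = KK R g p"
proof -
  obtain r z where p: "p = (r, z)" by (cases p)
  have "(LINT r':{0..R}|lborel. kernel r z r' z' * f (r', z') * r'\<^sup>2)
    = (LINT r':{0..R}|lborel. kernel r z r' z' * g (r', z') * r'\<^sup>2)" if "z' \<in> {-1..1}" for z'
    using that assms by (intro set_lebesgue_integral_cong) (auto simp: rz_domain_def)
  then have "(LINT z':{-1..1}|lborel. (LINT r':{0..R}|lborel. kernel r z r' z' * f (r', z') * r'\<^sup>2))
    = (LINT z':{-1..1}|lborel. (LINT r':{0..R}|lborel. kernel r z r' z' * g (r', z') * r'\<^sup>2))"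
    by (intro set_lebesgue_integral_cong) auto
  then show ?thesis by (simp add: KK_def p)
qed

lemma KK_add:
  assumes "0 < R" "p \<in> rz_domain R" "continuous_rz R f" "continuous_rz R g"
  shows "KK R (\<lambda>q. f q + g q) p = KK R f p + KK R g p"
proof -
  obtain M where M: "0 \<le> M" "sup_bounded R M f"
    using continuous_imp_sup_bounded[OF assms(3)] .
  obtain N where N: "0 \<le> N" "sup_bounded R N g"
    using continuous_imp_sup_bounded[OF assms(4)] .
  have c: "continuous_rz R (\<lambda>q. f q + g q)"
    using assms by (intro continuous_intros)
  show ?thesis
    unfolding KK_eq_box_integral[OF assms(1,2) c] KK_eq_box_integral[OF assms(1,2,3)]
      KK_eq_box_integral[OF assms(1,2,4)] box_integral_def distrib_left[symmetric]
    by (subst set_integral_add(2)[symmetric])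
      (use box_integral_kernel_bound(1)[OF assms(1,2) M(2,1), of "regular_kernel 0 p"]
        box_integral_kernel_bound(1)[OF assms(1,2) N(2,1), of "regular_kernel 0 p"] in
        \<open>auto simp: algebra_simps\<close>)
qed

lemma KK_scale: "KK R (\<lambda>q. c * f q) p = c * KK R f p"
proof -
  obtain r z where p: "p = (r, z)" by (cases p)
  have "kernel r z r' z' * (c * f (r', z')) * r'\<^sup>2 = c * (kernel r z r' z' * f (r', z') * r'\<^sup>2)" for r' z'
    by simp
  note e = this
  show ?thesis
    by (simp only: KK_def p case_prod_conv e set_integral_mult_right) simp
qed

lemma KK_diff:
  assumes "0 < R" "p \<in> rz_domain R" "continuous_rz R f" "continuous_rz R g"
  shows "KK R (\<lambda>q. f q - g q) p = KK R f p - KK R g p"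
  using KK_add[OF assms(1-3), of "\<lambda>q. (-1) * g q"] KK_scale[of R "-1" g p] assms(4)
  by (simp add: continuous_intros)

text \<open>
  The kernel is invariant under the simultaneous reflection of both points in the equatorial plane.
\<close>

lemma KK_reflect:
  assumes "\<And>r z. r \<in> {0..R} \<Longrightarrow> z \<in> {-1..1} \<Longrightarrow> f (r, - z) = f (r, z)"
  shows "KK R f (r, - z) = KK R f (r, z)"
proof -
  have "(LINT z':{-1..1}|lborel. (LINT r':{0..R}|lborel. kernel r (- z) r' z' * f (r', z') * r'\<^sup>2)) =
    (LINT z':{x. - x \<in> {-1..1}}|lborel. (LINT r':{0..R}|lborel. kernel r (- z) r' (- z') * f (r', - z') * r'\<^sup>2))"
    by (rule set_integral_reflect)
  also have "{x. - x \<in> {-1..1::real}} = {-1..1}" by auto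
  also have "(LINT z':{-1..1}|lborel. (LINT r':{0..R}|lborel. kernel r (- z) r' (- z') * f (r', - z') * r'\<^sup>2)) =
    (LINT z':{-1..1}|lborel. (LINT r':{0..R}|lborel. kernel r z r' z' * f (r', z') * r'\<^sup>2))"
  proof (rule set_lebesgue_integral_cong, simp, intro allI impI)
    fix z' :: real assume "z' \<in> {-1..1}"
    then show "(LINT r':{0..R}|lborel. kernel r (- z) r' (- z') * f (r', - z') * r'\<^sup>2) =
      (LINT r':{0..R}|lborel. kernel r z r' z' * f (r', z') * r'\<^sup>2)"
      using assms by (intro set_lebesgue_integral_cong) (auto simp: kernel_def)
  qed
  finally show ?thesis by (simp add: KK_def)
qed

lemma KK_centre: "KK R f (0, z) = KK R f (0, 0)"
  by (simp add: KK_def kernel_def)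

lemma box_integral_continuous:
  assumes "continuous_rz R f"
    and "continuous_on (rz_domain R \<times> spherical_box R) (\<lambda>(p, y). k p y)"
  shows "continuous_rz R (\<lambda>p. box_integral R f (k p))"
    and "p \<in> rz_domain R \<Longrightarrow> continuous_on (spherical_box R) (\<lambda>y. f (fst y) * (fst (fst y))\<^sup>2 * k p y)"
    and "p \<in> rz_domain R \<Longrightarrow> box_integral R f (k p) =
      1 / (4 * pi) * integral (spherical_box R) (\<lambda>y. f (fst y) * (fst (fst y))\<^sup>2 * k p y)"
    and "p \<in> rz_domain R \<Longrightarrow> (\<lambda>y. f (fst y) * (fst (fst y))\<^sup>2 * k p y) integrable_on spherical_box R"
    and "continuous_on (rz_domain R \<times> spherical_box R) (\<lambda>(p, y). f (fst y) * (fst (fst y))\<^sup>2 * k p y)"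
proof -
  have "continuous_on (rz_domain R \<times> spherical_box R) (\<lambda>x. f (fst (snd x)))"
    by (rule continuous_on_compose2[OF assms(1), of _ "\<lambda>x. fst (snd x)"])
      (auto simp: spherical_box_def rz_domain_def intro!: continuous_intros)
  then show c: "continuous_on (rz_domain R \<times> spherical_box R) (\<lambda>(p, y). f (fst y) * (fst (fst y))\<^sup>2 * k p y)"
    using assms(2) unfolding case_prod_unfold by (intro continuous_intros)
  show slice: "continuous_on (spherical_box R) (\<lambda>y. f (fst y) * (fst (fst y))\<^sup>2 * k p y)" if "p \<in> rz_domain R" for p
  proof -
    have "continuous_on (spherical_box R) (\<lambda>y. (p, y))" by (intro continuous_intros)
    from continuous_on_compose2[OF c this] show ?thesis using that by auto
  qed
  show e: "box_integral R f (k p) =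
      1 / (4 * pi) * integral (spherical_box R) (\<lambda>y. f (fst y) * (fst (fst y))\<^sup>2 * k p y)"
    and "(\<lambda>y. f (fst y) * (fst (fst y))\<^sup>2 * k p y) integrable_on spherical_box R"
    if "p \<in> rz_domain R" for p
    using set_borel_integral_eq_integral[of "spherical_box R" "\<lambda>y. f (fst y) * (fst (fst y))\<^sup>2 * k p y"]
      borel_integrable_compact[OF compact_spherical_box slice[OF that]]
    by (simp_all add: box_integral_def set_integrable_def)
  have "continuous_rz R (\<lambda>p. 1 / (4 * pi) * integral (spherical_box R) (\<lambda>y. f (fst y) * (fst (fst y))\<^sup>2 * k p y))"
    using c unfolding spherical_box_cbox
    by (intro continuous_intros integral_continuous_on_param)
  then show "continuous_rz R (\<lambda>p. box_integral R f (k p))"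
    by (rule continuous_on_eq) (simp add: e)
qed

lemma regularisation_error_tendsto: "(\<lambda>n. M * (1 / real (Suc n)) powr (1/4) * C) \<longlonglongrightarrow> 0"
proof -
  have "(\<lambda>n. (1 / real (Suc n)) powr (1/4)) \<longlonglongrightarrow> 0 powr (1/4)"
    by (rule tendsto_powr'[OF LIMSEQ_Suc[OF lim_1_over_n] tendsto_const]) auto
  from tendsto_mult[OF tendsto_mult[OF tendsto_const[of M] this] tendsto_const[of C]] show ?thesis
    by simp
qed

text \<open>
  Uniform limits of the regularised integrals, which are continuous because their integrands are.
\<close>

lemma singular_box_integral_continuous:
  assumes "0 < R" "continuous_rz R f"
  shows "continuous_rz R (\<lambda>p. box_integral R f (regular_kernel 0 p))"
    and "continuous_rz R (\<lambda>p. box_integral R f (regular_kernel_deriv 0 p))"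
proof -
  obtain M where M: "0 \<le> M" "sup_bounded R M f"
    using continuous_imp_sup_bounded[OF assms(2)] .
  have main: "continuous_rz R (\<lambda>p. box_integral R f (k 0 p))"
    if c: "\<And>\<eta>. 0 < \<eta> \<Longrightarrow> continuous_on (rz_domain R \<times> spherical_box R) (\<lambda>(p, y). k \<eta> p y)"
      and err: "\<And>\<eta> p. 0 < \<eta> \<Longrightarrow> p \<in> rz_domain R \<Longrightarrow>
        \<bar>box_integral R f (k 0 p) - box_integral R f (k \<eta> p)\<bar> \<le> M * \<eta> powr (1/4) * kernel_const R"
    for k :: "real \<Rightarrow> real \<times> real \<Rightarrow> (real \<times> real) \<times> real \<Rightarrow> real"
  proof (rule uniform_limit_theorem)
    let ?k = "\<lambda>n p. box_integral R f (k (1 / real (Suc n)) p)"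
    show "\<forall>\<^sub>F n in sequentially. continuous_rz R (?k n)"
      by (intro always_eventually allI box_integral_continuous(1) assms c) simp
    show "uniform_limit (rz_domain R) ?k (\<lambda>p. box_integral R f (k 0 p)) sequentially"
    proof (rule uniform_limitI)
      fix e :: real assume "0 < e"
      from order_tendstoD(2)[OF regularisation_error_tendsto[of M "kernel_const R"] this]
      show "\<forall>\<^sub>F n in sequentially. \<forall>p\<in>rz_domain R. dist (?k n p) (box_integral R f (k 0 p)) < e"
      proof eventually_elim
        case (elim n)
        then show ?case
          using err[of "1 / real (Suc n)"] by (force simp: dist_real_def abs_minus_commute)
      qed
    qed
  qed simp
  show "continuous_rz R (\<lambda>p. box_integral R f (regular_kernel 0 p))"
    by (rule main) (use regular_kernel_continuous box_integral_regularised[OF assms(1) _ M(2,1)] in auto)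
  show "continuous_rz R (\<lambda>p. box_integral R f (regular_kernel_deriv 0 p))"
    by (rule main) (use regular_kernel_continuous box_integral_regularised[OF assms(1) _ M(2,1)] in auto)
qed

lemma KK_continuous:
  assumes "0 < R" "continuous_rz R f"
  shows "continuous_rz R (KK R f)"
  by (rule continuous_on_eq[OF singular_box_integral_continuous(1)[OF assms]])
     (simp add: KK_eq_box_integral assms)

definition KK_dr :: "real \<Rightarrow> (real \<times> real \<Rightarrow> real) \<Rightarrow> real \<times> real \<Rightarrow> real" where
  "KK_dr R f p = box_integral R f (regular_kernel_deriv 0 p)"

lemma KK_dr_bound:
  assumes "0 < R" "p \<in> rz_domain R" "sup_bounded R M f" "0 \<le> M"
  shows "\<bar>KK_dr R f p\<bar> \<le> M * kernel_const R"
  using box_integral_kernel_bound(2)[OF assms, of "regular_kernel_deriv 0 p"]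
  by (simp add: KK_dr_def)

lemma KK_dr_continuous:
  assumes "0 < R" "continuous_rz R f"
  shows "continuous_rz R (KK_dr R f)"
  unfolding KK_dr_def[abs_def] by (rule singular_box_integral_continuous(2)[OF assms])

lemma regular_kernel_has_derivative:
  assumes "0 < \<eta>" "(r, z) \<in> rz_domain R" "y \<in> spherical_box R"
  shows "((\<lambda>r. regular_kernel \<eta> (r, z) y) has_real_derivative regular_kernel_deriv \<eta> (r, z) y) (at r within S)"
proof -
  define d where "d r = dist2 (r, z) y + \<eta>\<^sup>2" for r
  have pos: "0 < d r"
    using dist2_box_bounds(1)[OF assms(2,3)] assms(1) by (simp add: d_def add_nonneg_pos)
  have "(d has_real_derivative 2 * radial_offset (r, z) y) (at r within S)"
    unfolding d_def dist2_def radial_offset_def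
    by (auto intro!: derivative_eq_intros simp: algebra_simps)
  then have "((\<lambda>r. 1 / sqrt (d r)) has_real_derivative
      - (2 * radial_offset (r, z) y * (inverse (sqrt (d r)) / 2)) / (sqrt (d r))\<^sup>2) (at r within S)"
    using pos by (auto intro!: derivative_eq_intros simp: power2_eq_square)
  moreover have "- (2 * radial_offset (r, z) y * (inverse (sqrt (d r)) / 2)) / (sqrt (d r))\<^sup>2
      = - radial_offset (r, z) y / sqrt (d r) ^ 3"
    using pos by (simp add: field_simps power2_eq_square power3_eq_cube)
  ultimately show ?thesis
    by (simp add: regular_kernel_def regular_kernel_deriv_def d_def)
qed

text \<open>
  Differentiate the regularised potentials under the integral sign. Their derivatives converge
  uniformly on the whole interval, so the limit has the limiting derivative, one-sided at the end
  points.
\<close>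

lemma KK_has_derivative:
  assumes "0 < R" "continuous_rz R f" "r \<in> {0..R}" "z \<in> {-1..1}"
  shows "((\<lambda>s. KK R f (s, z)) has_real_derivative KK_dr R f (r, z)) (at r within {0..R})"
proof -
  obtain M where M: "0 \<le> M" "sup_bounded R M f"
    using continuous_imp_sup_bounded[OF assms(2)] .
  have dom: "(s, z) \<in> rz_domain R" if "s \<in> {0..R}" for s
    using that assms by (simp add: rz_domain_def)
  define \<eta> where "\<eta> n = 1 / real (Suc n)" for n
  have \<eta>: "0 < \<eta> n" for n by (simp add: \<eta>_def)
  define F where "F n s = box_integral R f (regular_kernel (\<eta> n) (s, z))" for n s
  define F' where "F' n s = box_integral R f (regular_kernel_deriv (\<eta> n) (s, z))" for n s
  have der: "(F n has_real_derivative F' n s) (at s within {0..R})" if s: "s \<in> {0..R}" for n s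
  proof -
    let ?d = "\<lambda>y. f (fst y) * (fst (fst y))\<^sup>2"
    note c = box_integral_continuous[OF assms(2) regular_kernel_continuous(1)[OF \<eta>[of n]]]
    note c' = box_integral_continuous[OF assms(2) regular_kernel_continuous(2)[OF \<eta>[of n]]]
    have cp: "continuous_on ({0..R} \<times> spherical_box R) (\<lambda>x. ((fst x, z), snd x))"
      by (intro continuous_intros)
    have sp: "(\<lambda>x. ((fst x, z), snd x)) ` ({0..R} \<times> spherical_box R) \<subseteq> rz_domain R \<times> spherical_box R"
      using dom by auto
    have cc: "continuous_on ({0..R} \<times> spherical_box R) (\<lambda>(s, y). ?d y * regular_kernel_deriv (\<eta> n) (s, z) y)"
      using continuous_on_compose2[OF c'(5) cp sp] by (simp add: case_prod_unfold)
    have "((\<lambda>s. integral (spherical_box R) (\<lambda>y. ?d y * regular_kernel (\<eta> n) (s, z) y)) has_real_derivative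
      integral (spherical_box R) (\<lambda>y. ?d y * regular_kernel_deriv (\<eta> n) (s, z) y)) (at s within {0..R})"
      unfolding spherical_box_cbox
    proof (rule leibniz_rule_field_derivative)
      show "((\<lambda>s. ?d y * regular_kernel (\<eta> n) (s, z) y) has_real_derivative
        ?d y * regular_kernel_deriv (\<eta> n) (s, z) y) (at s within {0..R})"
        if "s \<in> {0..R}" "y \<in> cbox ((0, -1), 0) ((R, 1), 2 * pi)" for s y
        using that by (intro DERIV_cmult regular_kernel_has_derivative \<eta>) (simp_all add: spherical_box_cbox dom)
      show "(\<lambda>y. ?d y * regular_kernel (\<eta> n) (s, z) y) integrable_on cbox ((0, -1), 0) ((R, 1), 2 * pi)"
        if "s \<in> {0..R}" for s
        using c(4)[OF dom[OF that]] by (simp add: spherical_box_cbox)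
    qed (use cc s in \<open>auto simp: spherical_box_cbox\<close>)
    from DERIV_cmult[OF this, of "1 / (4 * pi)"] show ?thesis
    proof (rule has_field_derivative_transform_within[OF _ zero_less_one s, THEN DERIV_cong])
      show "1 / (4 * pi) * integral (spherical_box R) (\<lambda>y. ?d y * regular_kernel_deriv (\<eta> n) (s, z) y) = F' n s"
        using c'(3)[OF dom[OF s]] by (simp add: F'_def)
      show "1 / (4 * pi) * integral (spherical_box R) (\<lambda>y. ?d y * regular_kernel (\<eta> n) (t, z) y) = F n t"
        if "t \<in> {0..R}" for t
        using c(3)[OF dom[OF that]] by (simp add: F_def)
    qed
  qed
  have lim: "(\<lambda>n. F n s) \<longlonglongrightarrow> KK R f (s, z)" if "s \<in> {0..R}" for s
  proof (rule LIM_zero_cancel, rule Lim_null_comparison[OF _ regularisation_error_tendsto[of M "kernel_const R"]])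
    show "\<forall>\<^sub>F n in sequentially. norm (F n s - KK R f (s, z)) \<le> M * (1 / real (Suc n)) powr (1/4) * kernel_const R"
      using box_integral_regularised(1)[OF assms(1) \<eta> M(2,1) dom[OF that]]
      by (intro always_eventually allI)
        (simp add: F_def KK_eq_box_integral assms dom[OF that] abs_minus_commute \<eta>_def[symmetric]
          del: of_nat_Suc)
  qed
  have "\<exists>g. \<forall>s\<in>{0..R}. (\<lambda>n. F n s) \<longlonglongrightarrow> g s \<and> (g has_derivative (\<lambda>h. KK_dr R f (s, z) * h)) (at s within {0..R})"
  proof (rule has_derivative_sequence[where f'="\<lambda>n s h. F' n s * h"])
    show "(F n has_derivative (*) (F' n s)) (at s within {0..R})" if "s \<in> {0..R}" for n s
      using der[OF that] by (simp add: has_field_derivative_def)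
    fix e :: real assume "0 < e"
    from order_tendstoD(2)[OF regularisation_error_tendsto[of M "kernel_const R"] this]
    show "\<forall>\<^sub>F n in sequentially. \<forall>s\<in>{0..R}. \<forall>h. norm (F' n s * h - KK_dr R f (s, z) * h) \<le> e * norm h"
    proof eventually_elim
      case (elim n)
      have "\<bar>F' n s - KK_dr R f (s, z)\<bar> \<le> e" if "s \<in> {0..R}" for s
        using box_integral_regularised(2)[OF assms(1) \<eta>[of n] M(2,1) dom[OF that]] elim
        by (simp add: F'_def KK_dr_def abs_minus_commute \<eta>_def[symmetric] del: of_nat_Suc)
      then show ?case
        by (auto simp: left_diff_distrib[symmetric] abs_mult intro!: mult_right_mono)
    qed
  qed (use lim[OF assms(3)] assms in auto)
  then obtain g where "\<forall>s\<in>{0..R}. (\<lambda>n. F n s) \<longlonglongrightarrow> g s \<and>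
      (g has_derivative (\<lambda>h. KK_dr R f (s, z) * h)) (at s within {0..R})"
    by blast
  then have g: "\<And>s. s \<in> {0..R} \<Longrightarrow> (\<lambda>n. F n s) \<longlonglongrightarrow> g s"
    "(g has_real_derivative KK_dr R f (r, z)) (at r within {0..R})"
    using assms(3) by (auto simp: has_field_derivative_def)
  show ?thesis
  proof (rule has_field_derivative_transform_within[OF g(2) zero_less_one assms(3)])
    show "g s = KK R f (s, z)" if "s \<in> {0..R}" for s
      using LIMSEQ_unique[OF g(1) lim] that by blast
  qed
qed

text \<open>
  The regularisation error depends on \<open>f\<close> only through its bound, and the regularised kernel is
  uniformly continuous on a compact set; so one modulus of continuity serves all sources bounded
  by \<open>M\<close>.
\<close>

lemma KK_equicontinuous:
  assumes "0 < R" "0 \<le> M" "0 < e"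
  shows "\<exists>d>0. \<forall>f p q. sup_bounded R M f \<longrightarrow> p \<in> rz_domain R \<longrightarrow> q \<in> rz_domain R \<longrightarrow> dist p q < d \<longrightarrow>
    \<bar>KK R f p - KK R f q\<bar> < e"
proof -
  have "\<forall>\<^sub>F n in sequentially. M * (1 / real (Suc n)) powr (1/4) * kernel_const R < e / 4"
    by (rule order_tendstoD(2)[OF regularisation_error_tendsto]) (use assms in simp)
  then obtain n where "M * (1 / real (Suc n)) powr (1/4) * kernel_const R < e / 4"
    unfolding eventually_sequentially by blast
  then obtain \<eta> where \<eta>: "0 < \<eta>" "M * \<eta> powr (1/4) * kernel_const R < e / 4"
    by (metis zero_less_divide_1_iff of_nat_0_less_iff zero_less_Suc)
  define V where "V = measure lborel (spherical_box R)"
  \<comment> \<open>the \<open>1\<close> only guards against a vanishing denominator\<close>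
  define \<kappa> where "\<kappa> = e / (4 * (M * R\<^sup>2 * V + 1))"
  have V: "0 \<le> M * R\<^sup>2 * V" using assms by (simp add: V_def)
  have \<kappa>: "0 < \<kappa>" "M * R\<^sup>2 * V * \<kappa> \<le> e / 4"
    using assms V by (auto simp: \<kappa>_def field_simps add_nonneg_pos)
  have "uniformly_continuous_on (rz_domain R \<times> spherical_box R) (\<lambda>(p, y). regular_kernel \<eta> p y)"
    by (intro compact_uniformly_continuous regular_kernel_continuous \<eta> compact_Times compact_rz_domain compact_spherical_box)
  from uniformly_continuous_onE[OF this \<kappa>(1)] obtain d where d: "d > 0"
    "\<And>x x'. x \<in> rz_domain R \<times> spherical_box R \<Longrightarrow> x' \<in> rz_domain R \<times> spherical_box R \<Longrightarrow> dist x' x < d \<Longrightarrow>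
      dist (case x' of (p, y) \<Rightarrow> regular_kernel \<eta> p y) (case x of (p, y) \<Rightarrow> regular_kernel \<eta> p y) < \<kappa>"
    by metis
  have "\<bar>KK R f p - KK R f q\<bar> < e"
    if f: "sup_bounded R M f" and pq: "p \<in> rz_domain R" "q \<in> rz_domain R" "dist p q < d" for f p q
  proof -
    have cont: "continuous_rz R f" using f by (simp add: sup_bounded_def)
    let ?I = "\<lambda>p y. f (fst y) * (fst (fst y))\<^sup>2 * regular_kernel \<eta> p y"
    note c = box_integral_continuous[OF cont regular_kernel_continuous(1)[OF \<eta>(1)]]
    have "\<bar>integral (spherical_box R) (?I p) - integral (spherical_box R) (?I q)\<bar>
        = \<bar>integral (spherical_box R) (\<lambda>y. ?I p y - ?I q y)\<bar>"
      using c(4) pq by (subst integral_diff) auto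
    also have "\<dots> \<le> M * R\<^sup>2 * \<kappa> * V"
    proof -
      have "norm (integral (spherical_box R) (\<lambda>y. ?I p y - ?I q y)) \<le> M * R\<^sup>2 * \<kappa> * measure lborel (spherical_box R)"
        unfolding spherical_box_cbox
      proof (rule integrable_bound)
        show "(\<lambda>y. ?I p y - ?I q y) integrable_on cbox ((0, -1), 0) ((R, 1), 2 * pi)"
          using c(4) pq by (intro integrable_diff) (auto simp: spherical_box_cbox)
        fix y :: "(real \<times> real) \<times> real" assume "y \<in> cbox ((0, -1), 0) ((R, 1), 2 * pi)"
        then have y: "y \<in> spherical_box R" by (simp add: spherical_box_cbox)
        have "\<bar>regular_kernel \<eta> p y - regular_kernel \<eta> q y\<bar> \<le> \<kappa>"
          using d(2)[of "(q, y)" "(p, y)"] pq y by (simp add: dist_Pair_Pair dist_real_def)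
        moreover have "\<bar>f (fst y)\<bar> \<le> M"
          using f spherical_box_fst[OF y] by (simp add: sup_bounded_def)
        moreover have "(fst (fst y))\<^sup>2 \<le> R\<^sup>2"
          using y by (intro power_mono) (auto simp: spherical_box_def)
        ultimately have "\<bar>f (fst y)\<bar> * (fst (fst y))\<^sup>2 * \<bar>regular_kernel \<eta> p y - regular_kernel \<eta> q y\<bar> \<le> M * R\<^sup>2 * \<kappa>"
          using assms by (intro mult_mono) auto
        then show "norm (?I p y - ?I q y) \<le> M * R\<^sup>2 * \<kappa>"
          by (simp add: abs_mult right_diff_distrib[symmetric])
      qed (use assms \<kappa> in auto)
      then show ?thesis by (simp add: V_def)
    qed
    also have "\<dots> \<le> e / 4" using \<kappa>(2) by (simp add: mult_ac)
    finally have reg: "\<bar>box_integral R f (regular_kernel \<eta> p) - box_integral R f (regular_kernel \<eta> q)\<bar> \<le> e / 4"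
    proof -
      assume *: "\<bar>integral (spherical_box R) (?I p) - integral (spherical_box R) (?I q)\<bar> \<le> e / 4"
      have "\<bar>1 / (4 * pi) * x - 1 / (4 * pi) * y\<bar> \<le> \<bar>x - y\<bar>" for x y
      proof -
        have "1 \<le> 4 * pi" using pi_gt3 by simp
        then have "1 / (4 * pi) * \<bar>x - y\<bar> \<le> 1 * \<bar>x - y\<bar>"
          by (intro mult_right_mono) auto
        then show ?thesis by (simp add: abs_mult right_diff_distrib[symmetric] diff_divide_distrib[symmetric])
      qed
      from order_trans[OF this *] show ?thesis using c(3) pq by simp
    qed
    from box_integral_regularised(1)[OF assms(1) \<eta>(1) f assms(2) pq(1)]
      box_integral_regularised(1)[OF assms(1) \<eta>(1) f assms(2) pq(2)] reg \<eta>(2)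
    show ?thesis
      unfolding KK_eq_box_integral[OF assms(1) pq(1) cont] KK_eq_box_integral[OF assms(1) pq(2) cont]
      using assms(3) by linarith
  qed
  with d(1) show ?thesis by blast
qed


section \<open>The density profile\<close>

text \<open>
  At \<open>0\<close> the difference quotient is at most \<open>\<bar>h\<bar> powr (\<nu> - 1)\<close>, which tends to \<open>0\<close> since \<open>\<nu> > 1\<close>.
\<close>

lemma pos_part_powr_has_derivative:
  assumes "1 < (\<nu>::real)"
  shows "((\<lambda>u. max u 0 powr \<nu>) has_real_derivative \<nu> * max u 0 powr (\<nu> - 1)) (at u)"
proof -
  consider "u > 0" | "u < 0" | "u = 0" by linarith
  then show ?thesis
  proof cases
    case 1
    have "((\<lambda>u. u powr \<nu>) has_real_derivative \<nu> * u powr (\<nu> - 1)) (at u)"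
      using 1 by (rule has_real_derivative_powr)
    then have "((\<lambda>u. max u 0 powr \<nu>) has_real_derivative \<nu> * u powr (\<nu> - 1)) (at u)"
      by (rule has_field_derivative_transform_within_open[where S="{0<..}"]) (use 1 in \<open>auto simp: max_def\<close>)
    then show ?thesis using 1 by (simp add: max_def)
  next
    case 2
    have "((\<lambda>u. 0) has_real_derivative 0) (at u)" by simp
    then have "((\<lambda>u. max u 0 powr \<nu>) has_real_derivative 0) (at u)"
      by (rule has_field_derivative_transform_within_open[where S="{..<0}"]) (use 2 in \<open>auto simp: max_def\<close>)
    then show ?thesis using 2 by (simp add: max_def)
  next
    case 3
    have "((\<lambda>h::real. \<bar>h\<bar> powr (\<nu> - 1)) \<longlongrightarrow> \<bar>0\<bar> powr (\<nu> - 1)) (at 0)"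
      by (rule tendsto_powr'[OF tendsto_rabs[OF tendsto_ident_at] tendsto_const]) (use assms in auto)
    then have "((\<lambda>h::real. \<bar>h\<bar> powr (\<nu> - 1)) \<longlongrightarrow> 0) (at 0)"
      by simp
    moreover have "\<forall>\<^sub>F h::real in at 0. norm (max h 0 powr \<nu> / h) \<le> \<bar>h\<bar> powr (\<nu> - 1)"
      by (rule always_eventually) (auto simp: max_def powr_diff divide_nonneg_nonpos)
    ultimately have "((\<lambda>h::real. max h 0 powr \<nu> / h) \<longlongrightarrow> 0) (at 0)"
      by (rule Lim_null_comparison[rotated])
    then show ?thesis using 3 by (simp add: has_field_derivative_iff)
  qed
qed

definition ff_deriv :: "real \<Rightarrow> (real \<Rightarrow> real) \<Rightarrow> real \<Rightarrow> real \<Rightarrow> real" where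
  "ff_deriv \<nu> \<Lambda>\<rho> uO u = \<nu> * max u 0 powr (\<nu> - 1) * (1 + \<Lambda>\<rho> (uO * u)) +
     max u 0 powr \<nu> * (uO * deriv \<Lambda>\<rho> (uO * u))"

lemma smooth_on_C1:
  assumes "smooth_on UNIV \<Lambda>"
  shows "(\<Lambda> has_real_derivative deriv \<Lambda> x) (at x)" "continuous_on UNIV \<Lambda>" "continuous_on UNIV (deriv \<Lambda>)"
proof -
  have d: "\<Lambda> field_differentiable (at x)" "deriv \<Lambda> field_differentiable (at x)" for x
    using assms[unfolded smooth_on_def, rule_format, of x 0] assms[unfolded smooth_on_def, rule_format, of x 1]
    by simp_all
  show "(\<Lambda> has_real_derivative deriv \<Lambda> x) (at x)"
    using d(1) by (rule field_differentiable_derivI)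
  show "continuous_on UNIV \<Lambda>" "continuous_on UNIV (deriv \<Lambda>)"
    using d by (auto intro!: continuous_at_imp_continuous_on field_differentiable_imp_continuous_at)
qed

lemma ff_has_derivative:
  assumes "1 < \<nu>" "smooth_on UNIV \<Lambda>\<rho>"
  shows "(ff \<nu> \<Lambda>\<rho> uO has_real_derivative ff_deriv \<nu> \<Lambda>\<rho> uO u) (at u)"
proof -
  have "((\<lambda>u. \<Lambda>\<rho> (uO * u)) has_real_derivative deriv \<Lambda>\<rho> (uO * u) * uO) (at u)"
    by (rule DERIV_chain2[OF smooth_on_C1(1)[OF assms(2)]]) (auto intro!: derivative_eq_intros)
  then have "((\<lambda>u. 1 + \<Lambda>\<rho> (uO * u)) has_real_derivative 0 + deriv \<Lambda>\<rho> (uO * u) * uO) (at u)"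
    by (intro DERIV_add DERIV_const)
  from DERIV_mult[OF pos_part_powr_has_derivative[OF assms(1), of u] this] show ?thesis
    by (simp add: ff_def[abs_def] ff_deriv_def algebra_simps)
qed

lemma deriv_ff:
  assumes "1 < \<nu>" "smooth_on UNIV \<Lambda>\<rho>"
  shows "deriv (ff \<nu> \<Lambda>\<rho> uO) u = ff_deriv \<nu> \<Lambda>\<rho> uO u"
  by (rule DERIV_imp_deriv[OF ff_has_derivative[OF assms]])

lemma ff_jointly_continuous:
  assumes "1 < \<nu>" "smooth_on UNIV \<Lambda>\<rho>"
  shows "continuous_on UNIV (\<lambda>(uO, u). ff \<nu> \<Lambda>\<rho> uO u)"
    and "continuous_on UNIV (\<lambda>(uO, u). ff_deriv \<nu> \<Lambda>\<rho> uO u)"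
proof -
  have p: "continuous_on UNIV (\<lambda>x :: real \<times> real. max (snd x) 0 powr s)" if "0 < s" for s
    using that by (intro continuous_on_powr' continuous_intros) auto
  have c: "continuous_on UNIV (\<lambda>x :: real \<times> real. \<Lambda>\<rho> (fst x * snd x))"
    "continuous_on UNIV (\<lambda>x :: real \<times> real. deriv \<Lambda>\<rho> (fst x * snd x))"
    by (rule continuous_on_compose2[OF smooth_on_C1(2)[OF assms(2)]]
        continuous_on_compose2[OF smooth_on_C1(3)[OF assms(2)]]; auto intro!: continuous_intros)+
  show "continuous_on UNIV (\<lambda>(uO, u). ff \<nu> \<Lambda>\<rho> uO u)"
    "continuous_on UNIV (\<lambda>(uO, u). ff_deriv \<nu> \<Lambda>\<rho> uO u)"
    unfolding ff_def ff_deriv_def case_prod_unfold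
    by (intro continuous_intros p c; use assms in simp)+
qed

lemma ff_continuous:
  assumes "1 < \<nu>" "smooth_on UNIV \<Lambda>\<rho>"
  shows "continuous_on S (ff \<nu> \<Lambda>\<rho> uO)" "continuous_on S (ff_deriv \<nu> \<Lambda>\<rho> uO)"
  using continuous_on_compose2[OF ff_jointly_continuous(1)[OF assms], of S "\<lambda>u. (uO, u)"]
    continuous_on_compose2[OF ff_jointly_continuous(2)[OF assms], of S "\<lambda>u. (uO, u)"]
  by (simp_all add: continuous_intros)

text \<open>
  Uniform continuity near a compact square; only the first argument pair has to lie in the square.
\<close>

lemma jointly_continuous_uniform:
  fixes \<phi> :: "real \<Rightarrow> real \<Rightarrow> real"
  assumes "continuous_on UNIV (\<lambda>(s, u). \<phi> s u)" "0 < e"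
  shows "\<exists>d>0. d \<le> 1 \<and> (\<forall>s t a b. \<bar>s\<bar> \<le> B \<longrightarrow> \<bar>a\<bar> \<le> B \<longrightarrow> \<bar>s - t\<bar> \<le> d \<longrightarrow> \<bar>a - b\<bar> \<le> d \<longrightarrow>
    \<bar>\<phi> s a - \<phi> t b\<bar> \<le> e)"
proof -
  let ?K = "{-(B+1)..B+1} \<times> {-(B+1)..B+1}"
  have "uniformly_continuous_on ?K (\<lambda>(s, u). \<phi> s u)"
    by (intro compact_uniformly_continuous continuous_on_subset[OF assms(1)] compact_Times) auto
  from uniformly_continuous_onE[OF this assms(2)] obtain d where d: "d > 0"
    "\<And>x x'. x \<in> ?K \<Longrightarrow> x' \<in> ?K \<Longrightarrow> dist x' x < d \<Longrightarrow>
      dist (case x' of (s, u) \<Rightarrow> \<phi> s u) (case x of (s, u) \<Rightarrow> \<phi> s u) < e"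
    by metis
  have "\<bar>\<phi> s a - \<phi> t b\<bar> \<le> e"
    if "\<bar>s\<bar> \<le> B" "\<bar>a\<bar> \<le> B" "\<bar>s - t\<bar> \<le> min 1 (d/3)" "\<bar>a - b\<bar> \<le> min 1 (d/3)" for s t a b
  proof -
    have "dist (s, a) (t, b) \<le> \<bar>s - t\<bar> + \<bar>a - b\<bar>"
      by (simp add: dist_Pair_Pair dist_real_def sqrt_sum_squares_le_sum_abs)
    also have "\<dots> < d" using that d(1) by linarith
    finally have "dist (s, a) (t, b) < d" .
    moreover have "(s, a) \<in> ?K" "(t, b) \<in> ?K" using that by auto
    ultimately have "dist (\<phi> s a) (\<phi> t b) < e" using d(2)[of "(t, b)" "(s, a)"] by simp
    then show ?thesis by (simp add: dist_real_def)
  qed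
  moreover have "0 < min 1 (d/3)" "min 1 (d/3) \<le> 1" using d(1) by simp_all
  ultimately show ?thesis by blast
qed

text \<open>
  The mean value inequality for \<open>x \<mapsto> ff \<nu> \<Lambda>\<rho> uO x - m * x\<close>, whose derivative is at most \<open>e\<close>.
\<close>

lemma ff_linearisation:
  assumes "1 < \<nu>" "smooth_on UNIV \<Lambda>\<rho>"
    and "\<And>x. \<bar>x - c\<bar> \<le> d \<Longrightarrow> \<bar>ff_deriv \<nu> \<Lambda>\<rho> uO x - m\<bar> \<le> e"
    and "\<bar>a - c\<bar> \<le> d" "\<bar>b - c\<bar> \<le> d"
  shows "\<bar>ff \<nu> \<Lambda>\<rho> uO a - ff \<nu> \<Lambda>\<rho> uO b - m * (a - b)\<bar> \<le> e * \<bar>a - b\<bar>"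
proof -
  have "norm ((ff \<nu> \<Lambda>\<rho> uO a - m * a) - (ff \<nu> \<Lambda>\<rho> uO b - m * b)) \<le> e * norm (a - b)"
  proof (rule field_differentiable_bound[where S="cball c d"])
    fix x assume "x \<in> cball c d"
    then have "\<bar>x - c\<bar> \<le> d" by (simp add: dist_real_def abs_minus_commute)
    then show "norm (ff_deriv \<nu> \<Lambda>\<rho> uO x - m) \<le> e" using assms(3) by simp
    show "((\<lambda>a. ff \<nu> \<Lambda>\<rho> uO a - m * a) has_real_derivative ff_deriv \<nu> \<Lambda>\<rho> uO x - m) (at x within cball c d)"
      using DERIV_diff[OF ff_has_derivative[OF assms(1,2)] DERIV_cmult_Id[of m x]]
      by (rule has_field_derivative_at_within)
  next
    show "a \<in> cball c d" "b \<in> cball c d"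
      using assms(4,5) by (simp_all add: dist_real_def abs_minus_commute)
  qed simp
  then show ?thesis by (simp add: algebra_simps)
qed


section \<open>Function spaces\<close>

instance bcontfun :: (metric_space, banach) banach ..

lemma rz_domain_cbox: "rz_domain R = cbox (0, -1) (R, 1)"
  by (auto simp: rz_domain_def cbox_Pair_eq)

text \<open>
  Functions on the rectangle are represented by bounded continuous functions on the plane, extended by
  their value at the nearest point of the rectangle; these form a Banach space under the
  supremum norm.
\<close>

definition clamp_ext :: "real \<Rightarrow> (real \<times> real \<Rightarrow> real) \<Rightarrow> (real \<times> real) \<Rightarrow>\<^sub>C real" where
  "clamp_ext R u = (SOME w. \<forall>p. apply_bcontfun w p = u (clamp (0, -1) (R, 1) p))"

lemma clamp_ext_apply:
  assumes "continuous_rz R u"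
  shows "clamp_ext R u p = u (clamp (0, -1) (R, 1) p)"
proof -
  obtain w :: "(real \<times> real) \<Rightarrow>\<^sub>C real" where "\<And>p. w p = u (clamp (0, -1) (R, 1) p)"
    using continuous_on_cbox_bcontfunE[of "(0, -1)" "(R, 1)" u] assms by (auto simp: rz_domain_cbox)
  then have "\<exists>w. \<forall>p. apply_bcontfun w p = u (clamp (0, -1) (R, 1) p)" by blast
  from someI_ex[OF this] show ?thesis unfolding clamp_ext_def by blast
qed

lemma clamp_rz: "0 < R \<Longrightarrow> clamp (0, -1) (R, 1) p \<in> rz_domain R"
  unfolding rz_domain_cbox by (intro clamp_in_interval) (auto simp: Basis_prod_def)

lemma clamp_rz_id: "p \<in> rz_domain R \<Longrightarrow> clamp (0, -1) (R, 1) p = p"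
  by (simp add: rz_domain_cbox)

lemma clamp_ext_apply_dom:
  "continuous_rz R u \<Longrightarrow> p \<in> rz_domain R \<Longrightarrow> clamp_ext R u p = u p"
  by (simp add: clamp_ext_apply clamp_rz_id)

definition E_symmetric :: "real \<Rightarrow> (real \<times> real \<Rightarrow> real) \<Rightarrow> bool" where
  "E_symmetric R u \<longleftrightarrow> (\<forall>\<zeta>\<in>{-1..1}. u (0, \<zeta>) = u (0, 0)) \<and>
     (\<forall>r\<in>{0..R}. \<forall>\<zeta>\<in>{-1..1}. u (r, - \<zeta>) = u (r, \<zeta>))"

lemma E_symmetricI:
  assumes "\<And>z. z \<in> {-1..1} \<Longrightarrow> u (0, z) = u (0, 0)"
    and "\<And>r z. (r, z) \<in> rz_domain R \<Longrightarrow> u (r, - z) = u (r, z)"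
  shows "E_symmetric R u"
  unfolding E_symmetric_def using assms by (simp only: rz_domain_def mem_Times_iff fst_conv snd_conv) blast

lemma E_symmetricD:
  assumes "E_symmetric R u"
  shows "z \<in> {-1..1} \<Longrightarrow> u (0, z) = u (0, 0)" "(r, z) \<in> rz_domain R \<Longrightarrow> u (r, - z) = u (r, z)"
  using assms unfolding E_symmetric_def rz_domain_def by blast+

lemma E_symmetric_cong:
  assumes "E_symmetric R u" "0 < R" "\<And>p. p \<in> rz_domain R \<Longrightarrow> v p = u p"
  shows "E_symmetric R v"
proof (rule E_symmetricI)
  show "v (0, z) = v (0, 0)" if "z \<in> {-1..1}" for z
    using E_symmetricD(1)[OF assms(1) that] assms(3)[of "(0, z)"] assms(3)[of "(0, 0)"] that assms(2)
    by (simp add: rz_domain_def)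
  show "v (r, - z) = v (r, z)" if "(r, z) \<in> rz_domain R" for r z
    using E_symmetricD(2)[OF assms(1) that] assms(3)[OF that] assms(3)[of "(r, - z)"] that
    by (simp add: rz_domain_def)
qed

text \<open>
  The copy of \<^const>\<open>E_space\<close> in that Banach space. Its elements are determined by their values on the
  rectangle, on which also the supremum is attained.
\<close>

definition E_sub :: "real \<Rightarrow> ((real \<times> real) \<Rightarrow>\<^sub>C real) set" where
  "E_sub R = {w. (\<forall>p. apply_bcontfun w (clamp (0, -1) (R, 1) p) = apply_bcontfun w p) \<and>
    E_symmetric R (apply_bcontfun w)}"

lemma E_subD:
  assumes "w \<in> E_sub R"
  shows "apply_bcontfun w (clamp (0, -1) (R, 1) p) = apply_bcontfun w p" "E_symmetric R (apply_bcontfun w)"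
  using assms unfolding E_sub_def by blast+

lemma continuous_on_eval: "continuous_on UNIV (\<lambda>w::('a::topological_space \<Rightarrow>\<^sub>C real). apply_bcontfun w x)"
proof (rule continuous_onI)
  fix w v :: "'a \<Rightarrow>\<^sub>C real" and e :: real assume "0 < e"
  then show "\<exists>d>0. \<forall>v\<in>UNIV. dist v w < d \<longrightarrow> dist (apply_bcontfun v x) (apply_bcontfun w x) \<le> e"
    using dist_bounded[of _ x w] by (intro exI[of _ e]) (force intro: order_trans)
qed

lemma closed_E_sub: "closed (E_sub R)"
  unfolding E_sub_def E_symmetric_def Ball_def
  by (intro closed_Collect_conj closed_Collect_all closed_Collect_imp open_Collect_const
      closed_Collect_eq continuous_on_eval)

lemma subspace_E_sub: "subspace (E_sub R)"
proof (rule subspaceI)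
  show "0 \<in> E_sub R" by (simp add: E_sub_def E_symmetric_def)
  fix x y assume xy: "x \<in> E_sub R" "y \<in> E_sub R"
  have "E_symmetric R (apply_bcontfun (x + y))"
  proof (rule E_symmetricI)
    have s: "E_symmetric R (apply_bcontfun x)" "E_symmetric R (apply_bcontfun y)"
      using xy by (simp_all add: E_sub_def)
    show "(x + y) (0, z) = (x + y) (0, 0)" if "z \<in> {-1..1}" for z
      using E_symmetricD(1)[OF s(1) that] E_symmetricD(1)[OF s(2) that] by simp
    show "(x + y) (r, - z) = (x + y) (r, z)" if "(r, z) \<in> rz_domain R" for r z
      using E_symmetricD(2)[OF s(1) that] E_symmetricD(2)[OF s(2) that] by simp
  qed
  then show "x + y \<in> E_sub R" using xy by (simp add: E_sub_def)
next
  fix c :: real and x assume x: "x \<in> E_sub R"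
  have "E_symmetric R (apply_bcontfun (c *\<^sub>R x))"
  proof (rule E_symmetricI)
    have s: "E_symmetric R (apply_bcontfun x)"
      using x by (simp add: E_sub_def)
    show "(c *\<^sub>R x) (0, z) = (c *\<^sub>R x) (0, 0)" if "z \<in> {-1..1}" for z
      using E_symmetricD(1)[OF s that] by simp
    show "(c *\<^sub>R x) (r, - z) = (c *\<^sub>R x) (r, z)" if "(r, z) \<in> rz_domain R" for r z
      using E_symmetricD(2)[OF s that] by simp
  qed
  then show "c *\<^sub>R x \<in> E_sub R" using x by (simp add: E_sub_def)
qed

lemma clamp_ext_in_E_sub:
  assumes "0 < R" "continuous_rz R u" "E_symmetric R u"
  shows "clamp_ext R u \<in> E_sub R"
proof -
  have "clamp_ext R u (clamp (0, -1) (R, 1) p) = clamp_ext R u p" for p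
    by (simp add: clamp_ext_apply[OF assms(2)] clamp_rz_id clamp_rz assms(1))
  moreover have "E_symmetric R (clamp_ext R u)"
    by (rule E_symmetric_cong[OF assms(3,1)]) (simp add: clamp_ext_apply_dom[OF assms(2)])
  ultimately show ?thesis by (simp add: E_sub_def)
qed

lemma E_sub_norm_le:
  assumes "w \<in> E_sub R" "0 < R" "\<And>p. p \<in> rz_domain R \<Longrightarrow> \<bar>apply_bcontfun w p\<bar> \<le> e"
  shows "norm w \<le> e"
proof (rule norm_bound)
  fix p
  have "apply_bcontfun w p = apply_bcontfun w (clamp (0, -1) (R, 1) p)"
    using E_subD(1)[OF assms(1)] by simp
  then show "norm (apply_bcontfun w p) \<le> e"
    using assms(3)[OF clamp_rz[OF assms(2)]] by simp
qed

lemma apply_le_norm: "\<bar>apply_bcontfun w p\<bar> \<le> norm w"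
  using norm_bounded[of w p] by simp

lemma E_sub_eqI:
  assumes "w \<in> E_sub R" "v \<in> E_sub R" "0 < R" "\<And>p. p \<in> rz_domain R \<Longrightarrow> apply_bcontfun w p = apply_bcontfun v p"
  shows "w = v"
proof (rule bcontfun_eqI)
  fix p
  have "apply_bcontfun w p = apply_bcontfun w (clamp (0, -1) (R, 1) p)"
    "apply_bcontfun v p = apply_bcontfun v (clamp (0, -1) (R, 1) p)"
    using E_subD(1)[OF assms(1)] E_subD(1)[OF assms(2)] by simp_all
  then show "apply_bcontfun w p = apply_bcontfun v p"
    using assms(4)[OF clamp_rz[OF assms(3)]] by simp
qed

lemma E_space_iff:
  "u \<in> E_space R \<longleftrightarrow> u \<in> extensional (rz_domain R) \<and> continuous_rz R u \<and> E_symmetric R u"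
  unfolding E_space_def E_symmetric_def by blast

lemma restrict_in_E_space:
  assumes "w \<in> E_sub R" "0 < R"
  shows "restrict (apply_bcontfun w) (rz_domain R) \<in> E_space R"
proof -
  have "continuous_rz R (restrict (apply_bcontfun w) (rz_domain R))"
    by (rule continuous_on_eq[OF continuous_on_apply_bcontfun]) simp
  moreover have "E_symmetric R (restrict (apply_bcontfun w) (rz_domain R))"
    by (rule E_symmetric_cong[of R "apply_bcontfun w"]) (use assms in \<open>simp_all add: E_sub_def\<close>)
  ultimately show ?thesis
    by (simp add: E_space_iff)
qed

lemma E_dist_le_iff:
  assumes "0 < R" "continuous_rz R u" "continuous_rz R v"
  shows "E_dist R u v \<le> e \<longleftrightarrow> (\<forall>p\<in>rz_domain R. \<bar>u p - v p\<bar> \<le> e)"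
proof -
  have "compact ((\<lambda>p. \<bar>u p - v p\<bar>) ` rz_domain R)"
    using assms by (intro compact_continuous_image continuous_intros compact_rz_domain)
  then have "bdd_above ((\<lambda>p. \<bar>u p - v p\<bar>) ` rz_domain R)"
    by (intro bounded_imp_bdd_above compact_imp_bounded)
  moreover have "rz_domain R \<noteq> {}" using assms(1) by (auto simp: rz_domain_def)
  ultimately show ?thesis
    by (simp add: E_dist_def E_norm_def cSUP_le_iff)
qed

lemma B_space_props:
  assumes "b \<in> B_space R" "0 < R"
  shows "\<And>x. x \<in> {0..R} \<Longrightarrow> (b has_real_derivative bderiv R b x) (at x within {0..R})"
    and "continuous_on {0..R} b" "continuous_on {0..R} (bderiv R b)"
proof -
  show "(b has_real_derivative bderiv R b x) (at x within {0..R})" if "x \<in> {0..R}" for x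
    using assms(1) that
    by (auto simp: B_space_def bderiv_def has_real_derivative_iff_has_vector_derivative vector_derivative_works)
  then show "continuous_on {0..R} b"
    by (intro DERIV_continuous_on)
  show "continuous_on {0..R} (bderiv R b)"
    using assms(1) by (simp add: B_space_def)
qed

lemma bderiv_eqI:
  assumes "(b has_real_derivative d) (at x within {0..R})" "x \<in> {0..R}" "0 < R"
  shows "bderiv R b x = d"
  unfolding bderiv_def
  using assms
  by (intro vector_derivative_within_cbox[of 0 R, simplified])
     (auto simp: has_real_derivative_iff_has_vector_derivative)

text \<open>
  Both suprema are finite by compactness, and the one-sided derivative is additive.
\<close>

lemma B_norm_diff_ge:
  assumes "b \<in> B_space R" "b' \<in> B_space R" "0 < R" "x \<in> {0..R}"
  shows "\<bar>b x - b' x\<bar> \<le> B_norm R (\<lambda>x. b x - b' x)"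
    and "\<bar>bderiv R b x - bderiv R b' x\<bar> \<le> B_norm R (\<lambda>x. b x - b' x)"
proof -
  note B = B_space_props[OF assms(1,3)] and B' = B_space_props[OF assms(2,3)]
  have d: "bderiv R (\<lambda>x. b x - b' x) x = bderiv R b x - bderiv R b' x" if "x \<in> {0..R}" for x
    by (rule bderiv_eqI[OF DERIV_diff[OF B(1) B'(1)] that assms(3)]) (use that in auto)
  have bdd: "bdd_above ((\<lambda>x. \<bar>f x\<bar>) ` {0..R})" if "continuous_on {0..R} f" for f :: "real \<Rightarrow> real"
    using that by (intro bounded_imp_bdd_above compact_imp_bounded compact_continuous_image continuous_intros) auto
  have up: "\<bar>f x\<bar> \<le> (SUP x\<in>{0..R}. \<bar>f x\<bar>)" if "continuous_on {0..R} f" for f :: "real \<Rightarrow> real"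
    using bdd[OF that] assms(4) by (rule cSUP_upper2) simp
  have c2: "continuous_on {0..R} (bderiv R (\<lambda>x. b x - b' x))"
    by (rule continuous_on_eq[of _ "\<lambda>x. bderiv R b x - bderiv R b' x"]) (auto simp: d intro!: continuous_intros B(3) B'(3))
  have 1: "\<bar>b x - b' x\<bar> \<le> (SUP x\<in>{0..R}. \<bar>b x - b' x\<bar>)"
    by (rule up) (intro continuous_intros B(2) B'(2))
  have 2: "\<bar>bderiv R (\<lambda>x. b x - b' x) x\<bar> \<le> (SUP x\<in>{0..R}. \<bar>bderiv R (\<lambda>x. b x - b' x) x\<bar>)"
    by (rule up[OF c2])
  show "\<bar>b x - b' x\<bar> \<le> B_norm R (\<lambda>x. b x - b' x)"
    "\<bar>bderiv R b x - bderiv R b' x\<bar> \<le> B_norm R (\<lambda>x. b x - b' x)"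
    using 1 2 d[OF assms(4)] by (auto simp: B_norm_def)
qed

lemma axis_dist_in_interval:
  assumes "(r, z) \<in> rz_domain R"
  shows "r * sqrt (1 - z\<^sup>2) \<in> {0..R}"
proof -
  have "0 \<le> sqrt (1 - z\<^sup>2)" "sqrt (1 - z\<^sup>2) \<le> 1"
    using assms by (auto simp: rz_domain_def abs_square_le_1 abs_le_iff)
  then have "r * sqrt (1 - z\<^sup>2) \<le> R * 1"
    using assms by (intro mult_mono) (auto simp: rz_domain_def)
  with \<open>0 \<le> sqrt (1 - z\<^sup>2)\<close> show ?thesis using assms by (auto simp: rz_domain_def)
qed

lemma gg_props:
  assumes "b \<in> B_space R" "0 < R"
  shows "continuous_rz R (gg b)" "E_symmetric R (gg b)"
    and "\<And>r z. (r, z) \<in> rz_domain R \<Longrightarrow>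
      ((\<lambda>s. gg b (s, z)) has_real_derivative bderiv R b (r * sqrt (1 - z\<^sup>2)) * sqrt (1 - z\<^sup>2)) (at r within {0..R})"
    and "continuous_rz R (\<lambda>(r, z). bderiv R b (r * sqrt (1 - z\<^sup>2)) * sqrt (1 - z\<^sup>2))"
proof -
  note B = B_space_props[OF assms]
  have c: "continuous_rz R (\<lambda>p. fst p * sqrt (1 - (snd p)\<^sup>2))"
    by (intro continuous_intros)
  have sub: "(\<lambda>p. fst p * sqrt (1 - (snd p)\<^sup>2)) ` rz_domain R \<subseteq> {0..R}"
    by (clarsimp simp del: atLeastAtMost_iff) (rule axis_dist_in_interval)
  show "continuous_rz R (gg b)"
    using continuous_on_compose2[OF B(2) c sub] by (simp add: gg_def case_prod_unfold)
  show "E_symmetric R (gg b)" by (simp add: E_symmetric_def gg_def)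
  show "continuous_rz R (\<lambda>(r, z). bderiv R b (r * sqrt (1 - z\<^sup>2)) * sqrt (1 - z\<^sup>2))"
    using continuous_on_compose2[OF B(3) c sub]
    by (simp add: case_prod_unfold) (intro continuous_intros)
  fix r z assume rz: "(r, z) \<in> rz_domain R"
  let ?c = "sqrt (1 - z\<^sup>2)"
  have im: "(\<lambda>s. s * ?c) ` {0..R} \<subseteq> {0..R}"
  proof (rule image_subsetI)
    fix s assume "s \<in> {0..R}"
    then have "(s, z) \<in> rz_domain R" using rz by (simp add: rz_domain_def)
    then show "s * ?c \<in> {0..R}" by (rule axis_dist_in_interval)
  qed
  have "((\<lambda>s. s * ?c) has_real_derivative ?c) (at r within {0..R})"
    by (auto intro!: derivative_eq_intros)
  moreover have "(b has_real_derivative bderiv R b (r * ?c)) (at (r * ?c) within (\<lambda>s. s * ?c) ` {0..R})"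
    using has_field_derivative_subset[OF B(1)[OF axis_dist_in_interval[OF rz]] im] .
  ultimately show "((\<lambda>s. gg b (s, z)) has_real_derivative bderiv R b (r * ?c) * ?c) (at r within {0..R})"
    using DERIV_image_chain[of b "bderiv R b (r * ?c)" "\<lambda>s. s * ?c" r "{0..R}" ?c]
    by (simp add: gg_def o_def)
qed


section \<open>The linearised problem\<close>

text \<open>
  The common shape of \<^const>\<open>GG\<close> and \<^const>\<open>DGG\<close>.
\<close>

definition centred_potential :: "real \<Rightarrow> (real \<times> real \<Rightarrow> real) \<Rightarrow> real \<times> real \<Rightarrow> real" where
  "centred_potential R f p = KK R f p - KK R f (0, 0)"

lemma GG_centred: "GG R f u p = 1 + centred_potential R (f \<circ> u) p"
  by (simp add: GG_def centred_potential_def)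

lemma DGG_centred: "DGG R f u h = centred_potential R (\<lambda>q. deriv f (u q) * h q)"
  by (rule ext) (simp add: DGG_def centred_potential_def)

lemma centre_in_domain: "0 < R \<Longrightarrow> (0, 0) \<in> rz_domain R"
  by (simp add: rz_domain_def)

lemma centred_potential_bound:
  assumes "0 < R" "p \<in> rz_domain R" "sup_bounded R M f" "0 \<le> M"
  shows "\<bar>centred_potential R f p\<bar> \<le> 2 * kernel_const R * M"
  using KK_bound[OF assms] KK_bound[OF assms(1) centre_in_domain[OF assms(1)] assms(3,4)]
  by (simp add: centred_potential_def abs_le_iff algebra_simps)

lemma centred_potential_continuous:
  "0 < R \<Longrightarrow> continuous_rz R f \<Longrightarrow> continuous_rz R (centred_potential R f)"
  unfolding centred_potential_def[abs_def] by (intro continuous_intros KK_continuous)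

lemma centred_potential_symmetric:
  assumes "E_symmetric R f"
  shows "E_symmetric R (centred_potential R f)"
proof (rule E_symmetricI)
  show "centred_potential R f (0, z) = centred_potential R f (0, 0)" for z
    by (simp add: centred_potential_def KK_centre[of R f z])
  show "centred_potential R f (r, - z) = centred_potential R f (r, z)" for r z
    using KK_reflect[of R f r z] E_symmetricD(2)[OF assms]
    by (simp add: centred_potential_def rz_domain_def)
qed

lemma centred_potential_cong:
  "(\<And>q. q \<in> rz_domain R \<Longrightarrow> f q = g q) \<Longrightarrow> centred_potential R f = centred_potential R g"
  using KK_cong[of R f g] by (simp add: centred_potential_def[abs_def])

lemma centred_potential_add:
  assumes "0 < R" "p \<in> rz_domain R" "continuous_rz R f" "continuous_rz R g"
  shows "centred_potential R (\<lambda>q. f q + g q) p = centred_potential R f p + centred_potential R g p"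
  unfolding centred_potential_def KK_add[OF assms] KK_add[OF assms(1) centre_in_domain[OF assms(1)] assms(3,4)]
  by simp

lemma centred_potential_diff:
  assumes "0 < R" "p \<in> rz_domain R" "continuous_rz R f" "continuous_rz R g"
  shows "centred_potential R (\<lambda>q. f q - g q) p = centred_potential R f p - centred_potential R g p"
  unfolding centred_potential_def KK_diff[OF assms] KK_diff[OF assms(1) centre_in_domain[OF assms(1)] assms(3,4)]
  by simp

lemma centred_potential_scale: "centred_potential R (\<lambda>q. c * f q) p = c * centred_potential R f p"
  unfolding centred_potential_def KK_scale by (simp add: right_diff_distrib)

text \<open>
  The equation of state enters through an exponent above \<open>1\<close> and a smooth correction factor.
\<close>

locale stellar_model =
  fixes R \<nu> :: real and \<Lambda>\<rho> :: "real \<Rightarrow> real"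
  assumes R: "0 < R" and \<nu>: "1 < \<nu>" and \<Lambda>\<rho>: "smooth_on UNIV \<Lambda>\<rho>"
begin

abbreviation "f \<equiv> ff \<nu> \<Lambda>\<rho>"
abbreviation "f' \<equiv> ff_deriv \<nu> \<Lambda>\<rho>"

text \<open>
  The operators \<^const>\<open>DGG\<close> and \<open>u \<mapsto> gg b + GG R f u\<close>, transported to the Banach space of bounded
  continuous functions.
\<close>

definition linearised_op :: "real \<Rightarrow> (real \<times> real \<Rightarrow> real) \<Rightarrow> (real \<times> real) \<Rightarrow>\<^sub>C real \<Rightarrow> (real \<times> real) \<Rightarrow>\<^sub>C real" where
  "linearised_op uO u h = clamp_ext R (centred_potential R (\<lambda>q. f' uO (u q) * h q))"

definition solution_op :: "(real \<Rightarrow> real) \<Rightarrow> real \<Rightarrow> (real \<times> real) \<Rightarrow>\<^sub>C real \<Rightarrow> (real \<times> real) \<Rightarrow>\<^sub>C real" where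
  "solution_op b uO w = clamp_ext R (\<lambda>p. gg b p + (1 + centred_potential R (\<lambda>q. f uO (w q)) p))"

lemma f_comp_continuous:
  assumes "continuous_on S u"
  shows "continuous_on S (\<lambda>q. f uO (u q))" "continuous_on S (\<lambda>q. f' uO (u q))"
  by (rule continuous_on_compose2[OF ff_continuous(1)[OF \<nu> \<Lambda>\<rho>, of UNIV] assms]
      continuous_on_compose2[OF ff_continuous(2)[OF \<nu> \<Lambda>\<rho>, of UNIV] assms]; simp)+

lemma combine_symmetric:
  assumes "E_symmetric R u" "E_symmetric R v"
  shows "E_symmetric R (\<lambda>q. \<phi> (u q) (v q))"
proof (rule E_symmetricI)
  show "\<phi> (u (0, z)) (v (0, z)) = \<phi> (u (0, 0)) (v (0, 0))" if "z \<in> {-1..1}" for z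
    by (simp only: E_symmetricD(1)[OF assms(1) that] E_symmetricD(1)[OF assms(2) that])
  show "\<phi> (u (r, - z)) (v (r, - z)) = \<phi> (u (r, z)) (v (r, z))" if "(r, z) \<in> rz_domain R" for r z
    by (simp only: E_symmetricD(2)[OF assms(1) that] E_symmetricD(2)[OF assms(2) that])
qed

lemma linearised_op_apply:
  assumes "continuous_rz R u"
  shows "linearised_op uO u h p =
    centred_potential R (\<lambda>q. f' uO (u q) * h q) (clamp (0, -1) (R, 1) p)"
  unfolding linearised_op_def
  by (intro clamp_ext_apply centred_potential_continuous R continuous_on_mult f_comp_continuous assms
      continuous_on_apply_bcontfun)

lemma solution_op_apply:
  assumes "b \<in> B_space R"
  shows "solution_op b uO w p = gg b (clamp (0, -1) (R, 1) p) +
    (1 + centred_potential R (\<lambda>q. f uO (w q)) (clamp (0, -1) (R, 1) p))"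
  unfolding solution_op_def
  by (intro clamp_ext_apply continuous_on_add continuous_on_const gg_props(1)[OF assms R]
      centred_potential_continuous R f_comp_continuous continuous_on_apply_bcontfun)

lemma linearised_op_in_E_sub:
  assumes "continuous_rz R u" "E_symmetric R u" "h \<in> E_sub R"
  shows "linearised_op uO u h \<in> E_sub R"
  unfolding linearised_op_def
proof (intro clamp_ext_in_E_sub centred_potential_symmetric centred_potential_continuous R)
  show "continuous_rz R (\<lambda>q. f' uO (u q) * h q)"
    by (intro continuous_on_mult f_comp_continuous assms continuous_on_apply_bcontfun)
  show "E_symmetric R (\<lambda>q. f' uO (u q) * h q)"
    by (rule combine_symmetric[OF assms(2) E_subD(2)[OF assms(3)], where \<phi>="\<lambda>x y. f' uO x * y"])
qed

lemma solution_op_in_E_sub: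
  assumes "b \<in> B_space R" "w \<in> E_sub R"
  shows "solution_op b uO w \<in> E_sub R"
  unfolding solution_op_def
proof (intro clamp_ext_in_E_sub R)
  show "continuous_rz R (\<lambda>p. gg b p + (1 + centred_potential R (\<lambda>q. f uO (w q)) p))"
    by (intro continuous_on_add continuous_on_const gg_props(1)[OF assms(1) R]
      centred_potential_continuous R f_comp_continuous continuous_on_apply_bcontfun)
  have "E_symmetric R (centred_potential R (\<lambda>q. f uO (w q)))"
    using combine_symmetric[OF E_subD(2)[OF assms(2)] E_subD(2)[OF assms(2)], where \<phi>="\<lambda>x y. f uO x"]
    by (rule centred_potential_symmetric)
  from combine_symmetric[OF gg_props(2)[OF assms(1) R] this, where \<phi>="\<lambda>x y. x + (1 + y)"]
  show "E_symmetric R (\<lambda>p. gg b p + (1 + centred_potential R (\<lambda>q. f uO (w q)) p))" .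
qed

lemma weight_sup_bounded:
  assumes "continuous_rz R u"
  obtains M where "0 \<le> M" "\<And>h. sup_bounded R (M * norm h) (\<lambda>q. f' uO (u q) * apply_bcontfun h q)"
proof -
  obtain M where M: "0 \<le> M" "sup_bounded R M (\<lambda>q. f' uO (u q))"
    using continuous_imp_sup_bounded[OF f_comp_continuous(2)[OF assms]] .
  have "sup_bounded R (M * norm h) (\<lambda>q. f' uO (u q) * apply_bcontfun h q)" for h
    unfolding sup_bounded_def
  proof (intro conjI ballI)
    show "continuous_rz R (\<lambda>q. f' uO (u q) * h q)"
      by (intro continuous_on_mult f_comp_continuous assms continuous_on_apply_bcontfun)
    fix q assume "q \<in> rz_domain R"
    then have "\<bar>f' uO (u q)\<bar> \<le> M" using M(2) by (simp add: sup_bounded_def)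
    then show "\<bar>f' uO (u q) * h q\<bar> \<le> M * norm h"
      unfolding abs_mult by (intro mult_mono apply_le_norm M) auto
  qed
  with M(1) show ?thesis by (rule that)
qed

lemma linearised_op_bounded_linear:
  assumes "continuous_rz R u"
  shows "bounded_linear (linearised_op uO u)"
proof -
  have c: "continuous_rz R (\<lambda>q. f' uO (u q) * h q)" for h :: "(real \<times> real) \<Rightarrow>\<^sub>C real"
    by (intro continuous_on_mult f_comp_continuous assms continuous_on_apply_bcontfun)
  obtain M where M: "0 \<le> M" "\<And>h. sup_bounded R (M * norm h) (\<lambda>q. f' uO (u q) * apply_bcontfun h q)"
    using weight_sup_bounded[OF assms, where uO=uO] by blast
  show ?thesis
  proof (rule bounded_linear_intro[where K="2 * kernel_const R * M"])
    fix g h :: "(real \<times> real) \<Rightarrow>\<^sub>C real" and a :: real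
    show "linearised_op uO u (g + h) = linearised_op uO u g + linearised_op uO u h"
      using centred_potential_add[OF R clamp_rz[OF R] c[of g] c[of h]]
      by (intro bcontfun_eqI) (simp add: linearised_op_apply[OF assms] distrib_left)
    show "linearised_op uO u (a *\<^sub>R h) = a *\<^sub>R linearised_op uO u h"
      using centred_potential_scale[of R a "\<lambda>q. f' uO (u q) * h q"]
      by (intro bcontfun_eqI) (simp add: linearised_op_apply[OF assms] mult.left_commute)
    show "norm (linearised_op uO u h) \<le> norm h * (2 * kernel_const R * M)"
    proof (rule norm_bound)
      fix p
      show "norm (linearised_op uO u h p) \<le> norm h * (2 * kernel_const R * M)"
        using centred_potential_bound[OF R clamp_rz[OF R, of p] M(2) mult_nonneg_nonneg[OF M(1) norm_ge_zero], of h]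
        by (simp add: linearised_op_apply[OF assms] mult_ac)
    qed
  qed
qed

text \<open>
  Arzela--Ascoli: the sources are uniformly bounded, so their potentials are bounded and
  equicontinuous.
\<close>

lemma linearised_op_compact:
  assumes "continuous_rz R u" and x: "\<And>n::nat. norm (x n) \<le> 1"
  shows "\<exists>l r. strict_mono (r :: nat \<Rightarrow> nat) \<and> (\<lambda>n. linearised_op uO u (x (r n))) \<longlonglongrightarrow> l"
proof -
  define F where "F n = centred_potential R (\<lambda>q. f' uO (u q) * x n q)" for n
  obtain M where M: "0 \<le> M" "\<And>h. sup_bounded R (M * norm h) (\<lambda>q. f' uO (u q) * apply_bcontfun h q)"
    using weight_sup_bounded[OF assms(1), where uO=uO] by blast
  have sb: "sup_bounded R M (\<lambda>q. f' uO (u q) * x n q)" for n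
    using M(1) x[of n] by (intro sup_bounded_mono[OF M(2)] mult_left_le)
  obtain g k where g: "continuous_rz R g" and k: "strict_mono (k :: nat \<Rightarrow> nat)"
    and lim: "\<And>e. 0 < e \<Longrightarrow> \<exists>N. \<forall>n x. n \<ge> N \<and> x \<in> rz_domain R \<longrightarrow> norm (F (k n) x - g x) < e"
  proof (rule Arzela_Ascoli[of "rz_domain R" F "2 * kernel_const R * M"])
    show "norm (F n p) \<le> 2 * kernel_const R * M" if "p \<in> rz_domain R" for n p
      unfolding F_def real_norm_def by (rule centred_potential_bound[OF R that sb M(1)])
    show "\<exists>d. 0 < d \<and> (\<forall>n q. q \<in> rz_domain R \<and> norm (p - q) < d \<longrightarrow> norm (F n p - F n q) < e)"
      if p: "p \<in> rz_domain R" and "0 < e" for p e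
    proof -
      obtain d where d: "d > 0" "\<And>f p q. sup_bounded R M f \<Longrightarrow> p \<in> rz_domain R \<Longrightarrow> q \<in> rz_domain R \<Longrightarrow>
        dist p q < d \<Longrightarrow> \<bar>KK R f p - KK R f q\<bar> < e"
        using KK_equicontinuous[OF R M(1) \<open>0 < e\<close>] by blast
      show ?thesis
        using d(1) d(2)[OF sb p] by (intro exI[of _ d]) (simp add: F_def centred_potential_def dist_norm)
    qed
  qed (use compact_rz_domain in auto)
  have "(\<lambda>n. linearised_op uO u (x (k n))) \<longlonglongrightarrow> clamp_ext R g"
  proof (rule metric_LIMSEQ_I)
    fix e :: real assume "0 < e"
    then obtain N where N: "\<And>n p. n \<ge> N \<Longrightarrow> p \<in> rz_domain R \<Longrightarrow> norm (F (k n) p - g p) < e / 2"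
      using lim[of "e / 2"] by (metis half_gt_zero)
    have "dist (linearised_op uO u (x (k n))) (clamp_ext R g) \<le> e / 2" if "n \<ge> N" for n
      using N[OF that clamp_rz[OF R]]
      by (intro dist_bound)
        (simp add: linearised_op_apply[OF assms(1)] clamp_ext_apply[OF g] F_def dist_real_def less_imp_le)
    then show "\<exists>N. \<forall>n\<ge>N. dist (linearised_op uO u (x (k n))) (clamp_ext R g) < e"
      using \<open>0 < e\<close> by (intro exI[of _ N]) fastforce
  qed
  with k show ?thesis by blast
qed

lemma HL_iff:
  "HL R \<nu> \<Lambda>\<rho> uO u \<longleftrightarrow> (\<forall>h\<in>E_space R. (\<forall>p\<in>rz_domain R. h p = centred_potential R (\<lambda>q. f' uO (u q) * h q) p)
    \<longrightarrow> (\<forall>p\<in>rz_domain R. h p = 0))"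
  by (simp add: HL_def DGG_centred deriv_ff[OF \<nu> \<Lambda>\<rho>])

lemma HL_injective:
  assumes "HL R \<nu> \<Lambda>\<rho> uO u" "continuous_rz R u" "x \<in> E_sub R" "linearised_op uO u x = x"
  shows "x = 0"
proof -
  let ?h = "restrict (apply_bcontfun x) (rz_domain R)"
  have "?h p = centred_potential R (\<lambda>q. f' uO (u q) * ?h q) p" if "p \<in> rz_domain R" for p
  proof -
    have "?h p = linearised_op uO u x p" using that assms(4) by simp
    also have "\<dots> = centred_potential R (\<lambda>q. f' uO (u q) * x q) p"
      by (simp add: linearised_op_apply[OF assms(2)] clamp_rz_id[OF that])
    also have "centred_potential R (\<lambda>q. f' uO (u q) * x q) = centred_potential R (\<lambda>q. f' uO (u q) * ?h q)"
      by (rule centred_potential_cong) simp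
    finally show ?thesis .
  qed
  then have "\<forall>p\<in>rz_domain R. ?h p = 0"
    using assms(1) restrict_in_E_space[OF assms(3) R] unfolding HL_iff by blast
  then show "x = 0"
    by (intro E_sub_eqI[OF assms(3) subspace_0[OF subspace_E_sub] R]) simp
qed

text \<open>
  The Fredholm alternative for \<open>I - T\<close>, with injectivity supplied by (HL).
\<close>

lemma HL_invertible:
  assumes "HL R \<nu> \<Lambda>\<rho> uO u" "continuous_rz R u" "E_symmetric R u"
  obtains c where "0 < c" "\<And>x. x \<in> E_sub R \<Longrightarrow> c * norm x \<le> norm (x - linearised_op uO u x)"
    "(\<lambda>x. x - linearised_op uO u x) ` E_sub R = E_sub R"
proof -
  note V = subspace_E_sub[of R] closed_E_sub[of R]
  note T = linearised_op_bounded_linear[OF assms(2), of uO]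
  have TV: "linearised_op uO u ` E_sub R \<subseteq> E_sub R"
    using linearised_op_in_E_sub[OF assms(2,3)] by blast
  have comp: "\<exists>l r. strict_mono (r :: nat \<Rightarrow> nat) \<and> (\<lambda>n. linearised_op uO u (x (r n))) \<longlonglongrightarrow> l"
    if "\<And>n::nat. x n \<in> E_sub R" "\<And>n. norm (x n) \<le> 1" for x
    by (rule linearised_op_compact[OF assms(2) that(2)])
  have "\<exists>c>0. \<forall>x\<in>E_sub R. c * norm x \<le> norm (x - linearised_op uO u x)"
  proof (rule compact_perturbation_bounded_below[OF V T TV])
    show "x = 0" if "x \<in> E_sub R" "linearised_op uO u x = x" for x
      by (rule HL_injective[OF assms(1,2) that])
  qed (rule comp)
  then obtain c where c: "c > 0" "\<And>x. x \<in> E_sub R \<Longrightarrow> c * norm x \<le> norm (x - linearised_op uO u x)"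
    by blast
  moreover have "(\<lambda>x. x - linearised_op uO u x) ` E_sub R = E_sub R"
    by (rule compact_perturbation_surjective[OF V T TV _ c]) (rule comp)
  ultimately show ?thesis using that by blast
qed

text \<open>
  The remainder is the potential of the error made in linearising the profile at each point. The linearisation \<open>T\<close> is taken at the fixed \<open>(uO', u)\<close>, while \<open>w\<close>, \<open>v\<close> and \<open>uO\<close> vary nearby.
\<close>

lemma linearisation_error:
  assumes "b \<in> B_space R" "w \<in> E_sub R" "v \<in> E_sub R" "continuous_rz R u" "E_symmetric R u" "0 \<le> e"
    and near: "\<And>q x. q \<in> rz_domain R \<Longrightarrow> \<bar>x - u q\<bar> \<le> d \<Longrightarrow> \<bar>f' uO x - f' uO' (u q)\<bar> \<le> e"
    and "\<And>q. q \<in> rz_domain R \<Longrightarrow> \<bar>w q - u q\<bar> \<le> d" "\<And>q. q \<in> rz_domain R \<Longrightarrow> \<bar>v q - u q\<bar> \<le> d"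
  shows "norm (solution_op b uO w - solution_op b uO v - linearised_op uO' u (w - v))
    \<le> 2 * kernel_const R * e * norm (w - v)"
proof (rule E_sub_norm_le[OF _ R])
  show "solution_op b uO w - solution_op b uO v - linearised_op uO' u (w - v) \<in> E_sub R"
    using assms by (intro subspace_diff subspace_E_sub solution_op_in_E_sub linearised_op_in_E_sub)
  fix p assume p: "p \<in> rz_domain R"
  let ?F = "\<lambda>q. f uO (w q) - f uO (v q) - f' uO' (u q) * (w - v) q"
  have cw: "continuous_rz R (\<lambda>q. f uO (w q))" "continuous_rz R (\<lambda>q. f uO (v q))"
    by (intro f_comp_continuous continuous_on_apply_bcontfun)+
  have cl: "continuous_rz R (\<lambda>q. f' uO' (u q) * (w - v) q)"
    by (intro continuous_on_mult f_comp_continuous assms continuous_on_apply_bcontfun)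
  have "(solution_op b uO w - solution_op b uO v - linearised_op uO' u (w - v)) p = centred_potential R ?F p"
    by (simp only: minus_bcontfun.rep_eq solution_op_apply[OF assms(1)] linearised_op_apply[OF assms(4)] clamp_rz_id[OF p]
      centred_potential_diff[OF R p continuous_on_diff[OF cw] cl[unfolded minus_bcontfun.rep_eq]] centred_potential_diff[OF R p cw])
  also have "\<bar>\<dots>\<bar> \<le> 2 * kernel_const R * (e * norm (w - v))"
  proof (rule centred_potential_bound[OF R p])
    show "sup_bounded R (e * norm (w - v)) ?F"
      unfolding sup_bounded_def
    proof (intro conjI ballI continuous_on_diff cw cl)
      fix q assume q: "q \<in> rz_domain R"
      have "\<bar>f uO (w q) - f uO (v q) - f' uO' (u q) * (w q - v q)\<bar> \<le> e * \<bar>w q - v q\<bar>"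
        by (rule ff_linearisation[OF \<nu> \<Lambda>\<rho> near[OF q] assms(8)[OF q] assms(9)[OF q]])
      also have "\<dots> \<le> e * norm (w - v)"
        using apply_le_norm[of "w - v" q] assms(6) by (intro mult_left_mono) auto
      finally show "\<bar>?F q\<bar> \<le> e * norm (w - v)" by simp
    qed
  qed (use assms in simp)
  finally show "\<bar>(solution_op b uO w - solution_op b uO v - linearised_op uO' u (w - v)) p\<bar>
    \<le> 2 * kernel_const R * e * norm (w - v)" by (simp add: mult_ac)
qed

lemma parameter_error:
  assumes "b \<in> B_space R" "b' \<in> B_space R" "w \<in> E_sub R" "0 \<le> e"
    and "\<And>q. q \<in> rz_domain R \<Longrightarrow> \<bar>f uO (w q) - f uO' (w q)\<bar> \<le> e"
  shows "norm (solution_op b uO w - solution_op b' uO' w) \<le> B_norm R (\<lambda>x. b x - b' x) + 2 * kernel_const R * e"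
proof (rule E_sub_norm_le[OF _ R])
  show "solution_op b uO w - solution_op b' uO' w \<in> E_sub R"
    using assms by (intro subspace_diff subspace_E_sub solution_op_in_E_sub)
  fix p assume p: "p \<in> rz_domain R"
  have c: "continuous_rz R (\<lambda>q. f uO (w q))" "continuous_rz R (\<lambda>q. f uO' (w q))"
    by (intro f_comp_continuous continuous_on_apply_bcontfun)+
  have "(solution_op b uO w - solution_op b' uO' w) p =
    (gg b p - gg b' p) + centred_potential R (\<lambda>q. f uO (w q) - f uO' (w q)) p"
    by (simp add: solution_op_apply assms clamp_rz_id[OF p] centred_potential_diff[OF R p c])
  moreover have "\<bar>gg b p - gg b' p\<bar> \<le> B_norm R (\<lambda>x. b x - b' x)"
    using B_norm_diff_ge(1)[OF assms(1,2) R] axis_dist_in_interval p by (cases p) (simp add: gg_def)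
  moreover have "\<bar>centred_potential R (\<lambda>q. f uO (w q) - f uO' (w q)) p\<bar> \<le> 2 * kernel_const R * e"
    using assms(5) by (intro centred_potential_bound[OF R p _ assms(4)])
      (auto simp: sup_bounded_def intro!: continuous_on_diff c)
  ultimately show "\<bar>(solution_op b uO w - solution_op b' uO' w) p\<bar> \<le> B_norm R (\<lambda>x. b x - b' x) + 2 * kernel_const R * e"
    by linarith
qed

text \<open>
  A solution \<open>h\<close> of the perturbed linear equation satisfies the unperturbed one up to a multiple of its
  norm that is smaller than the lower bound \<open>c\<close>, and so vanishes.
\<close>

lemma HL_stable:
  assumes c: "0 < c" "\<And>x. x \<in> E_sub R \<Longrightarrow> c * norm x \<le> norm (x - linearised_op uO' u' x)"
    and u: "continuous_rz R u" "E_symmetric R u" and u': "continuous_rz R u'" "E_symmetric R u'"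
    and near: "\<And>q. q \<in> rz_domain R \<Longrightarrow> \<bar>f' uO (u q) - f' uO' (u' q)\<bar> \<le> e" and e: "0 \<le> e" "2 * kernel_const R * e < c"
  shows "HL R \<nu> \<Lambda>\<rho> uO u"
  unfolding HL_iff
proof (intro ballI impI)
  fix h p assume h: "h \<in> E_space R" and p: "p \<in> rz_domain R"
    and eq: "\<forall>p\<in>rz_domain R. h p = centred_potential R (\<lambda>q. f' uO (u q) * h q) p"
  have hc: "continuous_rz R h" "E_symmetric R h" using h by (simp_all add: E_space_iff)
  define H where "H = clamp_ext R h"
  have H: "H \<in> E_sub R" unfolding H_def by (rule clamp_ext_in_E_sub[OF R hc])
  have Hh: "H q = h q" if "q \<in> rz_domain R" for q
    unfolding H_def by (rule clamp_ext_apply_dom[OF hc(1) that])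
  have "norm (H - linearised_op uO' u' H) \<le> 2 * kernel_const R * (e * norm H)"
  proof (rule E_sub_norm_le[OF _ R])
    show "H - linearised_op uO' u' H \<in> E_sub R"
      using H u' by (intro subspace_diff subspace_E_sub linearised_op_in_E_sub)
    fix p assume p: "p \<in> rz_domain R"
    let ?g = "\<lambda>q. f' uO (u q) * H q" and ?g' = "\<lambda>q. f' uO' (u' q) * H q"
    have g: "continuous_rz R ?g" "continuous_rz R ?g'"
      by (intro continuous_on_mult f_comp_continuous u u' continuous_on_apply_bcontfun)+
    have "h p = centred_potential R (\<lambda>q. f' uO (u q) * h q) p" using eq p by blast
    also have "centred_potential R (\<lambda>q. f' uO (u q) * h q) = centred_potential R ?g"
      by (rule centred_potential_cong) (simp add: Hh)
    finally have "(H - linearised_op uO' u' H) p = centred_potential R (\<lambda>q. ?g q - ?g' q) p"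
      unfolding centred_potential_diff[OF R p g]
      by (simp add: Hh[OF p] linearised_op_apply[OF u'(1)] clamp_rz_id[OF p])
    also have "\<bar>\<dots>\<bar> \<le> 2 * kernel_const R * (e * norm H)"
    proof (rule centred_potential_bound[OF R p])
      show "sup_bounded R (e * norm H) (\<lambda>q. ?g q - ?g' q)"
        unfolding sup_bounded_def
      proof (intro conjI ballI continuous_on_diff g)
        fix q assume "q \<in> rz_domain R"
        then have "\<bar>f' uO (u q) - f' uO' (u' q)\<bar> * \<bar>H q\<bar> \<le> e * norm H"
          by (intro mult_mono near apply_le_norm e) auto
        then show "\<bar>?g q - ?g' q\<bar> \<le> e * norm H"
          by (simp add: abs_mult[symmetric] left_diff_distrib)
      qed
    qed (use e in simp)
    finally show "\<bar>(H - linearised_op uO' u' H) p\<bar> \<le> 2 * kernel_const R * (e * norm H)" .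
  qed
  then have "c * norm H \<le> (2 * kernel_const R * e) * norm H"
    using c(2)[OF H] by (simp add: mult_ac)
  then have "norm H = 0"
    using e(2) by (metis mult_le_cancel_right norm_ge_zero norm_le_zero_iff not_le order_antisym_conv)
  then show "h p = 0" using Hh[OF p] by simp
qed

end


section \<open>Persistence of admissibility, and the main result\<close>

text \<open>
  The graph of \<open>\<rho>\<close> is the zero set of \<open>u\<close> and hence closed; a map into a compact set with closed graph
  is continuous.
\<close>

lemma continuous_on_zero_curve:
  fixes u :: "real \<times> real \<Rightarrow> real" and \<rho> :: "real \<Rightarrow> real"
  assumes "continuous_on ({a..b} \<times> S) u" "compact S"
    and "\<And>z. z \<in> S \<Longrightarrow> \<rho> z \<in> {a..b} \<and> u (\<rho> z, z) = 0"
    and unique: "\<And>r z. z \<in> S \<Longrightarrow> r \<in> {a..b} \<Longrightarrow> u (r, z) = 0 \<Longrightarrow> r = \<rho> z"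
  shows "continuous_on S \<rho>"
proof (rule continuous_from_closed_graph[of "{a..b}"])
  let ?sw = "\<lambda>p :: real \<times> real. (snd p, fst p)"
  have cl: "closed (S \<times> {a..b})" using assms(2) by (intro closed_Times compact_imp_closed) auto
  have "continuous_on (S \<times> {a..b}) (\<lambda>p. u (?sw p))"
    by (rule continuous_on_compose2[OF assms(1)]) (auto intro!: continuous_intros)
  from continuous_closed_preimage_constant[OF this cl, of 0]
  have "closed {p \<in> S \<times> {a..b}. u (?sw p) = 0}" .
  also have "{p \<in> S \<times> {a..b}. u (?sw p) = 0} = (\<lambda>z. (z, \<rho> z)) ` S"
    using assms(3) unique by force
  finally show "closed ((\<lambda>z. (z, \<rho> z)) ` S)" .
qed (use assms in auto)

context stellar_model
begin

text \<open>
  The radial derivative of \<open>gg b + 1 +\<close> the centred potential of \<open>g\<close>.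
\<close>

definition solution_dr :: "(real \<Rightarrow> real) \<Rightarrow> (real \<times> real \<Rightarrow> real) \<Rightarrow> real \<times> real \<Rightarrow> real" where
  "solution_dr b g p = bderiv R b (fst p * sqrt (1 - (snd p)\<^sup>2)) * sqrt (1 - (snd p)\<^sup>2) + KK_dr R g p"

lemma solution_dr_continuous:
  assumes "b \<in> B_space R" "continuous_rz R g"
  shows "continuous_rz R (solution_dr b g)"
  unfolding solution_dr_def[abs_def]
  using gg_props(4)[OF assms(1) R] KK_dr_continuous[OF R assms(2)]
  by (intro continuous_on_add) (simp_all add: case_prod_unfold)

lemma solution_has_derivative:
  assumes "b \<in> B_space R" "continuous_rz R g"
    and "\<And>p. p \<in> rz_domain R \<Longrightarrow> u p = gg b p + (1 + centred_potential R g p)" "(r, z) \<in> rz_domain R"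
  shows "((\<lambda>s. u (s, z)) has_real_derivative solution_dr b g (r, z)) (at r within {0..R})"
proof -
  have rz: "r \<in> {0..R}" "z \<in> {-1..1}" using assms(4) by (simp_all add: rz_domain_def)
  have "((\<lambda>s. gg b (s, z) + KK R g (s, z) + (1 - KK R g (0, 0))) has_real_derivative
    bderiv R b (r * sqrt (1 - z\<^sup>2)) * sqrt (1 - z\<^sup>2) + KK_dr R g (r, z) + 0) (at r within {0..R})"
    by (intro DERIV_add gg_props(3)[OF assms(1) R assms(4)] KK_has_derivative[OF R assms(2) rz] DERIV_const)
  then have "((\<lambda>s. u (s, z)) has_real_derivative
    bderiv R b (r * sqrt (1 - z\<^sup>2)) * sqrt (1 - z\<^sup>2) + KK_dr R g (r, z) + 0) (at r within {0..R})"
  proof (rule has_field_derivative_transform_within[OF _ zero_less_one rz(1)])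
    fix s assume "s \<in> {0..R}"
    then have "(s, z) \<in> rz_domain R" using rz by (simp add: rz_domain_def)
    from assms(3)[OF this] show "gg b (s, z) + KK R g (s, z) + (1 - KK R g (0, 0)) = u (s, z)"
      by (simp add: centred_potential_def)
  qed
  then show ?thesis by (simp add: solution_dr_def)
qed

lemma solution_dr_difference:
  assumes "b \<in> B_space R" "b' \<in> B_space R" "continuous_rz R g" "continuous_rz R g'"
    and "\<And>q. q \<in> rz_domain R \<Longrightarrow> \<bar>g q - g' q\<bar> \<le> e" "0 \<le> e" "p \<in> rz_domain R"
  shows "\<bar>solution_dr b g p - solution_dr b' g' p\<bar> \<le> B_norm R (\<lambda>x. b x - b' x) + e * kernel_const R"
proof -
  obtain r z where p: "p = (r, z)" by (cases p)
  let ?c = "sqrt (1 - z\<^sup>2)"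
  have x: "r * ?c \<in> {0..R}" using axis_dist_in_interval assms(7) by (simp add: p)
  have c: "0 \<le> ?c" "?c \<le> 1"
    using assms(7) by (auto simp: p rz_domain_def abs_square_le_1 abs_le_iff)
  have "\<bar>bderiv R b (r * ?c) - bderiv R b' (r * ?c)\<bar> * ?c \<le> B_norm R (\<lambda>x. b x - b' x) * 1"
    by (rule mult_mono[OF B_norm_diff_ge(2)[OF assms(1,2) R x] c(2)])
      (use c B_norm_diff_ge(2)[OF assms(1,2) R x] in auto)
  then have "\<bar>bderiv R b (r * ?c) * ?c - bderiv R b' (r * ?c) * ?c\<bar> \<le> B_norm R (\<lambda>x. b x - b' x)"
    using c by (simp add: left_diff_distrib[symmetric] abs_mult)
  moreover have "\<bar>KK_dr R g p - KK_dr R g' p\<bar> \<le> e * kernel_const R"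
  proof -
    obtain M where M: "0 \<le> M" "sup_bounded R M g" using continuous_imp_sup_bounded[OF assms(3)] .
    obtain N where N: "0 \<le> N" "sup_bounded R N g'" using continuous_imp_sup_bounded[OF assms(4)] .
    have "KK_dr R g p - KK_dr R g' p = KK_dr R (\<lambda>q. g q - g' q) p"
      unfolding KK_dr_def box_integral_def right_diff_distrib[symmetric]
      by (subst set_integral_diff(2)[symmetric])
        (use box_integral_kernel_bound(1)[OF R assms(7) M(2,1), of "regular_kernel_deriv 0 p"]
          box_integral_kernel_bound(1)[OF R assms(7) N(2,1), of "regular_kernel_deriv 0 p"] in
          \<open>auto simp: algebra_simps\<close>)
    also have "\<bar>\<dots>\<bar> \<le> e * kernel_const R"
      using assms by (intro KK_dr_bound R) (auto simp: sup_bounded_def intro!: continuous_on_diff)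
    finally show ?thesis .
  qed
  ultimately show ?thesis
    unfolding solution_dr_def p fst_conv snd_conv by linarith
qed

lemma solution_eq_iff:
  "(\<forall>p\<in>rz_domain R. u p = gg b p + GG R (f uO) u p) \<longleftrightarrow>
   (\<forall>p\<in>rz_domain R. u p = gg b p + (1 + centred_potential R (\<lambda>q. f uO (u q)) p))"
  by (simp add: GG_centred o_def)

text \<open>
  On each ray \<open>u\<close> is positive up to \<open>r0\<close>, strictly decreasing from there on, and negative at \<open>R\<close>; so it
  has exactly one zero, which lies in \<open>(r0, R)\<close>.
\<close>

lemma admissibleI:
  assumes "b \<in> B_space R" "0 < uO" "u \<in> E_space R"
    and "\<forall>p\<in>rz_domain R. u p = gg b p + GG R (f uO) u p"
    and r0: "0 < r0" "r0 < R"
    and inner: "\<And>r z. r \<in> {0..r0} \<Longrightarrow> z \<in> {-1..1} \<Longrightarrow> 0 < u (r, z)"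
    and outer: "\<And>z. z \<in> {-1..1} \<Longrightarrow> u (R, z) < 0"
    and slope: "\<And>r z. r \<in> {r0..R} \<Longrightarrow> z \<in> {-1..1} \<Longrightarrow>
      \<exists>d<0. ((\<lambda>s. u (s, z)) has_real_derivative d) (at r within {0..R})"
  shows "admissible_solution R \<nu> \<Lambda>\<rho> b uO u"
proof -
  have uc: "continuous_rz R u" using assms(3) by (simp add: E_space_iff)
  have uc1: "continuous_on {r0..R} (\<lambda>s. u (s, z))" if "z \<in> {-1..1}" for z
    by (rule continuous_on_compose2[OF uc]) (use that r0 in \<open>auto simp: rz_domain_def intro!: continuous_intros\<close>)
  have decr: "u (s, z) < u (r, z)" if "r0 \<le> r" "r < s" "s \<le> R" "z \<in> {-1..1}" for r s z
  proof (rule DERIV_neg_imp_decreasing_open[OF that(2)])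
    show "continuous_on {r..s} (\<lambda>s. u (s, z))"
      by (rule continuous_on_subset[OF uc1]) (use that in auto)
    fix t assume t: "r < t" "t < s"
    then have "t \<in> {r0..R}" using that by auto
    then obtain d where "d < 0" "((\<lambda>s. u (s, z)) has_real_derivative d) (at t within {0..R})"
      using slope \<open>z \<in> {-1..1}\<close> by blast
    moreover have "at t within {0..R} = at t"
      using t that r0 by (intro at_within_Icc_at) auto
    ultimately show "\<exists>d. ((\<lambda>s. u (s, z)) has_real_derivative d) (at t) \<and> d < 0" by auto
  qed
  have "\<exists>\<rho>. r0 < \<rho> \<and> \<rho> < R \<and> u (\<rho>, z) = 0" if z: "z \<in> {-1..1}" for z
  proof -
    have "0 < u (r0, z)" "u (R, z) < 0" using inner[of r0 z] outer[of z] z r0 by auto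
    moreover obtain \<rho> where "r0 \<le> \<rho>" "\<rho> \<le> R" "u (\<rho>, z) = 0"
      using IVT2'[of "\<lambda>s. u (s, z)" R 0 r0, OF _ _ _ uc1[OF z]] calculation r0 by force
    ultimately show ?thesis by (intro exI[of _ \<rho>]) (auto simp: less_le)
  qed
  then obtain \<rho> where \<rho>: "\<And>z. z \<in> {-1..1} \<Longrightarrow> r0 < \<rho> z" "\<And>z. z \<in> {-1..1} \<Longrightarrow> \<rho> z < R"
    "\<And>z. z \<in> {-1..1} \<Longrightarrow> u (\<rho> z, z) = 0"
    by metis
  have pos: "0 < u (r, z)" if "z \<in> {-1..1}" "0 \<le> r" "r < \<rho> z" for r z
    using inner[of r z] decr[of r "\<rho> z" z] \<rho>[OF that(1)] that by (cases "r \<le> r0") auto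
  have neg: "u (r, z) < 0" if "z \<in> {-1..1}" "\<rho> z < r" "r \<le> R" for r z
    using decr[of "\<rho> z" r z] \<rho>[OF that(1)] that by auto
  have "continuous_on {-1..1} \<rho>"
  proof (rule continuous_on_zero_curve[of 0 R _ u])
    show "continuous_on ({0..R} \<times> {-1..1}) u" using uc by (simp add: rz_domain_def)
    show "\<rho> z \<in> {0..R} \<and> u (\<rho> z, z) = 0" if "z \<in> {-1..1}" for z
      using \<rho>[OF that] r0 by auto
    show "r = \<rho> z" if "z \<in> {-1..1}" "r \<in> {0..R}" "u (r, z) = 0" for r z
      using pos[OF that(1), of r] neg[OF that(1), of r] that by (cases r "\<rho> z" rule: linorder_cases) auto
  qed simp
  moreover have "\<rho> ` {-1..1} \<subseteq> {r0<..<R}" using \<rho> by auto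
  ultimately show ?thesis
    unfolding admissible_solution_def using assms(1-4) r0 \<rho>(3) pos neg slope
    by (intro conjI bexI[of _ r0] exI[of _ \<rho>] ballI) auto
qed

text \<open>
  By compactness the strict inequalities satisfied by \<open>ub\<close> hold with a margin: \<open>m\<close> for the slope on
  \<open>[r0, R]\<close>, \<open>m0\<close> for the values on \<open>[0, r0]\<close> and \<open>m1\<close> for those at \<open>R\<close>. The same radius \<open>r0\<close> then works
  for all nearby solutions.
\<close>

lemma admissible_stable:
  assumes adm: "admissible_solution R \<nu> \<Lambda>\<rho> bb uOb ub"
  shows "\<exists>\<eta>>0. \<forall>b uO u. b \<in> B_space R \<longrightarrow> uO > 0 \<longrightarrow> u \<in> E_space R \<longrightarrow>
    (\<forall>p\<in>rz_domain R. u p = gg b p + GG R (f uO) u p) \<longrightarrow>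
    B_norm R (\<lambda>x. b x - bb x) \<le> \<eta> \<longrightarrow> (\<forall>p\<in>rz_domain R. \<bar>u p - ub p\<bar> \<le> \<eta>) \<longrightarrow>
    (\<forall>p\<in>rz_domain R. \<bar>f uO (u p) - f uOb (ub p)\<bar> \<le> \<eta>) \<longrightarrow> admissible_solution R \<nu> \<Lambda>\<rho> b uO u"
proof -
  have bb: "bb \<in> B_space R" and ub: "ub \<in> E_space R"
    and eq: "\<forall>p\<in>rz_domain R. ub p = gg bb p + GG R (f uOb) ub p"
    using adm by (auto simp: admissible_solution_def)
  obtain r0 Rb where r0: "0 < r0" "r0 < R" and Rb: "Rb ` {-1..1} \<subseteq> {r0<..<R}"
    and slope: "\<And>r z. r \<in> {r0..R} \<Longrightarrow> z \<in> {-1..1} \<Longrightarrow>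
      \<exists>d<0. ((\<lambda>s. ub (s, z)) has_real_derivative d) (at r within {0..R})"
    and pos: "\<And>r z. z \<in> {-1..1} \<Longrightarrow> r \<in> {0..<Rb z} \<Longrightarrow> ub (r, z) > 0"
    and neg: "\<And>r z. z \<in> {-1..1} \<Longrightarrow> r \<in> {Rb z<..R} \<Longrightarrow> ub (r, z) < 0"
    using adm unfolding admissible_solution_def by (auto simp: greaterThanLessThan_iff)
  have ubc: "continuous_rz R ub" using ub by (simp add: E_space_iff)
  let ?fb = "\<lambda>q. f uOb (ub q)"
  have fbc: "continuous_rz R ?fb" by (rule f_comp_continuous[OF ubc])
  have sub: "{r0..R} \<times> {-1..1} \<subseteq> rz_domain R" "{0..r0} \<times> {-1..1} \<subseteq> rz_domain R" "{R} \<times> {-1..1} \<subseteq> rz_domain R"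
    using r0 by (auto simp: rz_domain_def)
  have dub: "((\<lambda>s. ub (s, z)) has_real_derivative solution_dr bb ?fb (r, z)) (at r within {0..R})"
    if "(r, z) \<in> rz_domain R" for r z
    using eq unfolding solution_eq_iff by (intro solution_has_derivative[OF bb fbc _ that]) auto
  have dneg: "solution_dr bb ?fb p < 0" if "p \<in> {r0..R} \<times> {-1..1}" for p
  proof -
    obtain r z where p: "p = (r, z)" by (cases p)
    have "r \<in> {r0..R}" "z \<in> {-1..1}" using that by (auto simp: p)
    then obtain d where d: "d < 0" "((\<lambda>s. ub (s, z)) has_real_derivative d) (at r within {0..R})"
      using slope by blast
    have "(r, z) \<in> rz_domain R" using that sub(1) p by blast
    moreover have "r \<in> {0..R}" using that r0 by (auto simp: p)
    ultimately have "d = solution_dr bb ?fb p"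
      using bderiv_eqI[OF d(2) _ R] bderiv_eqI[OF dub _ R] p by metis
    with d(1) show ?thesis by simp
  qed
  have below: "\<exists>m>0. \<forall>p\<in>K. m \<le> \<phi> p"
    if "compact K" "K \<noteq> {}" "continuous_on K \<phi>" "\<And>p. p \<in> K \<Longrightarrow> 0 < \<phi> p"
    for K :: "(real \<times> real) set" and \<phi> :: "real \<times> real \<Rightarrow> real"
    using continuous_attains_inf[OF that(1,2,3)] that(4) by blast
  have "\<exists>m>0. \<forall>p\<in>{r0..R} \<times> {-1..1}. m \<le> - solution_dr bb ?fb p"
    using r0 dneg by (intro below continuous_on_minus continuous_on_subset[OF solution_dr_continuous[OF bb fbc] sub(1)])
      (auto intro!: compact_Times)
  then obtain m where m: "m > 0" "\<And>p. p \<in> {r0..R} \<times> {-1..1} \<Longrightarrow> m \<le> - solution_dr bb ?fb p" by blast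
  have "\<exists>m>0. \<forall>p\<in>{0..r0} \<times> {-1..1}. m \<le> ub p"
    using r0 Rb pos by (intro below continuous_on_subset[OF ubc sub(2)]) (force intro!: compact_Times)+
  then obtain m0 where m0: "m0 > 0" "\<And>p. p \<in> {0..r0} \<times> {-1..1} \<Longrightarrow> m0 \<le> ub p" by blast
  have "\<exists>m>0. \<forall>p\<in>{R} \<times> {-1..1}. m \<le> - ub p"
    using r0 Rb neg by (intro below continuous_on_minus continuous_on_subset[OF ubc sub(3)]) (force intro!: compact_Times)+
  then obtain m1 where m1: "m1 > 0" "\<And>p. p \<in> {R} \<times> {-1..1} \<Longrightarrow> m1 \<le> - ub p" by blast
  have kc: "0 < kernel_const R" by (rule kernel_const_pos[OF R])
  define \<eta> where "\<eta> = min (m / (2 * (1 + kernel_const R))) (min (m0 / 2) (m1 / 2))"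
  have \<eta>: "0 < \<eta>" "\<eta> < m0" "\<eta> < m1" "\<eta> + \<eta> * kernel_const R < m"
  proof -
    show "0 < \<eta>" "\<eta> < m0" "\<eta> < m1" using m m0 m1 kc by (auto simp: \<eta>_def)
    have "\<eta> * (1 + kernel_const R) \<le> m / (2 * (1 + kernel_const R)) * (1 + kernel_const R)"
      using kc by (intro mult_right_mono) (auto simp: \<eta>_def)
    also have "\<dots> = m / 2" using kc by (simp add: divide_simps)
    finally show "\<eta> + \<eta> * kernel_const R < m" using m(1) by (simp add: distrib_left)
  qed
  show ?thesis
  proof (intro exI[of _ \<eta>] conjI \<eta>(1) allI impI)
    fix b uO u
    assume b: "b \<in> B_space R" and uO: "(0::real) < uO" and u: "u \<in> E_space R"
      and equ: "\<forall>p\<in>rz_domain R. u p = gg b p + GG R (f uO) u p"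
      and bn: "B_norm R (\<lambda>x. b x - bb x) \<le> \<eta>" and un: "\<forall>p\<in>rz_domain R. \<bar>u p - ub p\<bar> \<le> \<eta>"
      and fn: "\<forall>p\<in>rz_domain R. \<bar>f uO (u p) - f uOb (ub p)\<bar> \<le> \<eta>"
    have uc: "continuous_rz R u" using u by (simp add: E_space_iff)
    let ?fu = "\<lambda>q. f uO (u q)"
    have fuc: "continuous_rz R ?fu" by (rule f_comp_continuous[OF uc])
    show "admissible_solution R \<nu> \<Lambda>\<rho> b uO u"
    proof (rule admissibleI[OF b uO u equ r0])
      show "0 < u (r, z)" if "r \<in> {0..r0}" "z \<in> {-1..1}" for r z
      proof -
        have "m0 \<le> ub (r, z)" using m0(2)[of "(r, z)"] that by simp
        moreover have "(r, z) \<in> rz_domain R" using sub(2) that by auto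
        with un have "\<bar>u (r, z) - ub (r, z)\<bar> \<le> \<eta>" by blast
        ultimately show ?thesis using \<eta>(2) by linarith
      qed
      show "u (R, z) < 0" if "z \<in> {-1..1}" for z
      proof -
        have "m1 \<le> - ub (R, z)" using m1(2)[of "(R, z)"] that by simp
        moreover have "(R, z) \<in> rz_domain R" using sub(3) that by auto
        with un have "\<bar>u (R, z) - ub (R, z)\<bar> \<le> \<eta>" by blast
        ultimately show ?thesis using \<eta>(3) by linarith
      qed
      show "\<exists>d<0. ((\<lambda>s. u (s, z)) has_real_derivative d) (at r within {0..R})"
        if "r \<in> {r0..R}" "z \<in> {-1..1}" for r z
      proof (intro exI conjI)
        have rz: "(r, z) \<in> rz_domain R" using sub(1) that by auto
        show "((\<lambda>s. u (s, z)) has_real_derivative solution_dr b ?fu (r, z)) (at r within {0..R})"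
          using equ unfolding solution_eq_iff by (intro solution_has_derivative[OF b fuc _ rz]) auto
        have "\<bar>solution_dr b ?fu (r, z) - solution_dr bb ?fb (r, z)\<bar> \<le> B_norm R (\<lambda>x. b x - bb x) + \<eta> * kernel_const R"
          using fn \<eta>(1) by (intro solution_dr_difference b bb fuc fbc rz) auto
        moreover have "m \<le> - solution_dr bb ?fb (r, z)" using m(2)[of "(r, z)"] that by simp
        ultimately show "solution_dr b ?fu (r, z) < 0" using bn \<eta>(4) by linarith
      qed
    qed
  qed
qed

lemma fixed_point_iff_solution:
  assumes "b \<in> B_space R" "w \<in> E_sub R"
  shows "solution_op b uO w = w \<longleftrightarrow> (\<forall>p\<in>rz_domain R. w p = gg b p + GG R (f uO) w p)"
proof -
  have "solution_op b uO w p = gg b p + GG R (f uO) w p" if "p \<in> rz_domain R" for p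
    by (simp add: solution_op_apply[OF assms(1)] clamp_rz_id[OF that] GG_centred o_def)
  then show ?thesis
    using E_sub_eqI[OF solution_op_in_E_sub[OF assms] assms(2) R, of uO] by force
qed

lemma solution_eq_cong:
  assumes "\<And>p. p \<in> rz_domain R \<Longrightarrow> u p = v p"
  shows "(\<forall>p\<in>rz_domain R. u p = gg b p + GG R (f uO) u p) \<longleftrightarrow> (\<forall>p\<in>rz_domain R. v p = gg b p + GG R (f uO) v p)"
  using centred_potential_cong[of R "f uO \<circ> u" "f uO \<circ> v"] assms by (simp add: GG_centred)

text \<open>
  The assembly. Every solution in question lifts to a fixed point of \<open>solution_op\<close> in the ball of
  radius \<open>\<epsilon>\<close> around \<open>U\<close>, and for a fixed point \<open>w\<close> the inequality \<open>close\<close> bounds its distance to any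
  \<open>v\<close> in the ball by the defect of \<open>v\<close>. With \<open>v\<close> a second fixed point this is uniqueness, and with \<open>v\<close>
  the solution for other parameters it is continuity.
\<close>

lemma solution_near:
  assumes bb: "bb \<in> B_space R" and ub: "ub \<in> E_space R"
    and adm: "admissible_solution R \<nu> \<Lambda>\<rho> bb uOb ub" and HLb: "HL R \<nu> \<Lambda>\<rho> uOb ub" and uOb: "0 < uOb"
  shows "\<exists>\<delta>>0. \<exists>\<epsilon>>0. \<exists>S.
    (\<forall>b\<in>B_space R. \<forall>uO. param_dist R (b, uO) (bb, uOb) \<le> \<delta> \<longrightarrow>
       (\<exists>!u. admissible_solution R \<nu> \<Lambda>\<rho> b uO u \<and> HL R \<nu> \<Lambda>\<rho> uO u \<and> E_dist R u ub \<le> \<epsilon>) \<and>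
       admissible_solution R \<nu> \<Lambda>\<rho> b uO (S (b, uO)) \<and> HL R \<nu> \<Lambda>\<rho> uO (S (b, uO)) \<and>
       E_dist R (S (b, uO)) ub \<le> \<epsilon>) \<and>
    continuous_param_map R
      {(b, uO). b \<in> B_space R \<and> param_dist R (b, uO) (bb, uOb) \<le> \<delta>} S"
proof -
  have ubc: "continuous_rz R ub" "E_symmetric R ub" using ub by (simp_all add: E_space_iff)
  obtain c where c: "0 < c" "\<And>x. x \<in> E_sub R \<Longrightarrow> c * norm x \<le> norm (x - linearised_op uOb ub x)"
    "(\<lambda>x. x - linearised_op uOb ub x) ` E_sub R = E_sub R"
    using HL_invertible[OF HLb ubc] by blast
  obtain \<eta> where \<eta>: "0 < \<eta>" and stable: "\<And>b uO u. b \<in> B_space R \<Longrightarrow> uO > 0 \<Longrightarrow> u \<in> E_space R \<Longrightarrow>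
    (\<forall>p\<in>rz_domain R. u p = gg b p + GG R (f uO) u p) \<Longrightarrow>
    B_norm R (\<lambda>x. b x - bb x) \<le> \<eta> \<Longrightarrow> (\<forall>p\<in>rz_domain R. \<bar>u p - ub p\<bar> \<le> \<eta>) \<Longrightarrow>
    (\<forall>p\<in>rz_domain R. \<bar>f uO (u p) - f uOb (ub p)\<bar> \<le> \<eta>) \<Longrightarrow> admissible_solution R \<nu> \<Lambda>\<rho> b uO u"
    using admissible_stable[OF adm] by blast
  obtain B0 where B0: "0 \<le> B0" "sup_bounded R B0 ub" using continuous_imp_sup_bounded[OF ubc(1)] .
  define B where "B = max B0 uOb"
  have B: "\<bar>uOb\<bar> \<le> B" "\<And>q. q \<in> rz_domain R \<Longrightarrow> \<bar>ub q\<bar> \<le> B"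
    using B0 uOb by (auto simp: B_def sup_bounded_def le_max_iff_disj)
  define k where "k = kernel_const R"
  have k: "0 < k" unfolding k_def by (rule kernel_const_pos[OF R])
  \<comment> \<open>potentials cost a factor \<open>2 k\<close>, so this makes the Lipschitz constant of the remainder \<open>c/2\<close>\<close>
  define e where "e = c / (4 * k)"
  have e: "0 < e" "2 * k * e = c / 2" using c(1) k by (simp_all add: e_def)
  obtain d1 where d1: "0 < d1" and near1: "\<And>s t a b. \<bar>s\<bar> \<le> B \<Longrightarrow> \<bar>a\<bar> \<le> B \<Longrightarrow> \<bar>s - t\<bar> \<le> d1 \<Longrightarrow> \<bar>a - b\<bar> \<le> d1 \<Longrightarrow>
    \<bar>f' s a - f' t b\<bar> \<le> e"
    using jointly_continuous_uniform[OF ff_jointly_continuous(2)[OF \<nu> \<Lambda>\<rho>] e(1), of B] by blast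
  obtain d2 where d2: "0 < d2" and near2: "\<And>s t a b. \<bar>s\<bar> \<le> B \<Longrightarrow> \<bar>a\<bar> \<le> B \<Longrightarrow> \<bar>s - t\<bar> \<le> d2 \<Longrightarrow> \<bar>a - b\<bar> \<le> d2 \<Longrightarrow>
    \<bar>f s a - f t b\<bar> \<le> \<eta>"
    using jointly_continuous_uniform[OF ff_jointly_continuous(1)[OF \<nu> \<Lambda>\<rho>] \<eta>, of B] by blast
  define \<epsilon> where "\<epsilon> = min d1 (min d2 \<eta>)"
  have \<epsilon>: "0 < \<epsilon>" "\<epsilon> \<le> d1" "\<epsilon> \<le> d2" "\<epsilon> \<le> \<eta>" using d1 d2 \<eta> by (auto simp: \<epsilon>_def)
  \<comment> \<open>this and \<open>\<delta> \<le> c \<epsilon> / 4\<close> bound the defect of \<open>U\<close> by \<open>c \<epsilon> / 2\<close>\<close>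
  define e3 where "e3 = c * \<epsilon> / (8 * k)"
  have e3: "0 < e3" "2 * k * e3 = c * \<epsilon> / 4" using c(1) k \<epsilon>(1) by (simp_all add: e3_def)
  obtain d3 where d3: "0 < d3" and near3: "\<And>s t a b. \<bar>s\<bar> \<le> B \<Longrightarrow> \<bar>a\<bar> \<le> B \<Longrightarrow> \<bar>s - t\<bar> \<le> d3 \<Longrightarrow> \<bar>a - b\<bar> \<le> d3 \<Longrightarrow>
    \<bar>f s a - f t b\<bar> \<le> e3"
    using jointly_continuous_uniform[OF ff_jointly_continuous(1)[OF \<nu> \<Lambda>\<rho>] e3(1), of B] by blast
  \<comment> \<open>the bound \<open>uOb / 2\<close> keeps \<open>uO\<close> positive\<close>
  define \<delta> where "\<delta> = min (min d1 (min d2 d3)) (min \<eta> (min (c * \<epsilon> / 4) (uOb / 2)))"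
  have \<delta>: "0 < \<delta>" "\<delta> \<le> d1" "\<delta> \<le> d2" "\<delta> \<le> d3" "\<delta> \<le> \<eta>" "\<delta> \<le> c * \<epsilon> / 4" "\<delta> \<le> uOb / 2"
    using d1 d2 d3 \<eta> c(1) \<epsilon>(1) uOb by (auto simp: \<delta>_def)
  define U where "U = clamp_ext R ub"
  have U: "U \<in> E_sub R" "\<And>p. p \<in> rz_domain R \<Longrightarrow> U p = ub p"
    unfolding U_def by (auto intro: clamp_ext_in_E_sub[OF R ubc] clamp_ext_apply_dom[OF ubc(1)])
  define T where "T = linearised_op uOb ub"
  note V = subspace_E_sub[of R] closed_E_sub[of R]
  have T: "bounded_linear T" "T ` E_sub R \<subseteq> E_sub R"
    unfolding T_def using linearised_op_bounded_linear[OF ubc(1)] linearised_op_in_E_sub[OF ubc] by blast+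
  have "\<forall>p\<in>rz_domain R. ub p = gg bb p + GG R (f uOb) ub p"
    using adm by (simp add: admissible_solution_def)
  then have fixU: "solution_op bb uOb U = U"
    using solution_eq_cong[of U ub bb uOb, OF U(2)] fixed_point_iff_solution[OF bb U(1), of uOb] by blast
  define N where "N = {(b, uO). b \<in> B_space R \<and> param_dist R (b, uO) (bb, uOb) \<le> \<delta>}"
  have ND: "b \<in> B_space R" "B_norm R (\<lambda>x. b x - bb x) \<le> \<delta>" "\<bar>uOb - uO\<bar> \<le> \<delta>" "0 < uO"
    if "(b, uO) \<in> N" for b uO
  proof -
    show b: "b \<in> B_space R" using that by (simp add: N_def)
    have "0 \<le> B_norm R (\<lambda>x. b x - bb x)"
      using B_norm_diff_ge(1)[OF b bb R, of 0] R by auto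
    then show "B_norm R (\<lambda>x. b x - bb x) \<le> \<delta>" "\<bar>uOb - uO\<bar> \<le> \<delta>"
      using that by (auto simp: N_def param_dist_def)
    then show "0 < uO" using \<delta>(7) uOb by linarith
  qed
  have pointwise: "\<bar>w q - ub q\<bar> \<le> \<epsilon>" if "dist w U \<le> \<epsilon>" "q \<in> rz_domain R" for w q
    using order_trans[OF dist_bounded[of w q U] that(1)] U(2)[OF that(2)] by (simp add: dist_real_def)
  have lin: "norm (solution_op b uO w - solution_op b uO v - T (w - v)) \<le> c/2 * norm (w - v)"
    if "(b, uO) \<in> N" "w \<in> E_sub R" "v \<in> E_sub R" "dist w U \<le> \<epsilon>" "dist v U \<le> \<epsilon>" for b uO w v
  proof -
    note n = ND[OF that(1)]
    have "norm (solution_op b uO w - solution_op b uO v - linearised_op uOb ub (w - v))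
      \<le> 2 * kernel_const R * e * norm (w - v)"
    proof (rule linearisation_error[OF n(1) that(2,3) ubc less_imp_le[OF e(1)]])
      show "\<bar>f' uO x - f' uOb (ub q)\<bar> \<le> e" if "q \<in> rz_domain R" "\<bar>x - ub q\<bar> \<le> \<epsilon>" for q x
        using near1[OF B(1) B(2)[OF that(1)], of uO x] that(2) n(3) \<delta>(2) \<epsilon>(2)
        by (simp add: abs_minus_commute)
    qed (use pointwise that in auto)
    also have "2 * kernel_const R * e = c / 2" using e(2) by (simp add: k_def)
    finally show ?thesis by (simp only: T_def)
  qed
  have close: "c/2 * norm (w - v) \<le> norm (solution_op b uO v - v)"
    if "(b, uO) \<in> N" "w \<in> E_sub R" "v \<in> E_sub R" "dist w U \<le> \<epsilon>" "dist v U \<le> \<epsilon>"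
      "solution_op b uO w = w" for b uO w v
  proof -
    have "c * norm (w - v) \<le> norm (w - v - T (w - v))"
      unfolding T_def by (intro c(2) subspace_diff V that)
    also have "w - v - T (w - v) = (solution_op b uO w - solution_op b uO v - T (w - v)) + (solution_op b uO v - v)"
      using that(6) by simp
    also have "norm \<dots> \<le> c/2 * norm (w - v) + norm (solution_op b uO v - v)"
      by (intro norm_triangle_mono lin[OF that(1-5)] order_refl)
    finally show ?thesis by simp
  qed
  have exist: "\<exists>w\<in>E_sub R. dist w U \<le> \<epsilon> \<and> solution_op b uO w = w" if n: "(b, uO) \<in> N" for b uO
  proof (rule fixed_point_near_approximate[where T=T and c=c])
    note nd = ND[OF n]
    have "norm (solution_op b uO U - solution_op bb uOb U) \<le> B_norm R (\<lambda>x. b x - bb x) + 2 * kernel_const R * e3"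
    proof (rule parameter_error[OF nd(1) bb U(1) less_imp_le[OF e3(1)]])
      show "\<bar>f uO (U q) - f uOb (U q)\<bar> \<le> e3" if "q \<in> rz_domain R" for q
        using near3[OF B(1) B(2)[OF that], of uO "ub q"] nd(3) \<delta>(4) d3 U(2)[OF that] by (simp add: abs_minus_commute)
    qed
    then show "norm (solution_op b uO U - U) \<le> c/2 * \<epsilon>"
      using nd(2) \<delta>(6) e3(2) unfolding fixU k_def by linarith
  qed (use V T U c lin[OF n] \<epsilon>(1) solution_op_in_E_sub[OF ND(1)[OF n]] in \<open>auto simp: T_def\<close>)
  define Q where "Q p u \<longleftrightarrow> admissible_solution R \<nu> \<Lambda>\<rho> (fst p) (snd p) u \<and> HL R \<nu> \<Lambda>\<rho> (snd p) u \<and> E_dist R u ub \<le> \<epsilon>" for p u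
  have lift: "clamp_ext R u \<in> E_sub R \<and> dist (clamp_ext R u) U \<le> \<epsilon> \<and> solution_op b uO (clamp_ext R u) = clamp_ext R u
      \<and> (\<forall>p\<in>rz_domain R. clamp_ext R u p = u p) \<and> u \<in> extensional (rz_domain R)"
    if "Q (b, uO) u" for b uO u
  proof -
    have u: "u \<in> E_space R" "b \<in> B_space R" "\<forall>p\<in>rz_domain R. u p = gg b p + GG R (f uO) u p" "E_dist R u ub \<le> \<epsilon>"
      using that by (auto simp: Q_def admissible_solution_def)
    have uc: "continuous_rz R u" "E_symmetric R u" "u \<in> extensional (rz_domain R)"
      using u(1) by (simp_all add: E_space_iff)
    have dom: "clamp_ext R u p = u p" if "p \<in> rz_domain R" for p
      by (rule clamp_ext_apply_dom[OF uc(1) that])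
    have E: "clamp_ext R u \<in> E_sub R" by (rule clamp_ext_in_E_sub[OF R uc(1,2)])
    have "dist (clamp_ext R u) U \<le> \<epsilon>"
      unfolding dist_norm
    proof (rule E_sub_norm_le[OF subspace_diff[OF V(1) E U(1)] R])
      show "\<bar>(clamp_ext R u - U) p\<bar> \<le> \<epsilon>" if "p \<in> rz_domain R" for p
        using u(4) that unfolding E_dist_le_iff[OF R uc(1) ubc(1)] by (simp add: dom U(2))
    qed
    moreover have "solution_op b uO (clamp_ext R u) = clamp_ext R u"
      using u(3) fixed_point_iff_solution[OF u(2) E, of uO]
        solution_eq_cong[of "clamp_ext R u" u b uO, OF dom] by blast
    ultimately show ?thesis using E dom uc(3) by blast
  qed
  have Qex: "\<exists>u. Q (b, uO) u" if n: "(b, uO) \<in> N" for b uO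
  proof -
    note nd = ND[OF n]
    obtain w where w: "w \<in> E_sub R" "dist w U \<le> \<epsilon>" "solution_op b uO w = w" using exist[OF n] by blast
    define u where "u = restrict (apply_bcontfun w) (rz_domain R)"
    have uw: "u p = w p" if "p \<in> rz_domain R" for p using that by (simp add: u_def)
    have u: "u \<in> E_space R" unfolding u_def by (rule restrict_in_E_space[OF w(1) R])
    have uc: "continuous_rz R u" "E_symmetric R u" using u by (simp_all add: E_space_iff)
    have near: "\<bar>u p - ub p\<bar> \<le> \<epsilon>" if "p \<in> rz_domain R" for p
      using pointwise[OF w(2) that] by (simp add: uw[OF that])
    have sol: "\<forall>p\<in>rz_domain R. u p = gg b p + GG R (f uO) u p"
      using w(3) fixed_point_iff_solution[OF nd(1) w(1), of uO]
        solution_eq_cong[of u w b uO, OF uw] by blast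
    have "admissible_solution R \<nu> \<Lambda>\<rho> b uO u"
    proof (rule stable[OF nd(1,4) u sol])
      show "B_norm R (\<lambda>x. b x - bb x) \<le> \<eta>" using nd(2) \<delta>(5) by simp
      show "\<forall>p\<in>rz_domain R. \<bar>u p - ub p\<bar> \<le> \<eta>" using near \<epsilon>(4) by force
      show "\<forall>p\<in>rz_domain R. \<bar>f uO (u p) - f uOb (ub p)\<bar> \<le> \<eta>"
      proof
        fix p assume p: "p \<in> rz_domain R"
        show "\<bar>f uO (u p) - f uOb (ub p)\<bar> \<le> \<eta>"
          using near2[OF B(1) B(2)[OF p], of uO "u p"] near[OF p] nd(3) \<delta>(3) \<epsilon>(3) by (simp add: abs_minus_commute)
      qed
    qed
    moreover have "HL R \<nu> \<Lambda>\<rho> uO u"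
    proof (rule HL_stable[OF c(1,2) uc ubc _ less_imp_le[OF e(1)]])
      show "\<bar>f' uO (u q) - f' uOb (ub q)\<bar> \<le> e" if "q \<in> rz_domain R" for q
        using near1[OF B(1) B(2)[OF that], of uO "u q"] near[OF that] nd(3) \<delta>(2) \<epsilon>(2) by (simp add: abs_minus_commute)
      show "2 * kernel_const R * e < c" using e(2) c(1) by (simp add: k_def)
    qed
    moreover have "E_dist R u ub \<le> \<epsilon>"
      unfolding E_dist_le_iff[OF R uc(1) ubc(1)] using near by blast
    ultimately show ?thesis by (auto simp: Q_def)
  qed
  have Quniq: "u = v" if n: "(b, uO) \<in> N" and q: "Q (b, uO) u" "Q (b, uO) v" for b uO u v
  proof -
    note u = lift[OF q(1)] and v = lift[OF q(2)]
    have "c/2 * norm (clamp_ext R u - clamp_ext R v) \<le> norm (solution_op b uO (clamp_ext R v) - clamp_ext R v)"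
      using u v by (intro close[OF n]) auto
    also have "\<dots> = 0" using v by simp
    finally have eq: "clamp_ext R u = clamp_ext R v" using c(1) by (simp add: mult_le_0_iff)
    show "u = v"
    proof (rule extensionalityI[of _ "rz_domain R"])
      show "u x = v x" if "x \<in> rz_domain R" for x using u v eq that by metis
    qed (use u v in auto)
  qed
  define S where "S p = (SOME u. Q p u)" for p
  have S: "Q (b, uO) (S (b, uO))" if "(b, uO) \<in> N" for b uO
    unfolding S_def by (rule someI_ex[OF Qex[OF that]])
  have "continuous_param_map R N S"
    unfolding continuous_param_map_def
  proof (intro ballI allI impI)
    fix p and e' :: real assume p: "p \<in> N" and e': "0 < e'"
    obtain b uO where bp: "p = (b, uO)" by (cases p)
    note nd = ND[OF p[unfolded bp]]
    define W where "W = clamp_ext R (S p)"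
    note Wp = lift[OF S[OF p[unfolded bp]], folded bp, folded W_def]
    \<comment> \<open>the two defects, from \<open>b\<close> and from \<open>uO\<close>, are each bounded by \<open>c e' / 8\<close>\<close>
    define t where "t = c * e' / (16 * k)"
    have t: "0 < t" "2 * k * t = c * e' / 8" using c(1) e' k by (simp_all add: t_def)
    define B' where "B' = max \<bar>uO\<bar> (norm W)"
    obtain d where d: "0 < d" and near: "\<And>s t' a a'. \<bar>s\<bar> \<le> B' \<Longrightarrow> \<bar>a\<bar> \<le> B' \<Longrightarrow> \<bar>s - t'\<bar> \<le> d \<Longrightarrow> \<bar>a - a'\<bar> \<le> d \<Longrightarrow>
      \<bar>f s a - f t' a'\<bar> \<le> t"
      using jointly_continuous_uniform[OF ff_jointly_continuous(1)[OF \<nu> \<Lambda>\<rho>] t(1), of B'] by blast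
    show "\<exists>d>0. \<forall>q\<in>N. param_dist R q p < d \<longrightarrow> E_dist R (S q) (S p) < e'"
    proof (intro exI[of _ "min d (c * e' / 8)"] conjI ballI impI)
      show "0 < min d (c * e' / 8)" using d c(1) e' by simp
      fix q assume q: "q \<in> N" and dq: "param_dist R q p < min d (c * e' / 8)"
      obtain b' uO' where bq: "q = (b', uO')" by (cases q)
      note nq = ND[OF q[unfolded bq]]
      define X where "X = clamp_ext R (S q)"
      note Xq = lift[OF S[OF q[unfolded bq]], folded bq, folded X_def]
      have "0 \<le> B_norm R (\<lambda>x. b' x - b x)"
        using B_norm_diff_ge(1)[OF nq(1) nd(1) R, of 0] R by auto
      moreover have "B_norm R (\<lambda>x. b' x - b x) + \<bar>uO' - uO\<bar> < min d (c * e' / 8)"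
        using dq by (simp add: param_dist_def bp bq)
      ultimately have pq: "B_norm R (\<lambda>x. b' x - b x) < c * e' / 8" "\<bar>uO - uO'\<bar> \<le> d"
        by linarith+
      have "c/2 * norm (X - W) \<le> norm (solution_op b' uO' W - W)"
        using Xq Wp by (intro close[OF q[unfolded bq]]) auto
      also have "\<dots> = norm (solution_op b' uO' W - solution_op b uO W)" using Wp by simp
      also have "\<dots> \<le> B_norm R (\<lambda>x. b' x - b x) + 2 * kernel_const R * t"
      proof (rule parameter_error[OF nq(1) nd(1) _ less_imp_le[OF t(1)]])
        show "W \<in> E_sub R" using Wp by simp
        show "\<bar>f uO' (W x) - f uO (W x)\<bar> \<le> t" for x
          using near[of uO "W x" uO' "W x"] pq(2) d apply_le_norm[of W x]
          by (simp add: B'_def le_max_iff_disj abs_minus_commute)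
      qed
      also have "\<dots> < c * e' / 4" using pq(1) t(2) unfolding k_def by linarith
      finally have "c * norm (X - W) < c * (e' / 2)" by simp
      then have XW: "norm (X - W) < e' / 2" using c(1) by simp
      have cont: "continuous_rz R (S q)" "continuous_rz R (S p)"
        using S[OF p[unfolded bp]] S[OF q[unfolded bq]]
        by (auto simp: Q_def bp bq admissible_solution_def E_space_iff)
      have "E_dist R (S q) (S p) \<le> e' / 2"
        unfolding E_dist_le_iff[OF R cont]
      proof
        fix x assume x: "x \<in> rz_domain R"
        have "S q x - S p x = (X - W) x" using Xq Wp x by simp
        then show "\<bar>S q x - S p x\<bar> \<le> e' / 2" using apply_le_norm[of "X - W" x] XW by simp
      qed
      then show "E_dist R (S q) (S p) < e'" using e' by simp
    qed
  qed
  moreover have "(\<exists>!u. admissible_solution R \<nu> \<Lambda>\<rho> b uO u \<and> HL R \<nu> \<Lambda>\<rho> uO u \<and> E_dist R u ub \<le> \<epsilon>) \<and>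
       admissible_solution R \<nu> \<Lambda>\<rho> b uO (S (b, uO)) \<and> HL R \<nu> \<Lambda>\<rho> uO (S (b, uO)) \<and>
       E_dist R (S (b, uO)) ub \<le> \<epsilon>" if "b \<in> B_space R" "param_dist R (b, uO) (bb, uOb) \<le> \<delta>" for b uO
  proof -
    have n: "(b, uO) \<in> N" using that by (simp add: N_def)
    have "\<exists>!u. Q (b, uO) u" using Qex[OF n] Quniq[OF n] by blast
    with S[OF n] show ?thesis by (simp add: Q_def)
  qed
  ultimately show ?thesis
    using \<delta>(1) \<epsilon>(1) unfolding N_def by blast
qed

end

theorem theorem1:
  fixes A \<gamma> R uOb :: real
    and P \<Lambda> \<Lambda>\<rho> bb :: "real \<Rightarrow> real"
    and ub :: "real \<times> real \<Rightarrow> real"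
  defines "\<nu> \<equiv> polytropic_index \<gamma>"
  assumes "equation_of_state A \<gamma> \<Lambda> P"
    and "density_correction A \<gamma> P \<Lambda>\<rho>"
    and "R > 0"
    and "bb \<in> B_space R" and "uOb > 0" and "ub \<in> E_space R"
    and "admissible_solution R \<nu> \<Lambda>\<rho> bb uOb ub"
    and "HL R \<nu> \<Lambda>\<rho> uOb ub"
  shows "\<exists>\<delta>>0. \<exists>\<epsilon>>0. \<exists>S.
    (\<forall>b\<in>B_space R. \<forall>uO. param_dist R (b, uO) (bb, uOb) \<le> \<delta> \<longrightarrow>
       (\<exists>!u. admissible_solution R \<nu> \<Lambda>\<rho> b uO u \<and> HL R \<nu> \<Lambda>\<rho> uO u \<and> E_dist R u ub \<le> \<epsilon>) \<and>
       admissible_solution R \<nu> \<Lambda>\<rho> b uO (S (b, uO)) \<and> HL R \<nu> \<Lambda>\<rho> uO (S (b, uO)) \<and>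
       E_dist R (S (b, uO)) ub \<le> \<epsilon>) \<and>
    continuous_param_map R
      {(b, uO). b \<in> B_space R \<and> param_dist R (b, uO) (bb, uOb) \<le> \<delta>} S"
proof -
  have "1 < \<gamma>" "\<gamma> < 2" using assms(2) by (simp_all add: equation_of_state_def)
  then have "1 < \<nu>" by (simp add: \<nu>_def polytropic_index_def)
  moreover have "smooth_on UNIV \<Lambda>\<rho>" using assms(3) by (simp add: density_correction_def)
  ultimately interpret stellar_model R \<nu> \<Lambda>\<rho>
    using assms(4) by unfold_locales
  show ?thesis by (rule solution_near[OF assms(5,7,8,9,6)])
qed

end
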